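(* Let $k\ge 2$ be an integer and let $d_k(n)=\sum_{n_1n_2\cdots n_k=n}1$ be the $k$-divisor function, i.e. the number of ordered $k$-tuples of positive integers with product $n$. Then $\{d_k(n)\}_{n\ge 1}$ is a strong Benford sequence if and only if $k\neq 10^j$ for all positive integers $j$.
   Context: Strong Benford: Every positive real $a$ is written $a=10^{M}\sum_{j\ge 0} d_j 10^{-j}$ with $M\in\mathbb{Z}$, $1\le d_0\le 9$, $0\le d_j\le 9$ for $j\ge 1$ (usual convention: the digits are not eventually all $9$); the $d_j$ are the digits of $a$. A sequence $\{a_m\}_{m\ge1}$ of positive reals is strong Benford if for every positive integer $K$ and every digit string $S=d_0d_1\cdots d_{K-1}$ with $d_0\ne 0$, $$\lim_{N\to\infty}\frac{\#\{m\le N: \text{the first } K \text{ digits of } a_m \text{ are } d_0,\dots,d_{K-1}\}}{N}=\log_{10}(r+10^{-K+1})-\log_{10} r,\qquad r=\sum_{j=0}^{K-1}d_j10^{-j}.$$ *)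

theory Defs
  imports Complex_Main
begin

(* a = 10^M * (d 0 . d 1 d 2 ...), with a nonzero leading digit and without a tail of 9s;
   these conditions determine M and d uniquely for every a > 0.
   The series always converges because the digits are bounded. *)
definition decimal_expansion :: "real \<Rightarrow> int \<Rightarrow> (nat \<Rightarrow> nat) \<Rightarrow> bool" where
  "decimal_expansion a M d \<longleftrightarrow>
     a = 10 powi M * (\<Sum>j. real (d j) * 10 powi (- int j)) \<and>
     1 \<le> d 0 \<and> (\<forall>j. d j \<le> 9) \<and> \<not> (\<exists>J. \<forall>j\<ge>J. d j = 9)"

definition has_first_digits :: "real \<Rightarrow> nat list \<Rightarrow> bool" where
  "has_first_digits a S \<longleftrightarrow>
     (\<exists>M d. decimal_expansion a M d \<and> (\<forall>j<length S. d j = S ! j))"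

definition digit_string :: "nat list \<Rightarrow> bool" where
  "digit_string S \<longleftrightarrow> S \<noteq> [] \<and> (\<forall>j<length S. S ! j \<le> 9) \<and> S ! 0 \<noteq> 0"

definition string_value :: "nat list \<Rightarrow> real" where
  "string_value S = (\<Sum>j<length S. real (S ! j) * 10 powi (- int j))"

(* Sequences are indexed from 1; the value a 0 is irrelevant. *)
definition strong_benford :: "(nat \<Rightarrow> real) \<Rightarrow> bool" where
  "strong_benford a \<longleftrightarrow>
     (\<forall>m\<ge>1. a m > 0) \<and>
     (\<forall>S. digit_string S \<longrightarrow>
       (\<lambda>N. real (card {m \<in> {1..N}. has_first_digits (a m) S}) / real N)
         \<longlonglongrightarrow> log 10 (string_value S + 10 powi (1 - int (length S))) - log 10 (string_value S))"

(* Ordered k-tuples of positive integers are lists of length k. *)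
definition divisor_fun :: "nat \<Rightarrow> nat \<Rightarrow> nat" where
  "divisor_fun k n = card {xs :: nat list. length xs = k \<and> (\<forall>x\<in>set xs. 0 < x) \<and> prod_list xs = n}"

end

theory Submission
  imports Defs "HOL-Complex_Analysis.Complex_Analysis" "HOL-Number_Theory.Number_Theory"
    "HOL-Computational_Algebra.Squarefree"
begin

text \<open>The numbers \<open>log 10 (d\<^sub>k(n))\<close> must be shown to be equidistributed modulo 1. By Weyl's criterion
  this is a statement about the mean values of \<open>f(n) = exp (2 \<pi> i h log 10 (d\<^sub>k(n)))\<close>. Since
  \<open>d\<^sub>k(p m) = k d\<^sub>k(m)\<close> for primes \<open>p\<close> not dividing \<open>m\<close>, this function satisfies \<open>f(p m) = z f(m)\<close> with
  \<open>z = exp (2 \<pi> i h log 10 k)\<close>, and \<open>z \<noteq> 1\<close> unless \<open>k\<close> is a power of 10.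

  Weighting by \<open>ln n = \<Sum>\<^bsub>d | n\<^esub> \<Lambda>(d)\<close> and using the prime number theorem in the inner sums gives
  \<open>\<Sum>\<^bsub>n\<le>N\<^esub> f(n) = (z N / ln N) \<Sum>\<^bsub>n\<le>N\<^esub> f(n) / n + o(N)\<close>. So the mean is \<open>z\<close> times the logarithmic mean up to
  \<open>o(1)\<close>; as the latter is an average of the former, both tend to 0 when \<open>z \<noteq> 1\<close>. The prime number
  theorem is obtained by Newman's contour method.

  Conversely, if \<open>k\<close> is a power of 10, then \<open>d\<^sub>k(n)\<close> is a power of 10, with first digit 1, for every
  squarefree \<open>n\<close>, and the squarefree numbers have lower density above \<open>log 10 2\<close>.\<close>

section \<open>Chebyshev's bound\<close>

text \<open>Chebyshev's bound alone is too weak for the weighting step. Replacing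
  \<open>psi (N div m)\<close> by N / m must cost o(N ln N) in total over m <= N: the prime number
  theorem gives an error \<epsilon> N / m, which sums to \<epsilon> N ln N, whereas an error of
  order N / m would be as large as the main term. Chebyshev's bound is needed earlier, since the
  contour method works with the coefficients (psi(n) - n) / n and these must be bounded. Both kinds
  of pairs contribute only O(N), because the sum of ln n / n^2 converges. That z = 1 for some
  frequency h >= 1 forces k to be a power of 10 rests on 10 not being a proper power: k^h = 10^m
  makes k divisible by 2 and by 5, so factors 10 can be split off one by one.\<close>

lemma divisor_pairs_bij:
  "bij_betw (\<lambda>(d, m). (d * m, d)) (SIGMA d:{1..N}. {1..N div d}) (SIGMA n:{1..N::nat}. {d. d dvd n})"
proof (rule bij_betw_byWitness[where f' = "\<lambda>(n, d). (d, n div d)"])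
  show "\<forall>x\<in>SIGMA n:{1..N}. {d. d dvd n}.
      (\<lambda>(d, m). (d * m, d)) ((\<lambda>(n, d). (d, n div d)) x) = x"
    by auto
next
  show "(\<lambda>(d, m). (d * m, d)) ` (SIGMA d:{1..N}. {1..N div d}) \<subseteq> (SIGMA n:{1..N}. {d. d dvd n})"
    by (auto simp: less_eq_div_iff_mult_less_eq mult.commute)
next
  show "(\<lambda>(n, d). (d, n div d)) ` (SIGMA n:{1..N}. {d. d dvd n}) \<subseteq> (SIGMA d:{1..N}. {1..N div d})"
  proof clarsimp
    fix n d :: nat assume "Suc 0 \<le> n" "n \<le> N" "d dvd n"
    then show "Suc 0 \<le> d \<and> d \<le> N \<and> Suc 0 \<le> n div d \<and> n div d \<le> N div d"
      by (auto simp: Suc_le_eq div_le_mono div_greater_zero_iff dest: dvd_imp_le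
               intro: dvd_pos_nat order.trans)
  qed
qed auto

text \<open>A sum of Dirichlet convolutions over n <= N is a double sum over the region d m <= N,
  with m the cofactor of d.\<close>

lemma sum_divisors_swap:
  fixes F :: "nat \<Rightarrow> nat \<Rightarrow> 'a::comm_monoid_add"
  shows "(\<Sum>n=1..N. \<Sum>d | d dvd n. F d (n div d)) = (\<Sum>d=1..N. \<Sum>m=1..N div d. F d m)"
proof -
  have "(\<Sum>n=1..N. \<Sum>d | d dvd n. F d (n div d)) =
        (\<Sum>(n, d)\<in>(SIGMA n:{1..N}. {d. d dvd n}). F d (n div d))"
    by (subst sum.Sigma) auto
  also have "\<dots> = (\<Sum>(d, m)\<in>(SIGMA d:{1..N}. {1..N div d}). F d m)"
    by (rule sum.reindex_bij_betw[OF divisor_pairs_bij, symmetric, THEN trans])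
       (auto intro!: sum.cong)
  also have "\<dots> = (\<Sum>d=1..N. \<Sum>m=1..N div d. F d m)"
    by (subst sum.Sigma) auto
  finally show ?thesis .
qed

text \<open>The region d m <= N is symmetric in d and m.\<close>

lemma sum_hyperbola_swap:
  fixes F :: "nat \<Rightarrow> nat \<Rightarrow> 'a::comm_monoid_add"
  shows "(\<Sum>d=1..N. \<Sum>m=1..N div d. F d m) = (\<Sum>m=1..N. \<Sum>d=1..N div m. F d m)"
proof -
  have aux: "y \<le> N" if "Suc 0 \<le> x" "x * y \<le> N" for x y
    using that by (cases x) auto
  have "(\<Sum>d=1..N. \<Sum>m=1..N div d. F d m) = (\<Sum>d=1..N. \<Sum>m\<in>{m\<in>{1..N}. d * m \<le> N}. F d m)"
    by (intro sum.cong refl) (auto simp: less_eq_div_iff_mult_less_eq mult.commute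
             intro: aux)
  also have "\<dots> = (\<Sum>m=1..N. \<Sum>d\<in>{d\<in>{1..N}. d * m \<le> N}. F d m)"
    by (rule sum.swap_restrict) auto
  also have "\<dots> = (\<Sum>m=1..N. \<Sum>d=1..N div m. F d m)"
    by (intro sum.cong refl) (auto simp: less_eq_div_iff_mult_less_eq mult.commute
             intro: aux)
  finally show ?thesis .
qed

section \<open>Chebyshev's function and its linear bound\<close>

definition psi :: "nat \<Rightarrow> real" where
  "psi n = (\<Sum>d=1..n. mangoldt d)"

lemma psi_0 [simp]: "psi 0 = 0"
  and psi_Suc: "psi (Suc n) = psi n + mangoldt (Suc n)"
  by (simp_all add: psi_def)

lemma psi_mono: "m \<le> n \<Longrightarrow> psi m \<le> psi n"
  unfolding psi_def by (rule sum_mono2) (auto simp: mangoldt_nonneg)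

lemma psi_nonneg: "0 \<le> psi n"
  using psi_mono[of 0 n] by simp

text \<open>Legendre's formula, from summing \<open>mangoldt_sum\<close> over m <= n. Terms with d >
  n vanish because \<open>n div d\<close> is 0; the common range up to N lets the formulas for n and
  2 n be subtracted termwise.\<close>

lemma ln_fact_eq_sum_mangoldt:
  assumes "n \<le> N"
  shows "ln (fact n) = (\<Sum>d=1..N. mangoldt d * real (n div d))"
proof -
  have "ln (fact n) = (\<Sum>m=1..n. ln (real m))"
    by (induction n) (auto simp: ln_mult)
  also have "\<dots> = (\<Sum>m=1..n. \<Sum>d | d dvd m. mangoldt d)"
    by (intro sum.cong refl, subst mangoldt_sum) auto
  also have "\<dots> = (\<Sum>d=1..n. \<Sum>m=1..n div d. mangoldt d)"
    using sum_divisors_swap[of "\<lambda>d m. mangoldt d" n] .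
  also have "\<dots> = (\<Sum>d=1..n. mangoldt d * real (n div d))"
    by (simp add: mult.commute)
  also have "\<dots> = (\<Sum>d=1..N. mangoldt d * real (n div d))"
    using assms by (intro sum.mono_neutral_left) auto
  finally show ?thesis .
qed

text \<open>Chebyshev's argument with the central binomial coefficient: floor(2n/d) - 2 floor(n/d)
  is never negative and is at least 1 for n < d <= 2 n, so the left side is bounded by the logarithm
  of (2n choose n), which is at most 4^n.\<close>

lemma psi_double_le: "psi (2 * n) - psi n \<le> real n * ln 4"
proof -
  have *: "real (2 * n div d) - 2 * real (n div d) \<ge> (if d \<in> {n<..2*n} then 1 else 0)"
    if "d > 0" for d
  proof -
    have "2 * (n div d) \<le> 2 * n div d"
      using that by (simp add: less_eq_div_iff_mult_less_eq)
    moreover have "2 * n div d \<ge> 1" "n div d = 0" if "d \<in> {n<..2*n}"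
      using that by (auto simp: Suc_le_eq div_greater_zero_iff)
    ultimately show ?thesis by (auto simp: of_nat_diff)
  qed
  have "psi (2 * n) - psi n = (\<Sum>d\<in>{1..2*n} - {1..n}. mangoldt d)"
    unfolding psi_def by (subst sum_diff) auto
  also have "{1..2*n} - {1..n} = {1..2*n} \<inter> {n<..2*n}"
    by auto
  also have "(\<Sum>d\<in>{1..2*n} \<inter> {n<..2*n}. mangoldt d) =
             (\<Sum>d=1..2*n. mangoldt d * (if d \<in> {n<..2*n} then 1 else 0 :: real))"
    by (subst sum.inter_restrict) (auto intro!: sum.cong)
  also have "\<dots> \<le> (\<Sum>d=1..2*n. mangoldt d * (real (2 * n div d) - 2 * real (n div d)))"
    by (intro sum_mono mult_left_mono mangoldt_nonneg *) auto
  also have "\<dots> = ln (fact (2 * n)) - 2 * ln (fact n)"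
    by (subst (1 2) ln_fact_eq_sum_mangoldt[of _ "2 * n"])
       (auto simp: algebra_simps sum_subtractf sum_distrib_left)
  also have "\<dots> = ln (real ((2 * n) choose n))"
  proof -
    have "real ((2 * n) choose n) = fact (2 * n) / (fact n * fact n)"
      by (subst binomial_fact) auto
    thus ?thesis by (simp add: ln_div ln_mult)
  qed
  also have "\<dots> \<le> ln (4 ^ n)"
  proof -
    have "(2 * n) choose n \<le> (\<Sum>k\<le>2*n. (2 * n) choose k)"
      by (rule member_le_sum) auto
    also have "\<dots> = 4 ^ n"
      by (simp add: choose_row_sum power_mult)
    finally have "real ((2 * n) choose n) \<le> 4 ^ n"
      by (metis of_nat_le_iff of_nat_numeral of_nat_power)
    thus ?thesis by (subst ln_le_cancel_iff) auto
  qed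
  also have "\<dots> = real n * ln 4"
    by (simp add: ln_realpow)
  finally show ?thesis .
qed

text \<open>Halving works because ln 4 <= 2: psi(2 m) is at most 4 m + m ln 4 <= 6 m, and an odd
  argument adds at most ln(2 m + 1) <= 2 m. The total 8 m is within 4 n.\<close>

lemma psi_le: "psi n \<le> 4 * real n"
proof (induction n rule: less_induct)
  case (less n)
  have ln4: "ln 4 \<le> (2::real)"
    using ln_add_one_self_le_self[of 1] ln_realpow[of 2 2] by simp
  consider "n = 0" | m where "n = 2 * m" "m > 0" | m where "n = Suc (2 * m)"
    by (metis evenE gr0I oddE Suc_eq_plus1 mult_0_right)
  then show ?case
  proof cases
    case 2
    then have "psi n \<le> 4 * real m + real m * ln 4"
      using less[of m] psi_double_le[of m] by simp
    also have "\<dots> \<le> 4 * real n"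
      using 2 mult_left_mono[OF ln4, of "real m"] by simp
    finally show ?thesis .
  next
    case 3
    have "psi n = psi (2 * m) + mangoldt n"
      using 3 by (simp add: psi_Suc)
    also have "mangoldt n \<le> ln (real n)"
      by (rule mangoldt_le) (use 3 in auto)
    also have "ln (real n) \<le> 2 * real m"
      using 3 ln_add_one_self_le_self[of "2 * real m"] by (simp add: add.commute)
    also have "psi (2 * m) \<le> 4 * real m + real m * ln 4"
      using less[of m] psi_double_le[of m] 3 by simp
    finally have "psi n \<le> 4 * real m + real m * ln 4 + 2 * real m"
      by simp
    also have "\<dots> \<le> 4 * real n"
      using 3 mult_left_mono[OF ln4, of "real m"] by simp
    finally show ?thesis .
  qed auto
qed

section \<open>The zeta function near the line \<open>Re s = 1\<close>\<close>

text \<open>\<open>Zf s\<close> is \<open>(s - 1) \<zeta>(s)\<close>, continued to \<open>Re s > 0\<close>: multiply the Dirichlet series by \<open>s - 1\<close> and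
  subtract the telescoping series of \<open>n powr (1 - s) - (n + 1) powr (1 - s)\<close>. As \<open>0 powr s = 0\<close>, the
  term for \<open>n = 0\<close> contributes the value 1 of that series.\<close>

definition zeta_term :: "nat \<Rightarrow> complex \<Rightarrow> complex" where
  "zeta_term n s = (s - 1) * of_nat n powr (-s) - of_nat n powr (1 - s) + of_nat (Suc n) powr (1 - s)"

definition Zf :: "complex \<Rightarrow> complex" where
  "Zf s = (\<Sum>n. zeta_term n s)"

lemma norm_nat_powr: "norm (of_nat n powr s :: complex) = real n powr Re s"
  using norm_powr_real_powr[of "of_nat n" s] by simp

text \<open>\<open>zeta_term n s\<close> is the first-order Taylor remainder of x^(1 - s) from n to
  n + 1, hence controlled by the second derivative s (s - 1) x^(-s - 1). The condition on Re s makes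
  the modulus of that derivative largest at x = n.\<close>

lemma norm_zeta_term_le:
  assumes n: "n > 0" and s: "Re s \<ge> -1"
  shows "norm (zeta_term n s) \<le> norm s * norm (s - 1) * real n powr (-Re s - 1)"
proof -
  define S where "S = closed_segment (of_nat n :: complex) (of_nat (Suc n))"
  define f :: "nat \<Rightarrow> complex \<Rightarrow> complex" where
    "f i x = (if i = 0 then x powr (1 - s) else if i = 1 then (1 - s) * x powr (-s)
              else (1 - s) * (-s) * x powr (-s - 1))" for i x
  have S: "\<exists>t. x = of_real t \<and> real n \<le> t" if "x \<in> S" for x
  proof -
    from that have "x \<in> of_real ` closed_segment (real n) (real (Suc n))"
      using closed_segment_of_real[of "real n" "real (Suc n)"] unfolding S_def
      by (metis of_real_of_nat_eq)
    thus ?thesis by (auto simp: closed_segment_eq_real_ivl)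
  qed
  have "cmod (f 0 (of_nat (Suc n)) - (\<Sum>i\<le>1. f i (of_nat n) * (of_nat (Suc n) - of_nat n) ^ i / fact i))
          \<le> norm s * norm (s - 1) * real n powr (-Re s - 1) * cmod (of_nat (Suc n) - of_nat n) ^ Suc 1 / fact 1"
  proof (rule complex_Taylor[of S])
    fix i x assume "x \<in> S" "i \<le> (1::nat)"
    obtain t where t: "x = of_real t" "real n \<le> t" using S[OF \<open>x \<in> S\<close>] by blast
    have x: "x \<notin> \<real>\<^sub>\<le>\<^sub>0" using t n by simp
    consider "i = 0" | "i = 1" using \<open>i \<le> 1\<close> by linarith
    thus "(f i has_field_derivative f (Suc i) x) (at x within S)"
    proof cases
      case 1
      show ?thesis using x unfolding 1 f_def
        by (auto intro!: derivative_eq_intros simp: mult_ac)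
    next
      case 2
      show ?thesis using x unfolding 2 f_def
        by (auto intro!: derivative_eq_intros simp: mult_ac)
    qed
  next
    fix x assume "x \<in> S"
    obtain t where t: "x = of_real t" "real n \<le> t" using S[OF \<open>x \<in> S\<close>] by blast
    have "norm (f 2 x) = norm s * norm (s - 1) * t powr (-Re s - 1)"
      using t n by (simp add: f_def norm_mult norm_powr_real_powr norm_minus_commute)
    also have "t powr (-Re s - 1) \<le> real n powr (-Re s - 1)"
      by (rule powr_mono2') (use t n s in auto)
    finally show "norm (f (Suc 1) x) \<le> norm s * norm (s - 1) * real n powr (-Re s - 1)"
      by (simp add: mult_left_mono numeral_2_eq_2)
  qed (auto simp: S_def)
  also have "f 0 (of_nat (Suc n)) - (\<Sum>i\<le>1. f i (of_nat n) * (of_nat (Suc n) - of_nat n) ^ i / fact i)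
              = zeta_term n s"
    by (simp add: f_def zeta_term_def algebra_simps)
  finally show ?thesis by simp
qed

lemma holomorphic_zeta_term: "zeta_term n holomorphic_on A"
  unfolding zeta_term_def
  by (intro holomorphic_on_add holomorphic_on_diff holomorphic_on_mult holomorphic_on_powr_right
        holomorphic_on_minus holomorphic_on_ident holomorphic_on_const)

text \<open>The terms are O(n^(a - Re s - 1)) locally uniformly, so the M-test applies to the right
  of Re s = a. The weights cover both \<open>Zf\<close> (weights 1, a = 0) and the series weighted
  by \<open>psi_error\<close> (a = 1).\<close>

lemma zeta_term_series:
  fixes b :: "nat \<Rightarrow> complex"
  assumes a: "a \<ge> 0" and b: "\<And>n. n > 0 \<Longrightarrow> norm (b n) \<le> C * real n powr a"
  shows "(\<lambda>s. \<Sum>n. b n * zeta_term n s) holomorphic_on {s. Re s > a}"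
    and "Re s > a \<Longrightarrow> summable (\<lambda>n. b n * zeta_term n s)"
proof -
  define S where "S = {s. Re s > a}"
  have S: "open S" unfolding S_def by (rule open_halfspace_Re_gt)
  have der: "((\<lambda>s. b n * zeta_term n s) has_field_derivative deriv (\<lambda>s. b n * zeta_term n s) x) (at x)"
    if "x \<in> S" for n x
    by (rule holomorphic_derivI[OF _ S that]) (intro holomorphic_on_mult holomorphic_on_const holomorphic_zeta_term)
  have *: "\<exists>d h. 0 < d \<and> summable h \<and>
         (\<forall>\<^sub>F n in sequentially. \<forall>y\<in>ball x d \<inter> S. norm (b n * zeta_term n y) \<le> h n)"
    if "x \<in> S" for x
  proof -
    \<comment> \<open>Half the distance to the line Re s = a: on the ball Re y >= a + d, so the
      exponent a - Re y - 1 is at most -1 - d.\<close>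
    define d where "d = (Re x - a) / 2"
    define h where "h = (\<lambda>n. C * ((norm x + d) * (norm x + d + 1)) * real n powr (-1 - d))"
    have C: "C \<ge> 0" using b[of 1] norm_ge_zero[of "b 1"] by (simp del: norm_ge_zero)
    have d: "d > 0" using that by (simp add: d_def S_def)
    have "summable (\<lambda>n. real n powr (-1 - d))"
      using d by (subst summable_real_powr_iff) auto
    hence "summable h" unfolding h_def by (rule summable_mult)
    moreover have "\<forall>\<^sub>F n in sequentially. \<forall>y\<in>ball x d \<inter> S. norm (b n * zeta_term n y) \<le> h n"
      using eventually_gt_at_top[of 0]
    proof eventually_elim
      case (elim n)
      show ?case
      proof
        fix y assume y: "y \<in> ball x d \<inter> S"
        have "\<bar>Re x - Re y\<bar> \<le> norm (x - y)"
          using abs_Re_le_cmod[of "x - y"] by simp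
        also have xy: "norm (x - y) < d" using y by (simp add: dist_norm)
        finally have re: "Re y \<ge> a + d" by (auto simp: d_def field_simps abs_if split: if_splits)
        have ny: "norm y \<le> norm x + d"
          using norm_triangle_ineq3[of x y] xy by linarith
        have ny1: "norm (y - 1) \<le> norm x + d + 1"
          using norm_triangle_ineq4[of y 1] ny by simp
        have "norm (b n * zeta_term n y) \<le> (C * real n powr a) * (norm y * norm (y - 1) * real n powr (-Re y - 1))"
          using b[OF elim] norm_zeta_term_le[of n y] elim re a d C
          by (auto simp: norm_mult intro!: mult_mono)
        also have "\<dots> = C * (norm y * norm (y - 1)) * real n powr (a - Re y - 1)"
          using elim by (simp add: powr_add powr_diff powr_minus field_simps)
        also have "\<dots> \<le> h n"
          unfolding h_def using C ny ny1 d re elim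
          by (intro mult_mono powr_mono) auto
        finally show "norm (b n * zeta_term n y) \<le> h n" .
      qed
    qed
    ultimately show ?thesis using d by blast
  qed
  obtain g g' where g: "\<And>x. x \<in> S \<Longrightarrow> (\<lambda>n. b n * zeta_term n x) sums g x \<and>
      (\<lambda>n. deriv (\<lambda>s. b n * zeta_term n s) x) sums g' x \<and> (g has_field_derivative g' x) (at x)"
    using series_and_derivative_comparison_local[OF S der *] by blast
  show "Re s > a \<Longrightarrow> summable (\<lambda>n. b n * zeta_term n s)"
    using g[of s] by (auto simp: S_def sums_iff)
  have "g holomorphic_on S"
    using g by (auto simp: holomorphic_on_open[OF S])
  moreover have "g s = (\<Sum>n. b n * zeta_term n s)" if "s \<in> S" for s
    using g[OF that] by (simp add: sums_iff)
  ultimately show "(\<lambda>s. \<Sum>n. b n * zeta_term n s) holomorphic_on {s. Re s > a}"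
    unfolding S_def by (rule holomorphic_transform) simp
qed

lemma Zf_holomorphic: "Zf holomorphic_on {s. Re s > 0}"
  and Zf_sums: "Re s > 0 \<Longrightarrow> (\<lambda>n. zeta_term n s) sums Zf s"
proof -
  note * = zeta_term_series[where a = 0 and b = "\<lambda>_. 1" and C = 1]
  show "Zf holomorphic_on {s. Re s > 0}"
    using *(1) unfolding Zf_def[abs_def] by simp
  show "Re s > 0 \<Longrightarrow> (\<lambda>n. zeta_term n s) sums Zf s"
    using *(2)[of s] summable_sums[of "\<lambda>n. zeta_term n s"] unfolding Zf_def by simp
qed

text \<open>Only the term n = 0 survives, as \<open>0 powr 0\<close> is 0 and
  \<open>1 powr 0\<close> is 1. The value is the residue of zeta at 1.\<close>

lemma Zf_1 [simp]: "Zf 1 = 1"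
proof -
  have "zeta_term n 1 = (if n = 0 then 1 else 0)" for n
    by (auto simp: zeta_term_def powr_def simp del: of_nat_Suc)
  hence "(\<lambda>n. zeta_term n 1) sums 1"
    using sums_single[of 0 "\<lambda>_. 1::complex"] by simp
  thus ?thesis using Zf_sums[of 1] sums_unique2 by fastforce
qed

lemma nat_powr_tendsto_0:
  assumes "Re s < 0"
  shows "(\<lambda>n. of_nat n powr s :: complex) \<longlonglongrightarrow> 0"
proof (rule tendsto_norm_zero_cancel)
  have "((\<lambda>n. real n powr Re s) \<longlongrightarrow> 0) sequentially"
    by (intro tendsto_neg_powr assms filterlim_real_sequentially)
  thus "(\<lambda>n. norm (of_nat n powr s :: complex)) \<longlonglongrightarrow> 0"
    by (simp add: norm_nat_powr)
qed

lemma zeta_sums: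
  assumes "Re s > 1"
  shows "(\<lambda>n. of_nat n powr (-s)) sums (Zf s / (s - 1))"
proof -
  have s: "s \<noteq> 1" using assms by auto
  \<comment> \<open>Both ends of the telescoping series are 0: the limit because Re s > 1, the start
    because 0 to any power is 0. So only the series of (s - 1) n^(-s) remains.\<close>
  have "(\<lambda>n. of_nat (Suc n) powr (1 - s) - of_nat n powr (1 - s)) sums (0 - of_nat 0 powr (1 - s) :: complex)"
    by (rule telescope_sums, rule nat_powr_tendsto_0) (use assms in auto)
  from sums_diff[OF Zf_sums[of s] this] have "(\<lambda>n. (s - 1) * of_nat n powr (-s)) sums Zf s"
    using assms by (simp add: zeta_term_def)
  from sums_divide[OF this, of "s - 1"] show ?thesis using s by simp
qed

section \<open>The logarithmic derivative of zeta\<close>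

definition Lf :: "complex \<Rightarrow> complex" where
  "Lf s = (\<Sum>n. mangoldt n * of_nat n powr (-s))"

text \<open>Termwise differentiation of \<open>zeta_sums\<close>; the right side is minus the
  derivative of Zf s / (s - 1).\<close>

lemma ln_series_sums:
  assumes s: "Re s > 1"
  shows "(\<lambda>n. of_real (ln (real n)) * of_nat n powr (-s)) sums (Zf s / (s - 1) ^ 2 - deriv Zf s / (s - 1))"
proof -
  define S where "S = {s. Re s > 1}"
  have S: "open S" unfolding S_def by (rule open_halfspace_Re_gt)
  have sS: "s \<in> S" using s by (simp add: S_def)
  have der: "((\<lambda>s. of_nat n powr (-s)) has_field_derivative
               (- of_real (ln (real n)) * of_nat n powr (-x))) (at x)" for n and x :: complex
  proof (cases "n = 0")
    case False
    have "Ln (of_nat n) = of_real (ln (real n))"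
      using Ln_of_nat[of n] False by simp
    moreover have "(uminus has_field_derivative - 1) (at x)"
      by (auto intro!: derivative_eq_intros)
    ultimately show ?thesis using False
      using DERIV_chain'[of uminus "-1" x UNIV "\<lambda>z. of_nat n powr z" "Ln (of_nat n) * of_nat n powr (-x)"]
        has_field_derivative_powr_right[of "of_nat n" "-x"] by simp
  qed simp
  have *: "\<exists>d h. 0 < d \<and> summable h \<and>
         (\<forall>\<^sub>F n in sequentially. \<forall>y\<in>ball x d \<inter> S. norm (of_nat n powr (-y) :: complex) \<le> h n)"
    if "x \<in> S" for x
  proof -
    define d where "d = (Re x - 1) / 2"
    have d: "d > 0" using that by (simp add: d_def S_def)
    have "summable (\<lambda>n. real n powr (-1 - d))"
      using d by (subst summable_real_powr_iff) auto
    moreover have "\<forall>\<^sub>F n in sequentially. \<forall>y\<in>ball x d \<inter> S. norm (of_nat n powr (-y) :: complex) \<le> real n powr (-1 - d)"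
      using eventually_gt_at_top[of 0]
    proof eventually_elim
      case (elim n)
      show ?case
      proof
        fix y assume y: "y \<in> ball x d \<inter> S"
        have "\<bar>Re x - Re y\<bar> \<le> norm (x - y)"
          using abs_Re_le_cmod[of "x - y"] by simp
        also have "norm (x - y) < d" using y by (simp add: dist_norm)
        finally have re: "Re y \<ge> 1 + d" by (auto simp: d_def field_simps abs_if split: if_splits)
        show "norm (of_nat n powr (-y) :: complex) \<le> real n powr (-1 - d)"
          using elim re by (auto simp: norm_nat_powr intro!: powr_mono)
      qed
    qed
    ultimately show ?thesis using d by blast
  qed
  obtain g g' where g: "\<And>x. x \<in> S \<Longrightarrow> (\<lambda>n. of_nat n powr (-x)) sums g x \<and>
      (\<lambda>n. - of_real (ln (real n)) * of_nat n powr (-x)) sums g' x \<and> (g has_field_derivative g' x) (at x)"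
    using series_and_derivative_comparison_local[OF S der *] by blast
  have g_eq: "g x = Zf x / (x - 1)" if "x \<in> S" for x
    using g[OF that] zeta_sums[of x] that sums_unique2 unfolding S_def by blast
  have "(Zf has_field_derivative deriv Zf s) (at s)"
    using s by (intro holomorphic_derivI[OF Zf_holomorphic] open_halfspace_Re_gt) auto
  hence "((\<lambda>x. Zf x / (x - 1)) has_field_derivative (deriv Zf s * (s - 1) - Zf s) / (s - 1) ^ 2) (at s)"
    using s by (auto intro!: derivative_eq_intros simp: power2_eq_square)
  moreover have "((\<lambda>x. Zf x / (x - 1)) has_field_derivative g' s) (at s)"
    by (rule has_field_derivative_transform_within_open[OF _ S sS g_eq]) (use g[OF sS] in auto)
  ultimately have g': "g' s = (deriv Zf s * (s - 1) - Zf s) / (s - 1) ^ 2"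
    using DERIV_unique by blast
  have "s \<noteq> 1" using s by auto
  hence "- g' s = Zf s / (s - 1) ^ 2 - deriv Zf s / (s - 1)"
    unfolding g' by (simp add: diff_divide_distrib power2_eq_square)
  moreover have "(\<lambda>n. of_real (ln (real n)) * of_nat n powr (-s)) sums (- g' s)"
    using g[OF sS] sums_minus[of "\<lambda>n. - of_real (ln (real n)) * of_nat n powr (-s)" "g' s"] by simp
  ultimately show ?thesis by simp
qed

lemma summable_ln_powr:
  assumes "x > 1"
  shows "summable (\<lambda>n. ln (real n) * real n powr (-x))"
proof -
  have "summable (\<lambda>n. Re (of_real (ln (real n)) * of_nat n powr (-of_real x)))"
    using ln_series_sums[of "of_real x"] assms by (intro summable_Re) (auto simp: sums_iff)
  moreover have "of_real (ln (real n)) * of_nat n powr (-of_real x) = complex_of_real (ln (real n) * real n powr (-x))" for n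
    using powr_of_real[of "real n" "-x"] by simp
  ultimately show ?thesis by simp
qed

lemma mangoldt_le_ln: "mangoldt n \<le> ln (real n)"
  by (cases "n = 0") (auto intro: mangoldt_le)

lemma summable_mangoldt:
  assumes "x > 1"
  shows "summable (\<lambda>n. mangoldt n * real n powr (-x))"
  by (rule summable_comparison_test'[OF summable_ln_powr[OF assms]])
     (auto simp: abs_mult mangoldt_nonneg intro!: mult_right_mono mangoldt_le_ln)

lemma norm_mangoldt_term:
  "norm (mangoldt n * of_nat n powr (-s) :: complex) = mangoldt n * real n powr (-Re s)"
  by (simp add: norm_mult norm_nat_powr)

lemma Lf_sums:
  assumes "Re s > 1"
  shows "(\<lambda>n. mangoldt n * of_nat n powr (-s)) sums Lf s"
  unfolding Lf_def
  by (rule summable_sums, rule summable_norm_cancel)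
     (use summable_mangoldt[OF assms] in \<open>simp add: norm_mangoldt_term\<close>)

lemma div_tendsto_at_top:
  assumes "k > (0::nat)"
  shows "filterlim (\<lambda>n. n div k) at_top at_top"
  unfolding filterlim_at_top
proof
  fix Z
  show "\<forall>\<^sub>F n in at_top. Z \<le> n div k"
    using eventually_ge_at_top[of "Z * k"]
    by eventually_elim (use assms in \<open>simp add: less_eq_div_iff_mult_less_eq\<close>)
qed

text \<open>Comes from ln n being the sum of \<open>mangoldt d\<close> over d | n, that is -zeta' =
  Lf zeta. The product form avoids dividing by \<open>Zf\<close>, whose nonvanishing is derived
  later from this identity.\<close>

lemma Lf_times_Zf:
  assumes s: "Re s > 1"
  shows "Lf s * Zf s = Zf s / (s - 1) - deriv Zf s"
proof -
  define P where "P = (\<lambda>M. \<Sum>m=1..M. of_nat m powr (-s) :: complex)"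
  define B where "B = (\<Sum>m. real m powr (-Re s))"
  \<comment> \<open>Instead of multiplying two series, the partial sum up to N is written as a
    series in d with inner sums \<open>P (N div d)\<close>. Each inner sum tends to zeta and is
    bounded by \<open>B\<close>, so Tannery's theorem gives the limit.\<close>
  define a where "a = (\<lambda>d N. mangoldt d * of_nat d powr (-s) * P (N div d))"
  have sm: "summable (\<lambda>n. real n powr (-Re s))"
    using s by (subst summable_real_powr_iff) auto
  have P0: "P M = (\<Sum>m<Suc M. of_nat m powr (-s))" for M
    unfolding P_def by (rule sum.mono_neutral_left) auto
  have "(\<lambda>M. P M) \<longlonglongrightarrow> Zf s / (s - 1)"
    using zeta_sums[OF s] unfolding sums_def P0 by (rule LIMSEQ_Suc)
  hence P: "(\<lambda>N. P (N div k)) \<longlonglongrightarrow> Zf s / (s - 1)" if "k > 0" for k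
    using filterlim_compose[OF _ div_tendsto_at_top[OF that]] by blast
  have P_le: "norm (P M) \<le> B" for M
  proof -
    have "norm (P M) \<le> (\<Sum>m=1..M. real m powr (-Re s))"
      unfolding P_def by (rule order.trans[OF norm_sum]) (simp add: norm_nat_powr)
    also have "\<dots> \<le> B"
      unfolding B_def by (rule sum_le_suminf[OF sm]) auto
    finally show ?thesis .
  qed
  have "(\<Sum>n=1..N. of_real (ln (real n)) * of_nat n powr (-s)) = (\<Sum>d. a d N)" for N
  proof -
    have "(\<Sum>n=1..N. of_real (ln (real n)) * of_nat n powr (-s)) =
          (\<Sum>n=1..N. \<Sum>d | d dvd n. mangoldt d * of_nat d powr (-s) * of_nat (n div d) powr (-s) :: complex)"
    proof (rule sum.cong[OF refl])
      fix n assume n: "n \<in> {1..N}"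
      have "of_nat n powr (-s) = (of_nat d powr (-s) * of_nat (n div d) powr (-s) :: complex)" if "d dvd n" for d
      proof -
        have "of_nat n = (of_nat d * of_nat (n div d) :: complex)"
          using that by (metis dvd_mult_div_cancel of_nat_mult)
        thus ?thesis using powr_times_real[of "of_nat d" "of_nat (n div d)" "-s"] by simp
      qed
      hence "(\<Sum>d | d dvd n. mangoldt d * of_nat d powr (-s) * of_nat (n div d) powr (-s) :: complex) =
             (\<Sum>d | d dvd n. mangoldt d) * of_nat n powr (-s)"
        by (simp add: sum_distrib_right mult.assoc)
      also have "(\<Sum>d | d dvd n. mangoldt d) = complex_of_real (ln (real n))"
        using n by (subst mangoldt_sum) auto
      finally show "of_real (ln (real n)) * of_nat n powr (-s) =
          (\<Sum>d | d dvd n. mangoldt d * of_nat d powr (-s) * of_nat (n div d) powr (-s) :: complex)" by simp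
    qed
    also have "\<dots> = (\<Sum>d=1..N. \<Sum>m=1..N div d. mangoldt d * of_nat d powr (-s) * of_nat m powr (-s))"
      by (rule sum_divisors_swap)
    also have "\<dots> = (\<Sum>d=1..N. a d N)"
      unfolding a_def P_def by (simp add: sum_distrib_left)
    also have "\<dots> = (\<Sum>d. a d N)"
      by (rule suminf_finite[symmetric]) (auto simp: a_def P_def not_le Suc_le_eq)
    finally show ?thesis .
  qed
  moreover have "(\<lambda>N. \<Sum>n=1..N. of_real (ln (real n)) * of_nat n powr (-s)) \<longlonglongrightarrow>
                   Zf s / (s - 1) ^ 2 - deriv Zf s / (s - 1)"
  proof -
    have "(\<Sum>n=1..N. of_real (ln (real n)) * of_nat n powr (-s)) =
          (\<Sum>n<Suc N. of_real (ln (real n)) * of_nat n powr (-s) :: complex)" for N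
      by (rule sum.mono_neutral_left) auto
    thus ?thesis using LIMSEQ_Suc[OF ln_series_sums[OF s, unfolded sums_def]] by simp
  qed
  moreover have "(\<lambda>N. \<Sum>d. a d N) \<longlonglongrightarrow> (\<Sum>d. mangoldt d * of_nat d powr (-s) * (Zf s / (s - 1)))"
  proof (rule tannerys_theorem[THEN conjunct2, THEN conjunct2])
    show "(\<lambda>N. a k N) \<longlonglongrightarrow> mangoldt k * of_nat k powr (-s) * (Zf s / (s - 1))" for k
      unfolding a_def using tendsto_mult_left[OF P[of k]] by (cases "k = 0") simp_all
    show "\<forall>\<^sub>F (k, n) in sequentially \<times>\<^sub>F sequentially. norm (a k n) \<le> mangoldt k * real k powr (-Re s) * B"
      using P_le by (intro always_eventually)
        (auto simp: a_def norm_mult norm_nat_powr mangoldt_nonneg intro!: mult_left_mono mult_nonneg_nonneg)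
    show "summable (\<lambda>k. mangoldt k * real k powr (-Re s) * B)"
      by (intro summable_mult2 summable_mangoldt s)
  qed auto
  moreover have "(\<Sum>d. mangoldt d * of_nat d powr (-s) * (Zf s / (s - 1))) = Lf s * (Zf s / (s - 1))"
    using sums_mult2[OF Lf_sums[OF s], of "Zf s / (s - 1)"] by (simp add: sums_iff)
  ultimately have "Zf s / (s - 1) ^ 2 - deriv Zf s / (s - 1) = Lf s * (Zf s / (s - 1))"
    using LIMSEQ_unique by fastforce
  moreover have "l * z = z / c - d" if "c \<noteq> 0" "z / c ^ 2 - d / c = l * (z / c)" for c d l z :: complex
  proof -
    have "l * z = c * (z / c ^ 2 - d / c)" unfolding that(2) using that(1) by simp
    also have "\<dots> = z / c - d" using that(1) by (simp add: right_diff_distrib power2_eq_square)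
    finally show ?thesis .
  qed
  moreover have "s - 1 \<noteq> 0" using s by auto
  ultimately show ?thesis by blast
qed

section \<open>Nonvanishing for Re s >= 1\<close>

lemma Zf_factor:
  assumes "Re s0 > 0"
  shows "\<exists>(n::nat) g r. (n = 0 \<longleftrightarrow> Zf s0 \<noteq> 0) \<and> r > 0 \<and> g holomorphic_on ball s0 r \<and>
           (\<forall>w\<in>ball s0 r. Zf w = g w * (w - s0) ^ n \<and> g w \<noteq> 0)"
proof -
  define n where "n = zorder Zf s0"
  define g where "g = zor_poly Zf s0"
  have "(if Zf s0 = 0 then n > 0 else n = 0) \<and> (\<exists>r. r > 0 \<and> cball s0 r \<subseteq> {s. Re s > 0} \<and>
      g holomorphic_on cball s0 r \<and> (\<forall>w\<in>cball s0 r. Zf w = g w * (w - s0) ^ nat n \<and> g w \<noteq> 0))"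
    unfolding n_def g_def
  proof (rule zorder_exist_zero)
    show "connected {s::complex. Re s > 0}"
      by (intro convex_connected convex_halfspace_Re_gt)
    show "\<exists>w\<in>{s. Re s > 0}. Zf w \<noteq> 0"
      by (rule bexI[of _ 1]) auto
  qed (use assms in \<open>auto intro: Zf_holomorphic open_halfspace_Re_gt\<close>)
  then obtain r where r: "if Zf s0 = 0 then n > 0 else n = 0" "r > 0" "g holomorphic_on cball s0 r"
     "\<And>w. w \<in> cball s0 r \<Longrightarrow> Zf w = g w * (w - s0) ^ nat n \<and> g w \<noteq> 0" by blast
  have "g holomorphic_on ball s0 r"
    by (rule holomorphic_on_subset[OF r(3)]) auto
  moreover have "nat n = 0 \<longleftrightarrow> Zf s0 \<noteq> 0" using r(1) by (auto split: if_splits)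
  ultimately show ?thesis using r(2,4)
    by (intro exI[of _ "nat n"] exI[of _ g] exI[of _ r]) auto
qed

text \<open>The residue of \<open>Lf\<close> at a zero of order \<open>n\<close> of \<open>Zf\<close> is \<open>-n\<close>, as \<open>Lf\<close> is minus the
  logarithmic derivative of the zeta function.\<close>

lemma Lf_residue:
  assumes "Re s0 \<ge> 1"
  obtains n :: nat where "n = 0 \<longleftrightarrow> Zf s0 \<noteq> 0"
    "((\<lambda>e. of_real e * Lf (s0 + of_real e)) \<longlongrightarrow> of_bool (s0 = 1) - of_nat n) (at_right 0)"
proof -
  have pos: "Re s0 > 0" using assms by simp
  obtain n :: nat and g r where n: "n = 0 \<longleftrightarrow> Zf s0 \<noteq> 0" and r: "r > 0" and g: "g holomorphic_on ball s0 r"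
    "\<And>w. w \<in> ball s0 r \<Longrightarrow> Zf w = g w * (w - s0) ^ n" "\<And>w. w \<in> ball s0 r \<Longrightarrow> g w \<noteq> 0"
    using Zf_factor[OF pos] by metis
  have dg: "deriv g holomorphic_on ball s0 r"
    by (rule holomorphic_deriv[OF g(1)]) auto
  have lim_e: "((\<lambda>e. s0 + of_real e) \<longlongrightarrow> s0) (at_right (0::real))"
    by (auto intro!: tendsto_eq_intros)
  have g_lim: "((\<lambda>e. g (s0 + of_real e)) \<longlongrightarrow> g s0) (at_right (0::real))"
    using isCont_tendsto_compose[OF _ lim_e, of g] holomorphic_on_imp_continuous_on[OF g(1)] r
    by (auto simp: continuous_on_eq_continuous_at)
  have dg_lim: "((\<lambda>e. deriv g (s0 + of_real e)) \<longlongrightarrow> deriv g s0) (at_right (0::real))"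
    using isCont_tendsto_compose[OF _ lim_e, of "deriv g"] holomorphic_on_imp_continuous_on[OF dg] r
    by (auto simp: continuous_on_eq_continuous_at)
  have one_lim: "((\<lambda>e. of_real e / (s0 + of_real e - 1)) \<longlongrightarrow> (of_bool (s0 = 1) :: complex)) (at_right (0::real))"
  proof (cases "s0 = 1")
    case True
    have "eventually (\<lambda>e. of_real e / (s0 + of_real e - 1) = (1::complex)) (at_right (0::real))"
      using eventually_at_right_less[of 0] by eventually_elim (use True in auto)
    thus ?thesis using True by (simp add: tendsto_eventually)
  next
    case False
    thus ?thesis by (auto intro!: tendsto_eq_intros)
  qed
  \<comment> \<open>With Zf w = g w (w - s0)^n at w = s0 + e, \<open>Lf_times_Zf\<close> gives Lf w
    = 1 / (w - 1) - g'(w) / g(w) - n / e. Multiplying by e leaves three terms with known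
    limits.\<close>
  have "((\<lambda>e. of_real e / (s0 + of_real e - 1) - of_nat n - of_real e * (deriv g (s0 + of_real e) / g (s0 + of_real e))) \<longlongrightarrow>
     of_bool (s0 = 1) - of_nat n - of_real 0 * (deriv g s0 / g s0)) (at_right (0::real))"
    by (intro tendsto_intros one_lim g_lim dg_lim g(3)) (use r in auto)
  hence lim: "((\<lambda>e. of_real e / (s0 + of_real e - 1) - of_nat n - of_real e * (deriv g (s0 + of_real e) / g (s0 + of_real e))) \<longlongrightarrow>
     of_bool (s0 = 1) - of_nat n) (at_right (0::real))" by simp
  have "eventually (\<lambda>e. e \<in> {0<..<r}) (at_right (0::real))"
    using r by (intro eventually_at_right_real) auto
  hence "eventually (\<lambda>e. of_real e / (s0 + of_real e - 1) - of_nat n - of_real e * (deriv g (s0 + of_real e) / g (s0 + of_real e))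
            = of_real e * Lf (s0 + of_real e)) (at_right (0::real))"
  proof eventually_elim
    case (elim e)
    define w where "w = s0 + of_real e"
    have w: "w \<in> ball s0 r" "w - s0 = of_real e" "of_real e \<noteq> (0::complex)"
      using elim by (auto simp: w_def dist_norm)
    have Re_w: "Re w > 1" using assms elim by (simp add: w_def)
    hence w1: "w \<noteq> 1" by auto
    have "((\<lambda>w. g w * (w - s0) ^ n) has_field_derivative
            (deriv g w * (w - s0) ^ n + g w * (of_nat n * (w - s0) ^ (n - 1)))) (at w)"
      by (auto intro!: derivative_eq_intros holomorphic_derivI[OF g(1)] w)
    hence "(Zf has_field_derivative (deriv g w * (w - s0) ^ n + g w * (of_nat n * (w - s0) ^ (n - 1)))) (at w)"
      by (rule has_field_derivative_transform_within_open[of _ _ _ "ball s0 r"]) (use g w in auto)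
    hence dZ: "deriv Zf w = deriv g w * (w - s0) ^ n + g w * (of_nat n * (w - s0) ^ (n - 1))"
      by (rule DERIV_imp_deriv)
    define E where "E = (of_real e :: complex)"
    have "of_nat n * E ^ (n - 1) = of_nat n * E ^ n / E"
      using w by (cases n) (auto simp: E_def)
    hence "deriv Zf w = deriv g w * E ^ n + g w * (of_nat n * E ^ n / E)"
      using dZ w by (simp add: E_def)
    moreover have "Zf w = g w * E ^ n" using g(2)[OF w(1)] w by (simp add: E_def)
    moreover note Lf_times_Zf[OF Re_w]
    ultimately have "Lf w * (g w * E ^ n) = (g w * E ^ n) / (w - 1) - deriv g w * E ^ n - g w * (of_nat n * E ^ n / E)"
      by (simp add: algebra_simps)
    hence "E ^ n * (Lf w * g w) = E ^ n * (g w / (w - 1) - deriv g w - g w * of_nat n / E)"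
      by (simp add: algebra_simps)
    hence "Lf w * g w = g w / (w - 1) - deriv g w - g w * of_nat n / E"
      using w by (simp add: E_def)
    moreover have "g w \<noteq> 0" using g w by auto
    ultimately have "Lf w = (g w / (w - 1) - deriv g w - g w * of_nat n / E) / g w"
      by (simp add: eq_divide_eq)
    also have "\<dots> = 1 / (w - 1) - deriv g w / g w - of_nat n / E"
      using \<open>g w \<noteq> 0\<close> by (simp add: diff_divide_distrib)
    finally have "E * Lf w = E * (1 / (w - 1) - deriv g w / g w - of_nat n / E)" by simp
    also have "\<dots> = E / (w - 1) - E * (deriv g w / g w) - of_nat n"
      using w(3) unfolding E_def[symmetric] by (simp add: right_diff_distrib)
    finally have "E * Lf w = E / (w - 1) - of_nat n - E * (deriv g w / g w)" by simp
    thus ?case by (simp add: w_def E_def)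
  qed
  from Lim_transform_eventually[OF lim this] n show ?thesis by (intro that[of n]) auto
qed

text \<open>The coefficients \<open>mangoldt n\<close> are nonnegative, so the real axis carries the
  largest value. This keeps \<open>Lf\<close> bounded as a point with Re s > 1 is approached from
  the right, which excludes zeros there.\<close>

lemma Lf_norm_le: "Re s > 1 \<Longrightarrow> Re s \<le> Re s' \<Longrightarrow> norm (Lf s') \<le> norm (Lf (of_real (Re s)))"
proof -
  assume s: "Re s > 1" "Re s \<le> Re s'"
  have sm: "summable (\<lambda>n. mangoldt n * real n powr (-Re s))" using s by (intro summable_mangoldt)
  have le: "norm (mangoldt n * of_nat n powr (-s') :: complex) \<le> mangoldt n * real n powr (-Re s)" for n
    unfolding norm_mangoldt_term using s
    by (cases "n = 0") (auto intro!: mult_left_mono powr_mono mangoldt_nonneg)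
  have "norm (Lf s') \<le> (\<Sum>n. mangoldt n * real n powr (-Re s))"
    unfolding Lf_def by (rule norm_suminf_le[OF le sm])
  also have "Lf (of_real (Re s)) = of_real (\<Sum>n. mangoldt n * real n powr (-Re s))"
  proof -
    have "(\<lambda>n. of_real (mangoldt n * real n powr (-Re s)) :: complex) sums of_real (\<Sum>n. mangoldt n * real n powr (-Re s))"
      using sm by (intro sums_of_real summable_sums)
    also have "(\<lambda>n. of_real (mangoldt n * real n powr (-Re s))) = (\<lambda>n. mangoldt n * of_nat n powr (- of_real (Re s)) :: complex)"
      using powr_of_real[of "real n" "-Re s" for n] by (intro ext) simp
    finally show ?thesis unfolding Lf_def by (simp only: sums_iff)
  qed
  hence "(\<Sum>n. mangoldt n * real n powr (-Re s)) \<le> norm (Lf (of_real (Re s)))"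
    by simp
  finally show ?thesis .
qed

text \<open>Real parts give nonnegative weights times 3 + 4 cos u + cos(2 u) = 2 (1 + cos u)^2,
  where u = t ln n.\<close>

lemma three_four_one:
  assumes "x > 1"
  shows "0 \<le> 3 * Re (Lf (of_real x)) + 4 * Re (Lf (of_real x + \<i> * of_real t)) + Re (Lf (of_real x + \<i> * of_real (2 * t)))"
proof -
  define T where "T = (\<lambda>u n. Re (mangoldt n * of_nat n powr (-(of_real x + \<i> * of_real u))))"
  have sums: "T u sums Re (Lf (of_real x + \<i> * of_real u))" for u
    unfolding T_def by (intro sums_Re Lf_sums) (use assms in auto)
  have T: "T u n = mangoldt n * real n powr (-x) * cos (u * ln (real n))" for u n
  proof (cases "n = 0")
    case False
    have "T u n = mangoldt n * Re (of_nat n powr (-(of_real x + \<i> * of_real u)))"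
      unfolding T_def by (simp add: mangoldt_def)
    also have "(of_nat n :: complex) powr (-(of_real x + \<i> * of_real u)) = exp (-(of_real x + \<i> * of_real u) * of_real (ln (real n)))"
      using False Ln_of_nat[of n] by (simp add: powr_def)
    finally show ?thesis using False
      by (simp add: Re_exp powr_def)
  qed (simp add: T_def)
  have "0 \<le> 3 * T 0 n + 4 * T t n + T (2 * t) n" for n
  proof -
    define c where "c = cos (t * ln (real n))"
    define M where "M = mangoldt n * real n powr (-x)"
    have "cos (2 * t * ln (real n)) = 2 * c\<^sup>2 - 1"
      unfolding c_def by (metis cos_double_cos mult.assoc)
    hence "T (2 * t) n = M * (2 * c\<^sup>2 - 1)" "T t n = M * c" "T 0 n = M"
      unfolding T M_def c_def by simp_all
    hence "3 * T 0 n + 4 * T t n + T (2 * t) n = M * (2 * (1 + c)\<^sup>2)"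
      by (simp add: algebra_simps power2_eq_square)
    moreover have "M \<ge> 0" by (simp add: M_def mangoldt_nonneg)
    ultimately show ?thesis by simp
  qed
  note nonneg = this
  have sums3: "(\<lambda>n. 3 * T 0 n + 4 * T t n + T (2 * t) n) sums
    (3 * Re (Lf (of_real x + \<i> * of_real 0)) + 4 * Re (Lf (of_real x + \<i> * of_real t)) + Re (Lf (of_real x + \<i> * of_real (2 * t))))"
    by (rule sums_add[OF sums_add[OF sums_mult[OF sums] sums_mult[OF sums]] sums])
  from sums_le[OF nonneg sums_zero sums3] show ?thesis by simp
qed

text \<open>The residues of \<open>Lf\<close> at 1, 1 + i t and 1 + 2 i t inherit
  \<open>three_four_one\<close>: the pole at 1 counts 3 and a zero of order n1 at 1 + i t counts -4
  n1, so n1 = 0. To the right of the line \<open>Lf\<close> stays bounded, so the residue and with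
  it the order is 0.\<close>

theorem Zf_nonzero:
  assumes "Re s \<ge> 1"
  shows "Zf s \<noteq> 0"
proof (cases "Re s = 1")
  case True
  define t where "t = Im s"
  have s: "s = 1 + \<i> * of_real t" using True by (simp add: t_def complex_eq_iff)
  show ?thesis
  proof (cases "t = 0")
    case False
    obtain n1 :: nat where n1: "n1 = 0 \<longleftrightarrow> Zf s \<noteq> 0"
        "((\<lambda>e. of_real e * Lf (s + of_real e)) \<longlongrightarrow> of_bool (s = 1) - of_nat n1) (at_right 0)"
      by (rule Lf_residue[OF assms])
    have "Re (1 + \<i> * of_real (2 * t)) \<ge> 1" by simp
    then obtain n2 :: nat where n2:
        "((\<lambda>e. of_real e * Lf (1 + \<i> * of_real (2 * t) + of_real e)) \<longlongrightarrow> of_bool (1 + \<i> * of_real (2 * t) = 1) - of_nat n2) (at_right 0)"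
      by (rule Lf_residue)
    have "Re 1 \<ge> 1" by simp
    then obtain n0 :: nat where n0: "n0 = 0 \<longleftrightarrow> Zf 1 \<noteq> 0"
        "((\<lambda>e. of_real e * Lf (1 + of_real e)) \<longlongrightarrow> of_bool (1 = (1::complex)) - of_nat n0) (at_right 0)"
      by (rule Lf_residue)
    have "((\<lambda>e. 3 * Re (of_real e * Lf (1 + of_real e)) + 4 * Re (of_real e * Lf (s + of_real e)) +
             Re (of_real e * Lf (1 + \<i> * of_real (2 * t) + of_real e))) \<longlongrightarrow>
          3 * Re (of_bool (1 = (1::complex)) - of_nat n0) + 4 * Re (of_bool (s = 1) - of_nat n1) +
           Re (of_bool (1 + \<i> * of_real (2 * t) = 1) - of_nat n2)) (at_right 0)"
      by (intro tendsto_intros n0 n1 n2)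
    moreover have "eventually (\<lambda>e. 0 \<le> 3 * Re (of_real e * Lf (1 + of_real e)) + 4 * Re (of_real e * Lf (s + of_real e)) +
             Re (of_real e * Lf (1 + \<i> * of_real (2 * t) + of_real e))) (at_right 0)"
      using eventually_at_right_less[of 0]
    proof eventually_elim
      case (elim e)
      have "0 \<le> e * (3 * Re (Lf (of_real (1 + e))) + 4 * Re (Lf (of_real (1 + e) + \<i> * of_real t)) + Re (Lf (of_real (1 + e) + \<i> * of_real (2 * t))))"
        using elim by (intro mult_nonneg_nonneg three_four_one) auto
      thus ?case by (simp add: s algebra_simps)
    qed
    ultimately have "0 \<le> 3 * Re (of_bool (1 = (1::complex)) - of_nat n0) + 4 * Re (of_bool (s = 1) - of_nat n1) +
           Re (of_bool (1 + \<i> * of_real (2 * t) = 1) - of_nat n2)"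
      by (rule tendsto_lowerbound) auto
    hence "4 * real n1 \<le> 3" using False n0 by (simp add: s)
    hence "n1 = 0" by simp
    thus ?thesis using n1 by simp
  qed (simp add: s)
next
  case False
  hence s: "Re s > 1" using assms by simp
  obtain n :: nat where n: "n = 0 \<longleftrightarrow> Zf s \<noteq> 0"
        "((\<lambda>e. of_real e * Lf (s + of_real e)) \<longlongrightarrow> of_bool (s = 1) - of_nat n) (at_right 0)"
    by (rule Lf_residue[OF assms])
  have "((\<lambda>e. of_real e * Lf (s + of_real e)) \<longlongrightarrow> 0) (at_right (0::real))"
  proof (rule Lim_null_comparison)
    show "eventually (\<lambda>e. norm (of_real e * Lf (s + of_real e)) \<le> e * norm (Lf (of_real (Re s)))) (at_right 0)"
      using eventually_at_right_less[of 0]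
      by eventually_elim (use s in \<open>auto simp: norm_mult intro!: mult_left_mono Lf_norm_le\<close>)
    show "((\<lambda>e. e * norm (Lf (of_real (Re s)))) \<longlongrightarrow> 0) (at_right (0::real))"
      by (auto intro!: tendsto_eq_intros)
  qed
  hence "of_bool (s = 1) - of_nat n = (0::complex)"
    using n(2) by (intro tendsto_unique[OF trivial_limit_at_right_real]) auto
  moreover have "s \<noteq> 1" using s by auto
  ultimately have "n = 0" by simp
  thus ?thesis using n by simp
qed

section \<open>The Dirichlet series of psi(n) - n\<close>

definition psi_error :: "nat \<Rightarrow> real" where
  "psi_error n = psi n - real n"

lemma psi_error_bound: "\<bar>psi_error n\<bar> \<le> 4 * real n"
  using psi_le[of n] psi_nonneg[of n] by (auto simp: psi_error_def)

text \<open>The error of replacing \<open>n powr (-s) - (n + 1) powr (-s)\<close> by \<open>s n powr (-s - 1)\<close> in the Abel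
  summation of the Dirichlet series of \<open>mangoldt n - 1\<close>.\<close>

definition psi_corr :: "complex \<Rightarrow> complex" where
  "psi_corr s = (\<Sum>n. of_real (psi_error n) * zeta_term n (s + 1))"

lemma psi_corr_holomorphic: "psi_corr holomorphic_on {s. Re s > 0}"
  and psi_corr_sums: "Re s > 0 \<Longrightarrow> (\<lambda>n. of_real (psi_error n) * zeta_term n (s + 1)) sums psi_corr s"
proof -
  have bd: "norm (complex_of_real (psi_error n)) \<le> 4 * real n powr 1" for n
    using psi_error_bound[of n] by simp
  note * = zeta_term_series[where a = 1 and b = "\<lambda>n. of_real (psi_error n)" and C = 4, OF _ bd]
  have "((\<lambda>s. \<Sum>n. of_real (psi_error n) * zeta_term n s) \<circ> (\<lambda>s. s + 1)) holomorphic_on {s. Re s > 0}"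
    by (rule holomorphic_on_compose_gen[OF _ *(1)]) (auto intro!: holomorphic_intros)
  thus "psi_corr holomorphic_on {s. Re s > 0}"
    by (simp add: psi_corr_def[abs_def] o_def)
  show "(\<lambda>n. of_real (psi_error n) * zeta_term n (s + 1)) sums psi_corr s" if "Re s > 0"
    unfolding psi_corr_def using that by (intro summable_sums *(2)) auto
qed

text \<open>Abel summation of the series of (mangoldt n - 1) n^(-s), whose value is Lf s - zeta(s).
  The boundary term \<open>c n\<close> tends to 0 since \<open>psi_error n\<close> is O(n) and Re s
  > 1; adding \<open>psi_corr s\<close> turns each difference of powers into s n^(-s - 1).\<close>

lemma psi_error_series:
  assumes s: "Re s > 1"
  shows "(\<lambda>n. of_real (psi_error n) * of_nat n powr (-s - 1)) sums
           ((Lf s - Zf s / (s - 1) + psi_corr s) / s)"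
proof -
  define c where "c = (\<lambda>n. of_real (psi_error n) * of_nat n powr (-s) :: complex)"
  have "c \<longlonglongrightarrow> 0"
  proof (rule Lim_null_comparison)
    show "eventually (\<lambda>n. norm (c n) \<le> 4 * real n powr (1 - Re s)) sequentially"
      using eventually_gt_at_top[of 0]
    proof eventually_elim
      case (elim n)
      have "norm (c n) = \<bar>psi_error n\<bar> * real n powr (-Re s)"
        by (simp add: c_def norm_mult norm_nat_powr)
      also have "\<dots> \<le> (4 * real n) * real n powr (-Re s)"
        by (intro mult_right_mono psi_error_bound) auto
      also have "\<dots> = 4 * real n powr (1 - Re s)"
        using elim by (simp add: powr_diff powr_minus divide_simps)
      finally show ?case .
    qed
    have "((\<lambda>n. real n powr (1 - Re s)) \<longlongrightarrow> 0) sequentially"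
      using s by (intro tendsto_neg_powr filterlim_real_sequentially) auto
    thus "(\<lambda>n. 4 * real n powr (1 - Re s)) \<longlonglongrightarrow> 0"
      by (rule tendsto_mult_right_zero)
  qed
  hence tel: "(\<lambda>n. c n - c (Suc n)) sums (c 0 - 0)"
    by (rule telescope_sums')
  have "(\<lambda>n. mangoldt n * of_nat n powr (-s) - of_nat n powr (-s)) sums (Lf s - Zf s / (s - 1))"
    by (intro sums_diff Lf_sums zeta_sums s)
  hence D: "(\<lambda>n. (mangoldt (Suc n) - 1) * of_nat (Suc n) powr (-s)) sums (Lf s - Zf s / (s - 1))"
    using sums_Suc_iff[of "\<lambda>n. (mangoldt n - 1) * of_nat n powr (-s)" "Lf s - Zf s / (s - 1)"]
    by (simp add: left_diff_distrib del: of_nat_Suc)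
  have eq: "c n - c (Suc n) + (mangoldt (Suc n) - 1) * of_nat (Suc n) powr (-s) =
        of_real (psi_error n) * (of_nat n powr (-s) - of_nat (Suc n) powr (-s))" for n
    by (simp add: c_def psi_error_def psi_Suc algebra_simps)
  have abel: "(\<lambda>n. of_real (psi_error n) * (of_nat n powr (-s) - of_nat (Suc n) powr (-s)))
          sums (Lf s - Zf s / (s - 1))"
    using sums_add[OF tel D] unfolding eq by (simp add: c_def)
  have term_eq: "of_real (psi_error n) * (of_nat n powr (-s) - of_nat (Suc n) powr (-s)) +
        of_real (psi_error n) * zeta_term n (s + 1) = of_real (psi_error n) * of_nat n powr (-s - 1) * s" for n
  proof -
    have e: "- (s + 1) = -s - 1" "1 - (s + 1) = -s" "s + 1 - 1 = s" by simp_all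
    show ?thesis unfolding zeta_term_def e by (simp add: algebra_simps)
  qed
  have "(\<lambda>n. of_real (psi_error n) * of_nat n powr (-s - 1) * s) sums (Lf s - Zf s / (s - 1) + psi_corr s)"
    using sums_add[OF abel psi_corr_sums[of s]] s unfolding term_eq by simp
  moreover have "s \<noteq> 0" using s by auto
  ultimately show ?thesis using sums_divide[of _ "Lf s - Zf s / (s - 1) + psi_corr s" s] by fastforce
qed

text \<open>The poles of Lf and zeta at s = 1 cancel: for s near 1, Lf s - Zf s / (s - 1) becomes
  -Zf'/Zf - (Zf s - Zf 1) / (s - 1), with a removable singularity. By \<open>Zf_nonzero\<close> this
  continues across the line Re s = 1, which is Re w = 0 for w = s - 1.\<close>

lemma psi_error_transform:
  shows "\<exists>G U. open U \<and> {w. Re w \<ge> 0} \<subseteq> U \<and> G holomorphic_on U \<and>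
    (\<forall>w. Re w > 0 \<longrightarrow> (\<lambda>n. of_real (psi_error n / real n) * of_nat n powr (-1 - w)) sums G w)"
proof -
  define V where "V = {s. Re s > 0} \<inter> Zf -` (- {0})"
  define D where "D = (\<lambda>s. - deriv Zf s / Zf s - (if s = 1 then deriv Zf 1 else (Zf s - Zf 1) / (s - 1)))"
  define G where "G = (\<lambda>w. (D (1 + w) + psi_corr (1 + w)) / (1 + w))"
  define U where "U = (\<lambda>w. 1 + w) -` V"
  have op: "open {s::complex. Re s > 0}" by (rule open_halfspace_Re_gt)
  have "open V"
    unfolding V_def using Zf_holomorphic
    by (intro continuous_open_preimage op holomorphic_on_imp_continuous_on) auto
  hence "open U"
    unfolding U_def by (intro open_vimage continuous_intros)
  moreover have "{w. Re w \<ge> 0} \<subseteq> U"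
    using Zf_nonzero by (auto simp: U_def V_def)
  moreover have "G holomorphic_on U"
  proof -
    have "deriv Zf holomorphic_on V"
      by (rule holomorphic_on_subset[OF holomorphic_deriv[OF Zf_holomorphic op]]) (auto simp: V_def)
    moreover have "(\<lambda>s. if s = 1 then deriv Zf 1 else (Zf s - Zf 1) / (s - 1)) holomorphic_on V"
      by (rule holomorphic_on_subset[OF pole_lemma_open[OF Zf_holomorphic op]]) (auto simp: V_def)
    moreover have "Zf holomorphic_on V" "psi_corr holomorphic_on V"
      by (auto intro: holomorphic_on_subset[OF Zf_holomorphic] holomorphic_on_subset[OF psi_corr_holomorphic] simp: V_def)
    ultimately have "(\<lambda>s. (D s + psi_corr s) / s) holomorphic_on V"
      unfolding D_def
      by (intro holomorphic_on_divide holomorphic_on_add holomorphic_on_diff holomorphic_on_minus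
            holomorphic_on_ident) (auto simp: V_def)
    moreover have "(\<lambda>w. 1 + w) holomorphic_on U" by (intro holomorphic_intros)
    ultimately have "((\<lambda>s. (D s + psi_corr s) / s) \<circ> (\<lambda>w. 1 + w)) holomorphic_on U"
      by (intro holomorphic_on_compose_gen[of _ _ _ V]) (auto simp: U_def)
    thus ?thesis by (simp add: G_def o_def)
  qed
  moreover have "(\<lambda>n. of_real (psi_error n / real n) * of_nat n powr (-1 - w)) sums G w" if "Re w > 0" for w
  proof -
    define s where "s = 1 + w"
    have s: "Re s > 1" using that by (simp add: s_def)
    have nz: "Zf s \<noteq> 0" using s by (intro Zf_nonzero) auto
    have s1: "s \<noteq> 1" using s by auto
    have "Lf s = (Zf s / (s - 1) - deriv Zf s) / Zf s"
      using Lf_times_Zf[OF s] nz by (simp add: eq_divide_eq)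
    also have "\<dots> = 1 / (s - 1) - deriv Zf s / Zf s"
      using nz by (simp add: diff_divide_distrib)
    finally have "Lf s - Zf s / (s - 1) = D s"
      using s1 by (simp add: D_def diff_divide_distrib)
    hence "G w = (Lf s - Zf s / (s - 1) + psi_corr s) / s"
      by (simp add: G_def s_def)
    moreover have "of_real (psi_error n / real n) * of_nat n powr (-1 - w) =
                   of_real (psi_error n) * of_nat n powr (-s - 1)" for n
    proof (cases "n = 0")
      case False
      have "-s - 1 = (-1 - w) + (-1)" by (simp add: s_def)
      hence "of_nat n powr (-s - 1) = (of_nat n powr (-1 - w) * of_nat n powr (-1) :: complex)"
        by (simp only: powr_add)
      thus ?thesis using False by (simp add: powr_minus divide_simps)
    qed simp
    ultimately show ?thesis using psi_error_series[OF s] by simp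
  qed
  ultimately show ?thesis by blast
qed

section \<open>Newman's Tauberian theorem\<close>

lemma powr_diff_mvt:
  fixes x t :: real
  assumes "x > 0"
  obtains y where "x < y" "y < x + 1" "(x + 1) powr t - x powr t = t * y powr (t - 1)"
proof -
  have "\<exists>z>x. z < x + 1 \<and> (x + 1) powr t - x powr t = (x + 1 - x) * (t * z powr (t - 1))"
    by (rule MVT2) (use assms in \<open>auto intro!: derivative_eq_intros\<close>)
  thus ?thesis using that by auto
qed

lemma powr_tail_le:
  fixes t :: real
  assumes t: "t > 0" and N: "N > 0"
  shows "summable (\<lambda>i. real (i + Suc N) powr (-1 - t))"
    and "(\<Sum>i. real (i + Suc N) powr (-1 - t)) \<le> real N powr (-t) / t"
proof -
  define u where "u = (\<lambda>i. real (i + N) powr (-t))"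
  have "((\<lambda>n. real n powr (-t)) \<longlongrightarrow> 0) sequentially"
    using t by (intro tendsto_neg_powr filterlim_real_sequentially) auto
  hence "u \<longlonglongrightarrow> 0" unfolding u_def by (rule LIMSEQ_ignore_initial_segment)
  hence "(\<lambda>i. u i - u (Suc i)) sums (u 0 - 0)" by (rule telescope_sums')
  hence sums: "(\<lambda>i. (u i - u (Suc i)) / t) sums (u 0 / t)" using sums_divide by fastforce
  have le: "real (i + Suc N) powr (-1 - t) \<le> (u i - u (Suc i)) / t" for i
  proof -
    have e: "-1 - t = -t - 1" by simp
    have "real (i + N) > 0" using N by simp
    then obtain y where y: "real (i + N) < y" "y < real (i + N) + 1"
      "(real (i + N) + 1) powr (-t) - real (i + N) powr (-t) = (-t) * y powr (-t - 1)"
      by (rule powr_diff_mvt)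
    have "(u i - u (Suc i)) / t = y powr (-t - 1)"
      using y(3) t by (simp add: u_def field_simps)
    also have "\<dots> \<ge> real (i + Suc N) powr (-t - 1)"
      by (rule powr_mono2') (use y t N in auto)
    finally show ?thesis unfolding e .
  qed
  show sm: "summable (\<lambda>i. real (i + Suc N) powr (-1 - t))"
    by (rule summable_comparison_test'[OF sums_summable[OF sums]]) (use le in auto)
  have "(\<Sum>i. real (i + Suc N) powr (-1 - t)) \<le> u 0 / t"
    by (rule sums_le[OF le summable_sums[OF sm] sums])
  thus "(\<Sum>i. real (i + Suc N) powr (-1 - t)) \<le> real N powr (-t) / t"
    by (simp add: u_def)
qed

lemma powr_sum_le:
  fixes t :: real
  assumes t: "t > 0" and N: "N > 0"
  shows "(\<Sum>n=1..N. real n powr (t - 1)) \<le> real N powr t / t + real N powr (t - 1)"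
proof -
  \<comment> \<open>For t < 1 the summand decreases and the integral dominates the sum; for t >= 1
    it is nondecreasing and the last value has to be added. The induction keeps the two cases
    apart.\<close>
  have "(\<Sum>n=1..N. real n powr (t - 1)) \<le> real N powr t / t + (if t \<ge> 1 then real N powr (t - 1) else 0)"
    using N
  proof (induction N rule: nat_induct_non_zero)
    case (Suc N)
    have "real N > 0" using Suc by simp
    then obtain y where y: "real N < y" "y < real N + 1"
      "(real N + 1) powr t - real N powr t = t * y powr (t - 1)" by (rule powr_diff_mvt)
    have eq: "real (Suc N) powr t / t = real N powr t / t + y powr (t - 1)"
      using y(3) t by (simp add: field_simps)
    show ?case
    proof (cases "t \<ge> 1")
      case True
      have "real N powr (t - 1) \<le> y powr (t - 1)"
        by (rule powr_mono2) (use y True in auto)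
      thus ?thesis using Suc.IH True eq by simp
    next
      case False
      have "real (Suc N) powr (t - 1) \<le> y powr (t - 1)"
        by (rule powr_mono2') (use y False Suc in auto)
      thus ?thesis using Suc.IH False eq by simp
    qed
  qed (use t in auto)
  thus ?thesis by (rule order.trans) auto
qed

section \<open>The kernel and the two half circles\<close>

text \<open>On |w| = R one has 1 / w = cnj w / R^2, so the second factor is the real number 2 Re w /
  R^2. This is the purpose of the summand w / R^2: the factor Re w cancels the 1 / |Re w| in the
  bounds on both arcs.\<close>

lemma newman_kernel_norm:
  assumes w: "norm w = R" and R: "R > 0" and N: "N > (0::nat)"
  shows "norm (exp (of_real (ln N) * w) * (1 / w + w / of_real R ^ 2)) = real N powr Re w * (2 * \<bar>Re w\<bar> / R ^ 2)"
proof -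
  have w0: "w \<noteq> 0" using w R by auto
  have "1 / w = cnj w / of_real R ^ 2"
    using w0 complex_norm_square[of w] w by (simp add: divide_simps)
  hence "1 / w + w / of_real R ^ 2 = of_real (2 * Re w / R ^ 2)"
    using complex_add_cnj[of w] by (simp add: add_divide_distrib[symmetric] add.commute)
  hence "norm (1 / w + w / of_real R ^ 2) = 2 * \<bar>Re w\<bar> / R ^ 2"
    by (simp only: norm_of_real) (simp add: abs_mult)
  moreover have "norm (exp (of_real (ln N) * w)) = real N powr Re w"
    using N by (simp add: powr_def mult.commute)
  ultimately show ?thesis by (simp add: norm_mult)
qed

lemma circlepath_split:
  assumes R: "R > 0" and f: "continuous_on (sphere 0 R) f"
  shows "contour_integral (circlepath 0 R) f =
     contour_integral (part_circlepath 0 R (-pi/2) (pi/2)) f + contour_integral (part_circlepath 0 R (pi/2) (3*pi/2)) f"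
proof -
  define g where "g = (\<lambda>t. f (0 + R * cis t) * R * \<i> * cis t)"
  have cont: "continuous_on A g" for A
    unfolding g_def using R
    by (intro continuous_intros continuous_on_compose2[OF f]) (auto simp: norm_mult)
  hence int: "g integrable_on {a..b}" for a b by (rule integrable_continuous_real)
  \<comment> \<open>\<open>circlepath\<close> runs over the angles 0 to 2 pi, the two arcs over
    -pi/2 to 3 pi/2; periodicity moves the last quarter to the front.\<close>
  have "integral {3*pi/2..2*pi} g = integral {-pi/2..0} (g \<circ> (\<lambda>x. x + 2 * pi))"
    using integral_shift[of "-pi/2" "2*pi" 0 g] cont by simp
  also have "g \<circ> (\<lambda>x. x + 2 * pi) = g"
    by (rule ext) (simp add: g_def cis_mult[symmetric])
  finally have shift: "integral {3*pi/2..2*pi} g = integral {-pi/2..0} g" .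
  have "contour_integral (circlepath 0 R) f = integral {0..2*pi} g"
    unfolding circlepath_def g_def by (rule contour_integral_part_circlepath_eq) auto
  also have "\<dots> = integral {0..pi/2} g + integral {pi/2..2*pi} g"
    by (rule Henstock_Kurzweil_Integration.integral_combine[symmetric]) (auto intro: int)
  also have "integral {pi/2..2*pi} g = integral {pi/2..3*pi/2} g + integral {3*pi/2..2*pi} g"
    by (rule Henstock_Kurzweil_Integration.integral_combine[symmetric]) (auto intro: int)
  also have "integral {0..pi/2} g + (integral {pi/2..3*pi/2} g + integral {3*pi/2..2*pi} g) =
     (integral {-pi/2..0} g + integral {0..pi/2} g) + integral {pi/2..3*pi/2} g"
    unfolding shift by simp
  also have "integral {-pi/2..0} g + integral {0..pi/2} g = integral {-pi/2..pi/2} g"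
    by (rule Henstock_Kurzweil_Integration.integral_combine) (auto intro: int)
  also have "integral {-pi/2..pi/2} g = contour_integral (part_circlepath 0 R (-pi/2) (pi/2)) f"
    unfolding g_def by (rule contour_integral_part_circlepath_eq[symmetric]) auto
  also have "integral {pi/2..3*pi/2} g = contour_integral (part_circlepath 0 R (pi/2) (3*pi/2)) f"
    unfolding g_def by (rule contour_integral_part_circlepath_eq[symmetric]) auto
  finally show ?thesis .
qed

lemma right_arc:
  assumes "R > 0" "w \<in> path_image (part_circlepath 0 R (-pi/2) (pi/2))"
  shows "norm w = R" "Re w \<ge> 0"
proof -
  from assms obtain t where t: "w = R * exp (\<i> * of_real t)" "-pi/2 \<le> t" "t \<le> pi/2"
    by (subst (asm) path_image_part_circlepath) auto
  show "norm w = R" using t assms by (simp add: norm_mult)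
  show "Re w \<ge> 0" using t assms by (simp add: Re_exp cos_ge_zero)
qed

lemma left_arc:
  assumes "R > 0" "w \<in> path_image (part_circlepath 0 R (pi/2) (3*pi/2))"
  shows "norm w = R" "Re w \<le> 0"
proof -
  from assms obtain t where t: "w = R * exp (\<i> * of_real t)" "pi/2 \<le> t" "t \<le> 3*pi/2"
    by (subst (asm) path_image_part_circlepath) auto
  show "norm w = R" using t assms by (simp add: norm_mult)
  have "cos (t - pi) \<ge> 0" by (rule cos_ge_zero) (use t in auto)
  hence "cos t \<le> 0" by simp
  thus "Re w \<le> 0" using t assms by (simp add: Re_exp mult_nonneg_nonpos)
qed

text \<open>On the imaginary axis \<open>N\<^sup>w\<close> has modulus 1 and antiderivative \<open>N\<^sup>w / ln N\<close>, so
  integrating by parts along the diameter gains a factor \<open>1 / ln N\<close>.\<close>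

lemma right_arc_oscillation:
  assumes R: "R > 0" and U: "open U" "{w. Re w \<ge> 0} \<subseteq> U" and H: "H holomorphic_on U"
  obtains B where "\<And>l::real. l > 0 \<Longrightarrow>
     norm (contour_integral (part_circlepath 0 R (-pi/2) (pi/2)) (\<lambda>w. exp (of_real l * w) * H w)) \<le> B / l"
proof -
  define P where "P = part_circlepath 0 R (-pi/2) (pi/2)"
  define a where "a = \<i> * of_real R"
  define S where "S = {w::complex. Re w \<ge> 0}"
  have S: "convex S" unfolding S_def by (rule convex_halfspace_Re_ge)
  have SU: "S \<subseteq> U" using U by (simp add: S_def)
  have HS: "H holomorphic_on S" using H SU by (rule holomorphic_on_subset)
  have dH: "deriv H holomorphic_on U" by (rule holomorphic_deriv[OF H U(1)])
  have seg: "closed_segment a (-a) \<subseteq> S"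
    by (intro closed_segment_subset S) (auto simp: a_def S_def)
  have Re_seg: "Re x = 0" if x: "x \<in> closed_segment a (-a)" for x
    using x by (auto simp: closed_segment_def a_def)
  have ends: "pathstart P = -a" "pathfinish P = a"
    by (simp_all add: P_def a_def exp_eq_polar cis_conv_exp[symmetric] complex_eq_iff)
  have imgP: "path_image P \<subseteq> S"
    using right_arc(2)[OF R] by (auto simp: P_def S_def)
  have "compact (deriv H ` closed_segment a (-a))"
    by (intro compact_continuous_image holomorphic_on_imp_continuous_on holomorphic_on_subset[OF dH])
       (use seg SU in auto)
  then obtain B0 where B0: "\<And>x. x \<in> closed_segment a (-a) \<Longrightarrow> norm (deriv H x) \<le> B0"
    using compact_imp_bounded bounded_iff by (metis imageI)
  have B0_nonneg: "B0 \<ge> 0" using B0[of a] norm_ge_zero order.trans by (metis ends_in_segment(1))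
  define B where "B = norm (H a) + norm (H (-a)) + B0 * norm (-a - a)"
  show ?thesis
  proof (rule that[of B])
    fix l :: real assume l: "l > 0"
    define f where "f = (\<lambda>w. exp (of_real l * w) * H w)"
    define f' where "f' = (\<lambda>w. exp (of_real l * w) * deriv H w)"
    have fS: "f holomorphic_on S" unfolding f_def by (intro holomorphic_intros HS)
    have f'S: "f' holomorphic_on S"
      unfolding f'_def by (intro holomorphic_intros holomorphic_on_subset[OF dH SU])
    have int_f: "f contour_integrable_on linepath a (-a)"
      by (intro contour_integrable_continuous_linepath holomorphic_on_imp_continuous_on
            holomorphic_on_subset[OF fS] seg)
    have int_f': "f' contour_integrable_on linepath a (-a)"
      by (intro contour_integrable_continuous_linepath holomorphic_on_imp_continuous_on
            holomorphic_on_subset[OF f'S] seg)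
    have int_P: "f contour_integrable_on P"
      unfolding P_def by (intro contour_integrable_continuous_part_circlepath holomorphic_on_imp_continuous_on
            holomorphic_on_subset[OF fS]) (use imgP in \<open>simp add: P_def\<close>)
    have vP: "valid_path P" by (simp add: P_def)
    \<comment> \<open>Arc and diameter close up inside the convex half plane \<open>S\<close>, so
      Cauchy's theorem moves the integral to the diameter.\<close>
    have "(f has_contour_integral 0) (P +++ linepath a (-a))"
      by (rule Cauchy_theorem_convex_simple[OF fS S])
         (use vP ends imgP seg in \<open>auto simp: path_image_join intro!: valid_path_join\<close>)
    hence "contour_integral P f + contour_integral (linepath a (-a)) f = 0"
      using contour_integral_join[OF int_P int_f vP] contour_integral_unique by force
    hence P_eq: "contour_integral P f = - contour_integral (linepath a (-a)) f"
      by (simp add: eq_neg_iff_add_eq_0)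
    have "((\<lambda>w. f w + f' w / of_real l) has_contour_integral
             (f (pathfinish (linepath a (-a))) / of_real l - f (pathstart (linepath a (-a))) / of_real l)) (linepath a (-a))"
    proof (rule contour_integral_primitive[of S])
      fix x assume x: "x \<in> S"
      have "(H has_field_derivative deriv H x) (at x)"
        using x SU by (intro holomorphic_derivI[OF H U(1)]) auto
      hence "((\<lambda>w. f w / of_real l) has_field_derivative
              (exp (of_real l * x) * of_real l * H x + exp (of_real l * x) * deriv H x) / of_real l) (at x)"
        unfolding f_def using l by (auto intro!: derivative_eq_intros)
      also have "(exp (of_real l * x) * of_real l * H x + exp (of_real l * x) * deriv H x) / of_real l = f x + f' x / of_real l"
        using l by (simp add: f_def f'_def field_simps)
      finally show "((\<lambda>w. f w / of_real l) has_field_derivative f x + f' x / of_real l) (at x within S)"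
        by (rule has_field_derivative_at_within)
    qed (use seg in auto)
    hence "contour_integral (linepath a (-a)) (\<lambda>w. f w + f' w / of_real l) = (f (-a) - f a) / of_real l"
      by (simp add: contour_integral_unique diff_divide_distrib)
    moreover have "contour_integral (linepath a (-a)) (\<lambda>w. f w + f' w / of_real l) =
        contour_integral (linepath a (-a)) f + contour_integral (linepath a (-a)) f' / of_real l"
      using int_f int_f' by (subst contour_integral_add) (auto intro: contour_integrable_div contour_integral_div)
    ultimately have "contour_integral (linepath a (-a)) f =
        (f (-a) - f a - contour_integral (linepath a (-a)) f') / of_real l"
      by (simp add: diff_divide_distrib eq_diff_eq)
    hence "norm (contour_integral P f) = norm (f (-a) - f a - contour_integral (linepath a (-a)) f') / l"
      using P_eq l by (simp add: norm_divide)
    also have "norm (f (-a) - f a - contour_integral (linepath a (-a)) f') \<le> B"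
    proof -
      have "norm (f (-a)) = norm (H (-a))" "norm (f a) = norm (H a)"
        by (simp_all add: f_def a_def norm_mult)
      moreover have "norm (contour_integral (linepath a (-a)) f') \<le> B0 * norm (-a - a)"
        by (rule has_contour_integral_bound_linepath[OF has_contour_integral_integral[OF int_f']])
           (use B0 B0_nonneg Re_seg in \<open>auto simp: f'_def norm_mult\<close>)
      moreover have "norm (f (-a) - f a - contour_integral (linepath a (-a)) f') \<le>
          norm (f (-a)) + norm (f a) + norm (contour_integral (linepath a (-a)) f')"
        by (meson norm_triangle_ineq4 norm_triangle_le_diff order.trans add_right_mono)
      ultimately show ?thesis by (simp add: B_def)
    qed
    finally show "norm (contour_integral (part_circlepath 0 R (-pi/2) (pi/2)) (\<lambda>w. exp (of_real l * w) * H w)) \<le> B / l"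
      using l by (simp add: P_def f_def divide_right_mono)
  qed
qed


text \<open>Used on the right arc, where N^(-Re w) / Re w times the norm of the kernel is the
  constant 2 / R^2.\<close>

lemma dirichlet_tail_bound:
  fixes a :: "nat \<Rightarrow> complex"
  assumes C: "\<And>n. norm (a n) \<le> C" and w: "Re w > 0" and N: "N > 0"
    and sums: "(\<lambda>n. a n * of_nat n powr (-1 - w)) sums G"
  shows "norm ((\<Sum>n=1..N. a n * of_nat n powr (-1 - w)) - G) \<le> C * (real N powr (-Re w) / Re w)"
proof -
  define f where "f = (\<lambda>n. a n * of_nat n powr (-1 - w))"
  have C0: "C \<ge> 0" using C[of 0] norm_ge_zero order.trans by blast
  have "(\<lambda>i. f (i + Suc N)) sums (G - sum f {..<Suc N})"
    using sums unfolding f_def by (rule sums_split_initial_segment)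
  moreover have "sum f {..<Suc N} = sum f {1..N}"
    by (rule sum.mono_neutral_right) (auto simp: f_def)
  ultimately have eq: "G - sum f {1..N} = (\<Sum>i. f (i + Suc N))"
    by (simp add: sums_iff)
  have "norm (\<Sum>i. f (i + Suc N)) \<le> (\<Sum>i. C * real (i + Suc N) powr (-1 - Re w))"
    by (rule norm_suminf_le)
       (use C powr_tail_le(1)[OF w N] in \<open>auto simp: f_def norm_mult norm_nat_powr simp del: of_nat_Suc of_nat_add intro!: mult_right_mono summable_mult\<close>)
  also have "\<dots> = C * (\<Sum>i. real (i + Suc N) powr (-1 - Re w))"
    by (rule suminf_mult[OF powr_tail_le(1)[OF w N]])
  also have "\<dots> \<le> C * (real N powr (-Re w) / Re w)"
    by (intro mult_left_mono powr_tail_le w N C0)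
  finally show ?thesis
    using eq norm_minus_commute[of "sum f {1..N}" G] by (simp add: f_def)
qed

lemma dirichlet_partial_sum_bound:
  fixes a :: "nat \<Rightarrow> complex"
  assumes C: "\<And>n. norm (a n) \<le> C" and w: "Re w < 0" and N: "N > 0"
  shows "norm (\<Sum>n=1..N. a n * of_nat n powr (-1 - w)) \<le>
           C * (real N powr (-Re w) / (-Re w) + real N powr (-Re w - 1))"
proof -
  have C0: "C \<ge> 0" using C[of 0] norm_ge_zero order.trans by blast
  have e: "Re (-1 - w) = -Re w - 1" by simp
  have "norm (\<Sum>n=1..N. a n * of_nat n powr (-1 - w)) \<le> (\<Sum>n=1..N. C * real n powr (-Re w - 1))"
    by (rule order.trans[OF norm_sum], rule sum_mono)
       (simp only: norm_mult norm_nat_powr e, intro mult_right_mono C, auto)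
  also have "\<dots> = C * (\<Sum>n=1..N. real n powr (-Re w - 1))"
    by (simp add: sum_distrib_left)
  also have "\<dots> \<le> C * (real N powr (-Re w) / (-Re w) + real N powr (-Re w - 1))"
    by (intro mult_left_mono powr_sum_le C0) (use w N in auto)
  finally show ?thesis .
qed

text \<open>The partial sum \<open>S\<close> is entire, so Cauchy's formula on the whole circle
  recovers \<open>S 0\<close>, while G enters on the right arc only. After division by 2 pi, S - G
  contributes C / R, the left arc C / R + C / N, and the integral of G decays like 1 / ln N for
  fixed R.\<close>

lemma newman_bound:
  fixes a :: "nat \<Rightarrow> complex"
  assumes C: "\<And>n. norm (a n) \<le> C"
    and U: "open U" "{w. Re w \<ge> 0} \<subseteq> U" and G: "G holomorphic_on U" "G 0 = 0"
    and sums: "\<And>w. Re w > 0 \<Longrightarrow> (\<lambda>n. a n * of_nat n powr (-1 - w)) sums G w"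
    and R: "R > 0"
  obtains B where "\<And>N. N \<ge> 2 \<Longrightarrow> norm (\<Sum>n=1..N. a n / of_nat n) \<le> 2 * C / R + C / real N + B / ln (real N)"
proof -
  define Pr where "Pr = part_circlepath 0 R (-pi/2) (pi/2)"
  define Pl where "Pl = part_circlepath 0 R (pi/2) (3*pi/2)"
  \<comment> \<open>As G 0 = 0, the product of G with the kernel has no pole at 0: it is exp (l w)
    times this function. Its integral can therefore be moved to the diameter through 0.\<close>
  define H where "H = (\<lambda>w. (if w = 0 then deriv G 0 else (G w - G 0) / (w - 0)) * (1 + w ^ 2 / of_real R ^ 2))"
  have C0: "C \<ge> 0" using C[of 0] norm_ge_zero order.trans by blast
  have "H holomorphic_on U"
    unfolding H_def using R by (intro holomorphic_intros pole_lemma_open G U) auto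
  then obtain B where B: "\<And>l::real. l > 0 \<Longrightarrow>
       norm (contour_integral Pr (\<lambda>w. exp (of_real l * w) * H w)) \<le> B / l"
    using right_arc_oscillation[OF R U] unfolding Pr_def by blast
  show ?thesis
  proof (rule that[of "B / (2 * pi)"])
    fix N :: nat assume N: "N \<ge> 2"
    define l where "l = ln (real N)"
    have l: "l > 0" using N by (simp add: l_def)
    define S where "S = (\<lambda>w::complex. \<Sum>n=1..N. a n * of_nat n powr (-1 - w))"
    define K where "K = (\<lambda>w::complex. exp (of_real l * w) * (1 / w + w / of_real R ^ 2))"
    define f where "f = (\<lambda>w. S w * K w)"
    have S_hol: "S holomorphic_on A" for A
      unfolding S_def
      by (intro holomorphic_on_sum holomorphic_on_mult holomorphic_on_powr_right
          holomorphic_on_diff holomorphic_on_const holomorphic_on_ident)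
    have S0: "S 0 = (\<Sum>n=1..N. a n / of_nat n)"
      unfolding S_def by (intro sum.cong) (auto simp: powr_minus divide_simps)
    have K_hol: "K holomorphic_on - {0}"
      unfolding K_def using R by (intro holomorphic_intros) auto
    have Pr_sub: "path_image Pr \<subseteq> U \<inter> - {0}" "path_image Pr \<subseteq> - {0}"
      using right_arc[OF R] U R unfolding Pr_def by force+
    have Pl_sub: "path_image Pl \<subseteq> - {0}"
      using left_arc[OF R] R unfolding Pl_def by force
    have int_r: "g contour_integrable_on Pr" if "g holomorphic_on U \<inter> - {0}" for g
      using holomorphic_on_imp_continuous_on[OF holomorphic_on_subset[OF that Pr_sub(1)]]
      unfolding Pr_def by (rule contour_integrable_continuous_part_circlepath)
    have K_hol': "K holomorphic_on U \<inter> - {0}" by (rule holomorphic_on_subset[OF K_hol]) auto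
    have G_hol': "G holomorphic_on U \<inter> - {0}" by (rule holomorphic_on_subset[OF G(1)]) auto
    have int_SG: "(\<lambda>w. (S w - G w) * K w) contour_integrable_on Pr"
      by (intro int_r holomorphic_intros S_hol K_hol' G_hol')
    have int_G: "(\<lambda>w. G w * K w) contour_integrable_on Pr"
      by (intro int_r holomorphic_intros K_hol' G_hol')
    have f_hol: "f holomorphic_on - {0}"
      unfolding f_def by (intro holomorphic_intros S_hol K_hol)
    have int_f: "f contour_integrable_on Pl"
      using holomorphic_on_imp_continuous_on[OF holomorphic_on_subset[OF f_hol Pl_sub]]
      unfolding Pl_def by (rule contour_integrable_continuous_part_circlepath)

    have "((\<lambda>u. (S u * exp (of_real l * u) * (1 + u ^ 2 / of_real R ^ 2)) / (u - 0)) has_contour_integral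
        (2 * of_real pi * \<i> * (S 0 * exp (of_real l * 0) * (1 + 0 ^ 2 / of_real R ^ 2)))) (circlepath 0 R)"
      using R by (intro Cauchy_integral_circlepath holomorphic_on_imp_continuous_on holomorphic_intros S_hol) auto
    hence "contour_integral (circlepath 0 R) (\<lambda>u. (S u * exp (of_real l * u) * (1 + u ^ 2 / of_real R ^ 2)) / (u - 0))
             = 2 * of_real pi * \<i> * S 0"
      by (simp add: contour_integral_unique)
    moreover have "contour_integral (circlepath 0 R) (\<lambda>u. (S u * exp (of_real l * u) * (1 + u ^ 2 / of_real R ^ 2)) / (u - 0))
        = contour_integral (circlepath 0 R) f"
    proof (rule contour_integral_eq)
      fix u assume "u \<in> path_image (circlepath 0 R)"
      hence "u \<noteq> 0" using R by auto
      hence "1 / u + u / of_real R ^ 2 = (1 + u ^ 2 / of_real R ^ 2) / u"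
        by (simp add: add_divide_distrib power2_eq_square)
      thus "(S u * exp (of_real l * u) * (1 + u ^ 2 / of_real R ^ 2)) / (u - 0) = f u"
        unfolding f_def K_def by simp
    qed
    moreover have "continuous_on (sphere 0 R) f"
      by (rule holomorphic_on_imp_continuous_on[OF holomorphic_on_subset[OF f_hol]]) (use R in auto)
    ultimately have split: "2 * of_real pi * \<i> * S 0 = contour_integral Pr f + contour_integral Pl f"
      using circlepath_split[OF R, of f] by (simp add: Pr_def Pl_def)
    have "contour_integral Pr f = contour_integral Pr (\<lambda>w. (S w - G w) * K w + G w * K w)"
      by (simp add: f_def algebra_simps)
    also have "\<dots> = contour_integral Pr (\<lambda>w. (S w - G w) * K w) + contour_integral Pr (\<lambda>w. G w * K w)"
      by (rule contour_integral_add[OF int_SG int_G])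
    also have "contour_integral Pr (\<lambda>w. G w * K w) = contour_integral Pr (\<lambda>w. exp (of_real l * w) * H w)"
    proof (rule contour_integral_eq)
      fix w assume "w \<in> path_image Pr"
      hence "w \<noteq> 0" using Pr_sub by auto
      thus "G w * K w = exp (of_real l * w) * H w"
        using G(2) by (simp add: K_def H_def algebra_simps power2_eq_square)
    qed
    finally have split': "2 * of_real pi * \<i> * S 0 = contour_integral Pr (\<lambda>w. (S w - G w) * K w) +
        contour_integral Pr (\<lambda>w. exp (of_real l * w) * H w) + contour_integral Pl f"
      using split by simp

    have bd1: "norm (contour_integral Pr (\<lambda>w. (S w - G w) * K w)) \<le> 2 * C / R ^ 2 * R * \<bar>pi/2 - (-pi/2)\<bar>"
      unfolding Pr_def
    proof (rule contour_integral_bound_part_circlepath)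
      fix w assume "w \<in> path_image (part_circlepath 0 R (- pi / 2) (pi / 2))"
      note w = right_arc[OF R this]
      have K: "norm (K w) = real N powr Re w * (2 * \<bar>Re w\<bar> / R ^ 2)"
        unfolding K_def l_def by (rule newman_kernel_norm) (use w R N in auto)
      show "norm ((S w - G w) * K w) \<le> 2 * C / R ^ 2"
      \<comment> \<open>On the imaginary axis the tail bound says nothing, but there the kernel
        vanishes.\<close>
      proof (cases "Re w = 0")
        case False
        hence w0: "Re w > 0" using w by simp
        have "norm ((S w - G w) * K w) \<le> (C * (real N powr (-Re w) / Re w)) * (real N powr Re w * (2 * \<bar>Re w\<bar> / R ^ 2))"
          unfolding norm_mult K S_def
          by (intro mult_right_mono dirichlet_tail_bound C w0 sums) (use N in auto)
        also have "\<dots> = 2 * C / R ^ 2"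
          using w0 N by (simp add: powr_minus divide_simps)
        finally show ?thesis .
      qed (use K C0 in \<open>simp add: norm_mult\<close>)
    qed (use int_SG C0 R in \<open>auto simp: Pr_def\<close>)
    have bd2: "norm (contour_integral Pl f) \<le> 2 * C / R ^ 2 * (1 + R / real N) * R * \<bar>3*pi/2 - pi/2\<bar>"
      unfolding Pl_def
    proof (rule contour_integral_bound_part_circlepath)
      fix w assume "w \<in> path_image (part_circlepath 0 R (pi / 2) (3 * pi / 2))"
      note w = left_arc[OF R this]
      have K: "norm (K w) = real N powr Re w * (2 * \<bar>Re w\<bar> / R ^ 2)"
        unfolding K_def l_def by (rule newman_kernel_norm) (use w R N in auto)
      show "norm (f w) \<le> 2 * C / R ^ 2 * (1 + R / real N)"
      proof (cases "Re w = 0")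
        case False
        hence w0: "Re w < 0" using w by simp
        define t where "t = - Re w"
        have t: "t > 0" "t \<le> R" using w0 w abs_Re_le_cmod[of w] by (auto simp: t_def)
        have "norm (f w) \<le> (C * (real N powr (-Re w) / (-Re w) + real N powr (-Re w - 1))) *
                (real N powr Re w * (2 * \<bar>Re w\<bar> / R ^ 2))"
          unfolding norm_mult K f_def S_def
          by (intro mult_right_mono dirichlet_partial_sum_bound C w0) (use N in auto)
        also have "\<dots> = C * (real N powr t / t + real N powr t / real N) * (1 / real N powr t * (2 * t / R ^ 2))"
          using t N by (simp add: t_def powr_minus powr_diff divide_simps)
        also have "\<dots> = 2 * C / R ^ 2 * (1 + t / real N)"
          using t N R by (simp add: field_simps)
        also have "\<dots> \<le> 2 * C / R ^ 2 * (1 + R / real N)"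
          using t C0 by (intro mult_left_mono add_left_mono divide_right_mono) auto
        finally show ?thesis .
      qed (use K C0 R in \<open>simp add: norm_mult f_def\<close>)
    qed (use int_f C0 R in \<open>auto simp: Pl_def\<close>)
    have "2 * pi * norm (S 0) = norm (2 * of_real pi * \<i> * S 0)"
      by (simp add: norm_mult)
    also have "\<dots> \<le> 2 * C / R ^ 2 * R * \<bar>pi/2 - (-pi/2)\<bar> + B / l + 2 * C / R ^ 2 * (1 + R / real N) * R * \<bar>3*pi/2 - pi/2\<bar>"
      unfolding split' by (intro norm_triangle_le add_mono order.refl bd1 bd2 B l)
    also have "\<dots> = 2 * pi * (2 * C / R + C / real N + B / (2 * pi) / l)"
      using R N l by (simp add: field_simps power2_eq_square)
    finally show "norm (\<Sum>n=1..N. a n / of_nat n) \<le> 2 * C / R + C / real N + B / (2 * pi) / ln (real N)"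
      unfolding S0[symmetric] l_def[symmetric] using pi_gt_zero by simp
  qed
qed

text \<open>R is fixed first to make 2 C / R small, and only then N grows, because the constant
  \<open>B\<close> depends on R.\<close>

lemma newman_zero:
  fixes a :: "nat \<Rightarrow> complex"
  assumes C: "\<And>n. norm (a n) \<le> C"
    and U: "open U" "{w. Re w \<ge> 0} \<subseteq> U" and G: "G holomorphic_on U" "G 0 = 0"
    and sums: "\<And>w. Re w > 0 \<Longrightarrow> (\<lambda>n. a n * of_nat n powr (-1 - w)) sums G w"
  shows "(\<lambda>N. \<Sum>n=1..N. a n / of_nat n) \<longlonglongrightarrow> 0"
proof (rule tendstoI)
  fix \<epsilon> :: real assume \<epsilon>: "\<epsilon> > 0"
  have C0: "C \<ge> 0" using C[of 0] norm_ge_zero order.trans by blast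
  define R where "R = 6 * (C + 1) / \<epsilon>"
  have R: "R > 0" "2 * C / R < \<epsilon> / 2" using C0 \<epsilon> by (auto simp: R_def field_simps intro!: add_pos_nonneg)
  obtain B where B: "\<And>N. N \<ge> 2 \<Longrightarrow> norm (\<Sum>n=1..N. a n / of_nat n) \<le> 2 * C / R + C / real N + B / ln (real N)"
    using newman_bound[OF C U G sums R(1)] by blast
  have "((\<lambda>N. C / real N + B / ln (real N)) \<longlongrightarrow> 0 + 0) sequentially"
    by (intro tendsto_add tendsto_divide_0[OF tendsto_const] filterlim_at_top_imp_at_infinity
          filterlim_compose[OF ln_at_top] filterlim_real_sequentially)
  hence "eventually (\<lambda>N. C / real N + B / ln (real N) < \<epsilon> / 2) sequentially"
    using \<epsilon> by (intro order_tendstoD(2)[where y = "0 + 0"]) auto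
  thus "eventually (\<lambda>N. dist (\<Sum>n=1..N. a n / of_nat n) 0 < \<epsilon>) sequentially"
    using eventually_ge_at_top[of 2]
  proof eventually_elim
    case (elim N)
    have "norm (\<Sum>n=1..N. a n / of_nat n) \<le> 2 * C / R + (C / real N + B / ln (real N))"
      using B[of N] elim by simp
    also have "\<dots> < \<epsilon>" using elim R by linarith
    finally show ?case by (simp add: dist_norm)
  qed
qed

text \<open>Subtracting G 0 from the coefficient at n = 1 lowers the transform by the constant G 0,
  since 1^(-1 - w) = 1; this reduces to a transform vanishing at 0.\<close>

theorem newman:
  fixes a :: "nat \<Rightarrow> complex"
  assumes C: "\<And>n. norm (a n) \<le> C"
    and U: "open U" "{w. Re w \<ge> 0} \<subseteq> U" and G: "G holomorphic_on U"
    and sums: "\<And>w. Re w > 0 \<Longrightarrow> (\<lambda>n. a n * of_nat n powr (-1 - w)) sums G w"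
  shows "(\<lambda>N. \<Sum>n=1..N. a n / of_nat n) \<longlonglongrightarrow> G 0"
proof -
  define b where "b = (\<lambda>n. a n - (if n = 1 then G 0 else 0))"
  have "(\<lambda>N. \<Sum>n=1..N. b n / of_nat n) \<longlonglongrightarrow> 0"
  proof (rule newman_zero[of b "C + norm (G 0)" U "\<lambda>w. G w - G 0"])
    show "norm (b n) \<le> C + norm (G 0)" for n
      using C[of n] norm_triangle_ineq4[of "a n" "G 0"] by (auto simp: b_def intro: add_increasing2)
    show "(\<lambda>w. G w - G 0) holomorphic_on U" by (intro holomorphic_intros G)
    fix w :: complex assume w: "Re w > 0"
    have eq: "b n * of_nat n powr (-1 - w) = a n * of_nat n powr (-1 - w) - (if n = 1 then G 0 else 0)" for n
      by (auto simp: b_def)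
    show "(\<lambda>n. b n * of_nat n powr (-1 - w)) sums (G w - G 0)"
      unfolding eq by (intro sums_diff sums[OF w] sums_single)
  qed (use U in auto)
  hence "(\<lambda>N. (\<Sum>n=1..N. b n / of_nat n) + G 0) \<longlonglongrightarrow> 0 + G 0"
    by (intro tendsto_intros)
  moreover have "eventually (\<lambda>N. (\<Sum>n=1..N. b n / of_nat n) + G 0 = (\<Sum>n=1..N. a n / of_nat n)) sequentially"
    using eventually_gt_at_top[of 0]
  proof eventually_elim
    case (elim N)
    have "(\<Sum>n=1..N. b n / of_nat n) = (\<Sum>n=1..N. a n / of_nat n) - (\<Sum>n=1..N. if n = 1 then G 0 else 0)"
      unfolding sum_subtractf[symmetric] by (intro sum.cong) (auto simp: b_def diff_divide_distrib)
    also have "(\<Sum>n=1..N. if n = 1 then G 0 else 0) = G 0"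
      using elim by (subst sum.delta) auto
    finally show ?case by simp
  qed
  ultimately show ?thesis by (simp add: tendsto_cong)
qed

section \<open>The prime number theorem\<close>

text \<open>Newman's theorem for the coefficients psi_error n / n, bounded by 4 through Chebyshev's
  estimate, makes the series of psi_error n / n^2 converge.\<close>

lemma psi_error_sum_cauchy:
  assumes "\<epsilon> > 0"
  shows "\<exists>M. \<forall>m n. M \<le> m \<longrightarrow> m \<le> n \<longrightarrow> \<bar>\<Sum>i\<in>{m<..n}. psi_error i / real i ^ 2\<bar> < \<epsilon>"
proof -
  obtain G U where GU: "open U" "{w. Re w \<ge> 0} \<subseteq> U" "G holomorphic_on U"
    "\<forall>w. Re w > 0 \<longrightarrow> (\<lambda>n. of_real (psi_error n / real n) * of_nat n powr (-1 - w)) sums G w"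
    using psi_error_transform by (elim exE conjE) (rule that)
  have bd: "norm (of_real (psi_error n / real n) :: complex) \<le> 4" for n
  proof -
    have "\<bar>psi_error n / real n\<bar> \<le> 4"
      using psi_error_bound[of n] by (cases "n = 0") (simp_all add: abs_divide divide_le_eq)
    thus ?thesis by (simp only: norm_of_real)
  qed
  have "(\<lambda>N. \<Sum>n=1..N. of_real (psi_error n / real n) / of_nat n) \<longlonglongrightarrow> G 0"
    by (rule newman[OF bd GU(1-3)]) (use GU(4) in auto)
  hence "(\<lambda>N. Re (\<Sum>n=1..N. of_real (psi_error n / real n) / of_nat n)) \<longlonglongrightarrow> Re (G 0)"
    by (rule tendsto_Re)
  moreover have "Re (\<Sum>n=1..N. of_real (psi_error n / real n) / of_nat n) = (\<Sum>n=1..N. psi_error n / real n ^ 2)" for N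
  proof -
    have "of_real (psi_error n / real n) / of_nat n = complex_of_real (psi_error n / real n ^ 2)" for n
      by (simp add: power2_eq_square)
    thus ?thesis by (simp only: of_real_sum[symmetric] Re_complex_of_real)
  qed
  ultimately have "Cauchy (\<lambda>N. \<Sum>n=1..N. psi_error n / real n ^ 2)"
    using LIMSEQ_imp_Cauchy by fastforce
  then obtain M where M: "\<And>m n. m \<ge> M \<Longrightarrow> n \<ge> M \<Longrightarrow>
      dist (\<Sum>i=1..m. psi_error i / real i ^ 2) (\<Sum>i=1..n. psi_error i / real i ^ 2) < \<epsilon>"
    using assms unfolding Cauchy_def by meson
  show ?thesis
  proof (intro exI[of _ M] allI impI)
    fix m n assume mn: "M \<le> m" "m \<le> n"
    have *: "{1..n} = {1..m} \<union> {m<..n}" using mn by auto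
    have "(\<Sum>i=1..n. psi_error i / real i ^ 2) = (\<Sum>i=1..m. psi_error i / real i ^ 2) + (\<Sum>i\<in>{m<..n}. psi_error i / real i ^ 2)"
      unfolding * by (rule sum.union_disjoint) auto
    thus "\<bar>\<Sum>i\<in>{m<..n}. psi_error i / real i ^ 2\<bar> < \<epsilon>"
      using M[of n m] mn by (simp add: dist_real_def)
  qed
qed

text \<open>As \<open>psi\<close> is monotone, a relative deviation \<open>\<epsilon>\<close> at \<open>n\<close> persists on an interval of length
  about \<open>\<epsilon> n / 2\<close>, which is visible in the Cauchy criterion.\<close>

theorem prime_number_theorem:
  assumes \<epsilon>: "0 < \<epsilon>" "\<epsilon> < 1"
  shows "\<exists>n0. \<forall>n\<ge>n0. \<bar>psi_error n\<bar> \<le> \<epsilon> * real n"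
proof -
  have "\<epsilon>\<^sup>2 / 32 > 0" using \<epsilon> by simp
  then obtain M where M: "\<And>m n. M \<le> m \<Longrightarrow> m \<le> n \<Longrightarrow> \<bar>\<Sum>i\<in>{m<..n}. psi_error i / real i ^ 2\<bar> < \<epsilon>\<^sup>2 / 32"
    using psi_error_sum_cauchy by meson
  show ?thesis
  \<comment> \<open>4 / \<epsilon> gives \<epsilon> n >= 4, so rounding \<epsilon> n / 2 down keeps
    at least \<epsilon> n / 4; 2 M keeps the block of length k <= n / 2 to the left of n beyond
    M.\<close>
  proof (intro exI[of _ "2 * M + nat \<lceil>4 / \<epsilon>\<rceil> + 1"] allI impI)
    fix n assume n: "n \<ge> 2 * M + nat \<lceil>4 / \<epsilon>\<rceil> + 1"
    have "4 / \<epsilon> \<le> real n" using n by linarith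
    hence n4: "\<epsilon> * real n \<ge> 4" using \<epsilon> by (simp add: field_simps)
    have n0: "n > 0" using n by simp
    have en: "0 \<le> \<epsilon> * real n / 2" using \<epsilon> by simp
    define k where "k = nat \<lfloor>\<epsilon> * real n / 2\<rfloor>"
    have k: "real k \<le> \<epsilon> * real n / 2" "real k \<ge> \<epsilon> * real n / 4"
      using n4 unfolding k_def by linarith+
    have kn: "real k \<le> real n / 2"
      using k(1) mult_right_mono[of \<epsilon> 1 "real n"] \<epsilon> by linarith
    show "\<bar>psi_error n\<bar> \<le> \<epsilon> * real n"
    proof (rule ccontr)
      assume "\<not> \<bar>psi_error n\<bar> \<le> \<epsilon> * real n"
      then consider "psi_error n > \<epsilon> * real n" | "psi_error n < - \<epsilon> * real n" by linarith
      thus False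
      proof cases
        case 1
        \<comment> \<open>At least \<epsilon> n / 4 terms, each at least (\<epsilon> n / 2) / (2
          n)^2 = \<epsilon> / (8 n): hence the constant 1/32.\<close>
        have "\<epsilon>\<^sup>2 / 32 \<le> (\<Sum>i\<in>{n<..n+k}. \<epsilon> / (8 * real n))"
        proof -
          have "\<epsilon>\<^sup>2 / 32 = (\<epsilon> * real n / 4) * (\<epsilon> / (8 * real n))"
            using n0 by (simp add: power2_eq_square)
          also have "\<dots> \<le> real k * (\<epsilon> / (8 * real n))"
            using \<epsilon> k by (intro mult_right_mono) auto
          finally show ?thesis by simp
        qed
        also have "\<dots> \<le> (\<Sum>i\<in>{n<..n+k}. psi_error i / real i ^ 2)"
        proof (rule sum_mono)
          fix i assume i: "i \<in> {n<..n+k}"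
          hence ri: "real i \<le> real n + real k" by (auto simp flip: of_nat_add)
          have pm: "psi n \<le> psi i" using i by (intro psi_mono) auto
          have "\<epsilon> * real n / 2 \<le> psi_error i"
            using 1 pm ri k(1) unfolding psi_error_def by linarith
          moreover have "real i ^ 2 \<le> (2 * real n) ^ 2"
            using ri kn by (intro power_mono) auto
          moreover have "real i ^ 2 > 0" using i by simp
          ultimately have "(\<epsilon> * real n / 2) / (2 * real n) ^ 2 \<le> psi_error i / real i ^ 2"
            using en order.trans[OF en] by (intro frac_le) blast+
          moreover have "(\<epsilon> * real n / 2) / (2 * real n) ^ 2 = \<epsilon> / (8 * real n)"
            using n0 by (simp add: field_simps power2_eq_square)
          ultimately show "\<epsilon> / (8 * real n) \<le> psi_error i / real i ^ 2" by simp
        qed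
        finally show False using M[of n "n + k"] n by auto
      next
        case 2
        have kn': "k \<le> n" using kn by linarith
        have "\<epsilon>\<^sup>2 / 32 \<le> (\<Sum>i\<in>{n-k<..n}. \<epsilon> / (2 * real n))"
        proof -
          have "(\<epsilon> * real n / 4) * (\<epsilon> / (2 * real n)) = \<epsilon>\<^sup>2 / 8"
            using n0 by (simp add: power2_eq_square)
          moreover have "\<epsilon>\<^sup>2 \<ge> 0" by simp
          ultimately have "\<epsilon>\<^sup>2 / 32 \<le> (\<epsilon> * real n / 4) * (\<epsilon> / (2 * real n))"
            by linarith
          also have "\<dots> \<le> real k * (\<epsilon> / (2 * real n))"
            using \<epsilon> k by (intro mult_right_mono) auto
          finally show ?thesis using kn' by simp
        qed
        also have "\<dots> \<le> (\<Sum>i\<in>{n-k<..n}. - (psi_error i / real i ^ 2))"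
        proof (rule sum_mono)
          fix i assume i: "i \<in> {n-k<..n}"
          hence "n \<le> i + k" by auto
          hence "real n \<le> real (i + k)" by (rule of_nat_mono)
          hence ri: "real i \<ge> real n - real k" by simp
          have pm: "psi i \<le> psi n" using i by (intro psi_mono) auto
          have "\<epsilon> * real n / 2 \<le> - psi_error i"
            using 2 pm ri k(1) unfolding psi_error_def by linarith
          moreover have "real i ^ 2 \<le> real n ^ 2"
            using i by (intro power_mono) auto
          moreover have "real i ^ 2 > 0" using i by simp
          ultimately have "(\<epsilon> * real n / 2) / real n ^ 2 \<le> (- psi_error i) / real i ^ 2"
            using en order.trans[OF en] by (intro frac_le) blast+
          moreover have "(\<epsilon> * real n / 2) / real n ^ 2 = \<epsilon> / (2 * real n)"
            using n0 by (simp add: field_simps power2_eq_square)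
          ultimately show "\<epsilon> / (2 * real n) \<le> - (psi_error i / real i ^ 2)" by simp
        qed
        also have "\<dots> = - (\<Sum>i\<in>{n-k<..n}. psi_error i / real i ^ 2)"
          by (rule sum_negf)
        finally have ge: "\<epsilon>\<^sup>2 / 32 \<le> \<bar>\<Sum>i\<in>{n-k<..n}. psi_error i / real i ^ 2\<bar>" by linarith
        have "2 * k \<le> n" using kn by linarith
        moreover have "2 * M \<le> n" using n by linarith
        ultimately have "M \<le> n - k" by arith
        hence "\<bar>\<Sum>i\<in>{n-k<..n}. psi_error i / real i ^ 2\<bar> < \<epsilon>\<^sup>2 / 32"
          by (rule M) simp
        thus False using ge by linarith
      qed
    qed
  qed
qed

section \<open>Mean values\<close>

text \<open>Discrete Gronwall argument: once e n < c \<epsilon> / 2, each step multiplies the bound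
  for x n - \<epsilon> / 2 by 1 - c \<delta> n <= exp(-c \<delta> n), and divergence of the sum of
  the \<delta> n drives it to 0.\<close>

lemma recursion_tendsto_0:
  fixes x \<delta> e :: "nat \<Rightarrow> real"
  assumes c: "c > 0" and x: "\<And>n. x n \<ge> 0" and \<delta>: "\<And>n. \<delta> n \<ge> 0" "\<And>n. c * \<delta> n \<le> 1"
    and rec: "\<And>n. x (Suc n) \<le> (1 - c * \<delta> n) * x n + \<delta> n * e n"
    and e: "e \<longlonglongrightarrow> 0" and div: "filterlim (\<lambda>n. \<Sum>i<n. \<delta> i) at_top sequentially"
  shows "x \<longlonglongrightarrow> 0"
proof (rule tendstoI)
  fix \<epsilon> :: real assume \<epsilon>: "\<epsilon> > 0"
  have "eventually (\<lambda>n. e n < c * \<epsilon> / 2) sequentially"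
    by (rule order_tendstoD(2)[OF e]) (use c \<epsilon> in simp)
  then obtain n0 where n0: "\<And>n. n \<ge> n0 \<Longrightarrow> e n < c * \<epsilon> / 2"
    unfolding eventually_sequentially by blast
  define D where "D = (\<lambda>n. \<Sum>i<n. \<delta> i)"
  have bound: "x n - \<epsilon> / 2 \<le> x n0 * exp (- c * (D n - D n0))" if "n \<ge> n0" for n
    using that
  proof (induction n rule: dec_induct)
    case base
    thus ?case using \<epsilon> by simp
  next
    case (step n)
    have "x (Suc n) - \<epsilon> / 2 \<le> (1 - c * \<delta> n) * x n + \<delta> n * (c * \<epsilon> / 2) - \<epsilon> / 2"
      using rec[of n] mult_left_mono[of "e n" "c * \<epsilon> / 2" "\<delta> n"] n0[of n] \<delta>(1)[of n] step by simp
    also have "\<dots> = (1 - c * \<delta> n) * (x n - \<epsilon> / 2)" by (simp add: algebra_simps)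
    also have "\<dots> \<le> (1 - c * \<delta> n) * (x n0 * exp (- c * (D n - D n0)))"
      using step.IH \<delta>(2)[of n] by (intro mult_left_mono) auto
    also have "\<dots> \<le> exp (- (c * \<delta> n)) * (x n0 * exp (- c * (D n - D n0)))"
      using exp_ge_add_one_self[of "- (c * \<delta> n)"] x[of n0] by (intro mult_right_mono) auto
    also have "\<dots> = x n0 * exp (- c * (D (Suc n) - D n0))"
      by (simp add: D_def exp_add[symmetric] algebra_simps)
    finally show ?case .
  qed
  have "filterlim (\<lambda>n. - c * (D n - D n0)) at_bot sequentially"
  proof -
    have "filterlim (\<lambda>n. D n + (- D n0)) at_top sequentially"
      using filterlim_tendsto_add_at_top[OF tendsto_const div, of "- D n0"] by (simp add: D_def add.commute)
    hence "filterlim (\<lambda>n. c * (D n + (- D n0))) at_top sequentially"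
      by (intro filterlim_tendsto_pos_mult_at_top[OF tendsto_const c])
    hence "filterlim (\<lambda>n. - (- c * (D n - D n0))) at_top sequentially" by simp
    thus ?thesis unfolding filterlim_uminus_at_bot .
  qed
  hence "((\<lambda>n. x n0 * exp (- c * (D n - D n0))) \<longlongrightarrow> x n0 * 0) sequentially"
    by (intro tendsto_mult tendsto_const filterlim_compose[OF exp_at_bot])
  hence "eventually (\<lambda>n. x n0 * exp (- c * (D n - D n0)) < \<epsilon> / 2) sequentially"
    by (rule order_tendstoD(2)) (use \<epsilon> in simp)
  thus "eventually (\<lambda>n. dist (x n) 0 < \<epsilon>) sequentially"
    using eventually_ge_at_top[of n0]
  proof eventually_elim
    case (elim n)
    thus ?case using bound[of n] x[of n] by (simp add: dist_real_def)
  qed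
qed

section \<open>Pairs outside the generic case\<close>

lemma sum_power_ge_2_le:
  assumes "0 \<le> x" "x \<le> (1/2::real)"
  shows "(\<Sum>a=2..N. x ^ a) \<le> 2 * x ^ 2"
proof (cases "N \<ge> 1")
  case True
  \<comment> \<open>The extra 2 x^(N + 1) bounds the geometric tail beyond N and makes the induction
    close.\<close>
  have "(\<Sum>a=2..N. x ^ a) + 2 * x ^ Suc N \<le> 2 * x ^ 2"
    using True
  proof (induction N rule: dec_induct)
    case (step N)
    have "x ^ Suc N * (2 * x - 1) \<le> 0"
      using assms by (intro mult_nonneg_nonpos) auto
    thus ?case using step by (simp add: algebra_simps)
  qed (simp add: power2_eq_square)
  moreover have "2 * x ^ Suc N \<ge> 0" using assms by simp
  ultimately show ?thesis by linarith
qed (use assms in auto)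

text \<open>Equals -zeta'(2); it is the uniform constant in the O(N) errors from exceptional
  pairs.\<close>

definition ln_sq_sum :: real where
  "ln_sq_sum = (\<Sum>n. ln (real n) * real n powr (-2))"

lemma sum_ln_div_sq_le: "finite A \<Longrightarrow> (\<Sum>n\<in>A. ln (real n) / real n ^ 2) \<le> ln_sq_sum"
proof -
  assume A: "finite A"
  have "(\<Sum>n\<in>A. ln (real n) / real n ^ 2) = (\<Sum>n\<in>A. ln (real n) * real n powr (-2))"
    by (intro sum.cong refl) (auto simp: powr_minus divide_simps)
  also have "\<dots> \<le> ln_sq_sum"
    unfolding ln_sq_sum_def
  proof (rule sum_le_suminf)
    show "summable (\<lambda>n. ln (real n) * real n powr (-2))"
      by (rule summable_ln_powr) simp
    show "0 \<le> ln (real n) * real n powr (-2)" for n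
      by (cases "n = 0") auto
  qed (use A in auto)
  finally show ?thesis .
qed

text \<open>Only prime powers p^a with a >= 2 contribute, and for each p they form a geometric
  series bounded by 2 ln p / p^2.\<close>

lemma sum_mangoldt_nonprime_le:
  "(\<Sum>d\<in>{d\<in>{1..N}. \<not> prime d}. mangoldt d / real d) \<le> 2 * ln_sq_sum"
proof -
  define I where "I = {p\<in>{2..N}. prime p} \<times> {2..N}"
  define g where "g = (\<lambda>d. mangoldt d / real d)"
  have fin: "finite I" by (simp add: I_def)
  have "(\<Sum>d\<in>{d\<in>{1..N}. \<not> prime d}. g d) = (\<Sum>d\<in>{d\<in>{1..N}. \<not> prime d \<and> primepow d}. g d)"
    by (rule sum.mono_neutral_right) (auto simp: g_def mangoldt_def)
  also have "\<dots> \<le> (\<Sum>d\<in>(\<lambda>(p, a). p ^ a) ` I. g d)"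
  proof (rule sum_mono2)
    show "{d\<in>{1..N}. \<not> prime d \<and> primepow d} \<subseteq> (\<lambda>(p, a). p ^ a) ` I"
    proof
      fix d assume d: "d \<in> {d\<in>{1..N}. \<not> prime d \<and> primepow d}"
      then obtain p a where pa: "prime p" "a > 0" "d = p ^ a"
        unfolding primepow_def by auto
      have "a \<noteq> 1" using d pa by auto
      hence a: "a \<ge> 2" using pa by simp
      have p: "p \<ge> 2" using pa prime_ge_2_nat by auto
      have "p \<le> d" using pa p by (simp add: self_le_power)
      hence pN: "p \<le> N" using d by simp
      \<comment> \<open>A crude bound for the exponent, which places all pairs (p, a) in a finite
        rectangle.\<close>
      have "a < 2 ^ a" by (rule less_exp)
      also have "(2::nat) ^ a \<le> p ^ a" by (rule power_mono[OF p]) simp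
      finally have "a \<le> d" using pa(3) by simp
      hence aN: "a \<le> N" using d by simp
      show "d \<in> (\<lambda>(p, a). p ^ a) ` I"
        using pN aN pa a p by (intro image_eqI[of _ _ "(p, a)"]) (simp_all add: I_def)
    qed
  qed (use fin in \<open>auto simp: g_def mangoldt_nonneg\<close>)
  also have "\<dots> \<le> (\<Sum>x\<in>I. (g \<circ> (\<lambda>(p, a). p ^ a)) x)"
    by (rule sum_image_le[OF fin]) (auto simp: g_def mangoldt_nonneg)
  also have "\<dots> = (\<Sum>x\<in>I. (\<lambda>(p, a). ln (real p) * (1 / real p) ^ a) x)"
    by (intro sum.cong refl) (auto simp: I_def g_def power_divide)
  also have "\<dots> = (\<Sum>p\<in>{p\<in>{2..N}. prime p}. \<Sum>a=2..N. ln (real p) * (1 / real p) ^ a)"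
    unfolding I_def by (rule sum.cartesian_product[symmetric])
  also have "\<dots> \<le> (\<Sum>p\<in>{p\<in>{2..N}. prime p}. 2 * (ln (real p) / real p ^ 2))"
  proof (rule sum_mono)
    fix p assume "p \<in> {p\<in>{2..N}. prime p}"
    hence p: "real p \<ge> 2" by simp
    have "(\<Sum>a=2..N. ln (real p) * (1 / real p) ^ a) = ln (real p) * (\<Sum>a=2..N. (1 / real p) ^ a)"
      by (simp add: sum_distrib_left)
    also have "\<dots> \<le> ln (real p) * (2 * (1 / real p) ^ 2)"
      using p by (intro mult_left_mono sum_power_ge_2_le) (auto simp: field_simps)
    finally show "(\<Sum>a=2..N. ln (real p) * (1 / real p) ^ a) \<le> 2 * (ln (real p) / real p ^ 2)"
      by (simp add: power_divide mult.commute)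
  qed
  also have "\<dots> \<le> 2 * ln_sq_sum"
    unfolding sum_distrib_left[symmetric] by (intro mult_left_mono sum_ln_div_sq_le) auto
  finally show ?thesis by (simp add: g_def)
qed

lemma real_div_bounds:
  "real (n div m) \<le> real n / real m" "real n / real m \<le> real (n div m) + 1"
proof -
  have *: "real (n div m) * real m + real (n mod m) = real n"
    by (metis div_mult_mod_eq of_nat_add of_nat_mult)
  have "real (n div m) * real m \<le> real n" using * by linarith
  thus "real (n div m) \<le> real n / real m"
    by (cases "m = 0") (simp_all add: le_divide_eq)
  show "real n / real m \<le> real (n div m) + 1"
  proof (cases "m = 0")
    case False
    hence "real (n mod m) \<le> real m" by (simp add: less_imp_le)
    hence "real n \<le> (real (n div m) + 1) * real m"
      using * unfolding distrib_right by linarith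
    thus ?thesis using False by (simp add: divide_le_eq)
  qed simp
qed

lemma card_multiples_le: "card {m \<in> {1..M}. d dvd m} \<le> M div (d::nat)"
proof (cases "d = 0")
  case False
  have "{m \<in> {1..M}. d dvd m} \<subseteq> (\<lambda>i. d * i) ` {1..M div d}"
  proof
    fix m assume m: "m \<in> {m \<in> {1..M}. d dvd m}"
    then obtain i where i: "m = d * i" by auto
    moreover have "i \<in> {1..M div d}"
      using m i False by (auto simp: less_eq_div_iff_mult_less_eq mult.commute intro!: Suc_leI gr0I)
    ultimately show "m \<in> (\<lambda>i. d * i) ` {1..M div d}" by blast
  qed
  hence "card {m \<in> {1..M}. d dvd m} \<le> card ((\<lambda>i. d * i) ` {1..M div d})"
    by (intro card_mono) auto
  also have "\<dots> \<le> card {1..M div d}" by (rule card_image_le) auto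
  finally show ?thesis by simp
qed auto

text \<open>The summand picks the pairs for which f(d m) = z f(m) cannot be used. For prime d at
  most N / d^2 values of m are multiples of d, giving one \<open>ln_sq_sum\<close>; the remaining d
  give two.\<close>

lemma sum_mangoldt_exceptional_le:
  "(\<Sum>d=1..N. \<Sum>m=1..N div d. if prime d \<and> \<not> d dvd m then 0 else mangoldt d) \<le> 3 * ln_sq_sum * real N"
proof -
  have "(\<Sum>m=1..N div d. if prime d \<and> \<not> d dvd m then 0 else mangoldt d) \<le>
          real N * ((if prime d then ln (real d) / real d ^ 2 else 0) + (if prime d then 0 else mangoldt d / real d))"
    if d: "d \<in> {1..N}" for d
  proof (cases "prime d")
    case True
    have "(\<Sum>m=1..N div d. if prime d \<and> \<not> d dvd m then 0 else mangoldt d) =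
            (\<Sum>m\<in>{m\<in>{1..N div d}. d dvd m}. ln (real d))"
      using True by (subst sum.inter_filter) (auto intro!: sum.cong)
    also have "\<dots> = real (card {m\<in>{1..N div d}. d dvd m}) * ln (real d)" by simp
    also have "\<dots> \<le> real (N div d div d) * ln (real d)"
      using d by (intro mult_right_mono) (use card_multiples_le in auto)
    also have "\<dots> \<le> (real N / real d ^ 2) * ln (real d)"
      using d real_div_bounds(1)[of N "d * d"]
      by (intro mult_right_mono) (auto simp: div_mult2_eq power2_eq_square)
    finally show ?thesis using True by simp
  next
    case False
    have "(\<Sum>m=1..N div d. if prime d \<and> \<not> d dvd m then 0 else mangoldt d) = real (N div d) * mangoldt d"
      using False by simp
    also have "\<dots> \<le> (real N / real d) * mangoldt d"
      by (intro mult_right_mono real_div_bounds mangoldt_nonneg)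
    finally show ?thesis using False by simp
  qed
  hence "(\<Sum>d=1..N. \<Sum>m=1..N div d. if prime d \<and> \<not> d dvd m then 0 else mangoldt d) \<le>
     (\<Sum>d=1..N. real N * ((if prime d then ln (real d) / real d ^ 2 else 0) + (if prime d then 0 else mangoldt d / real d)))"
    by (rule sum_mono)
  also have "\<dots> = real N * ((\<Sum>d=1..N. if prime d then ln (real d) / real d ^ 2 else 0) + (\<Sum>d=1..N. if prime d then 0 else mangoldt d / real d))"
    by (simp only: sum_distrib_left[symmetric] sum.distrib)
  also have "(\<Sum>d=1..N. if prime d then ln (real d) / real d ^ 2 else 0) = (\<Sum>d\<in>{d\<in>{1..N}. prime d}. ln (real d) / real d ^ 2)"
    by (subst sum.inter_filter) auto
  also have "(\<Sum>d=1..N. if prime d then 0 else mangoldt d / real d) = (\<Sum>d\<in>{d\<in>{1..N}. \<not> prime d}. mangoldt d / real d)"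
    by (subst sum.inter_filter) (auto intro!: sum.cong)
  also have "real N * ((\<Sum>d\<in>{d\<in>{1..N}. prime d}. ln (real d) / real d ^ 2) + (\<Sum>d\<in>{d\<in>{1..N}. \<not> prime d}. mangoldt d / real d))
        \<le> real N * (ln_sq_sum + 2 * ln_sq_sum)"
    by (intro mult_left_mono add_mono sum_ln_div_sq_le sum_mangoldt_nonprime_le) auto
  finally show ?thesis by (simp add: algebra_simps)
qed

text \<open>A one-sided Stirling bound. Passing from N to N + 1 raises each of the N terms by ln(1 +
  1 / N) <= 1 / N.\<close>

lemma ln_minus_ln_sum_le: "N > 0 \<Longrightarrow> (\<Sum>n=1..N. ln (real N) - ln (real n)) \<le> real N"
proof (induction N rule: nat_induct_non_zero)
  case (Suc N)
  have N: "real N > 0" using Suc by simp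
  have "(\<Sum>n=1..Suc N. ln (real (Suc N)) - ln (real n)) =
          (\<Sum>n=1..N. (ln (real N) - ln (real n)) + (ln (real (Suc N)) - ln (real N)))"
    by simp
  also have "\<dots> = (\<Sum>n=1..N. ln (real N) - ln (real n)) + real N * (ln (real (Suc N)) - ln (real N))"
    by (subst sum.distrib) simp
  also have "ln (real (Suc N)) - ln (real N) = ln (1 + 1 / real N)"
  proof -
    have "ln (real (Suc N)) - ln (real N) = ln (real (Suc N) / real N)"
      using N by (simp add: ln_div)
    also have "real (Suc N) / real N = 1 + 1 / real N" using N by (simp add: field_simps)
    finally show ?thesis .
  qed
  also have "real N * ln (1 + 1 / real N) \<le> real N * (1 / real N)"
    using N by (intro mult_left_mono ln_add_one_self_le_self) auto
  also have "\<dots> = 1" using N by simp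
  finally show ?case using Suc.IH by simp
qed auto

lemma harm_ln_diff:
  assumes "N > 0"
  shows "0 \<le> harm N - ln (real N)" "harm N - ln (real N) \<le> 1"
proof -
  have "ln (real N) \<le> ln (real N + 1)" using assms by simp
  thus "0 \<le> harm N - ln (real N)" using ln_le_harm[of N] by simp
  obtain n where n: "N = Suc n" using assms gr0_implies_Suc by blast
  show "harm N - ln (real N) \<le> 1"
    using decseqD[OF decseq_harm_diff_ln, of 0 n] n by (simp add: harm_expand)
qed

section \<open>Mean values of functions with f(p m) = z f(m)\<close>

locale prime_eigenfunction =
  fixes f :: "nat \<Rightarrow> complex" and z :: complex
  assumes norm_f: "norm (f n) \<le> 1"
    and f_prime: "prime p \<Longrightarrow> \<not> p dvd m \<Longrightarrow> m > 0 \<Longrightarrow> f (p * m) = z * f m"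
    and norm_z: "norm z = 1"
begin

definition S where "S N = (\<Sum>n=1..N. f n)"
definition L where "L N = (\<Sum>n=1..N. f n / of_nat n)"

text \<open>Expand ln n through \<open>mangoldt\<close> and replace f(d m) by z f(m). Each
  exceptional pair costs at most 2 \<open>mangoldt d\<close>, which doubles the constant 3 of
  \<open>sum_mangoldt_exceptional_le\<close>.\<close>

lemma log_weighted_sum:
  "norm ((\<Sum>n=1..N. f n * of_real (ln (real n))) - z * (\<Sum>m=1..N. f m * of_real (psi (N div m)))) \<le> 6 * ln_sq_sum * real N"
proof -
  have "(\<Sum>n=1..N. f n * of_real (ln (real n))) = (\<Sum>n=1..N. \<Sum>d | d dvd n. mangoldt d * f (d * (n div d)))"
  proof (rule sum.cong[OF refl])
    fix n assume n: "n \<in> {1..N}"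
    have "(\<Sum>d | d dvd n. mangoldt d * f (d * (n div d))) = (\<Sum>d | d dvd n. mangoldt d) * f n"
      unfolding sum_distrib_right by (intro sum.cong) auto
    also have "(\<Sum>d | d dvd n. mangoldt d) = complex_of_real (ln (real n))"
      using n by (subst mangoldt_sum) auto
    finally show "f n * of_real (ln (real n)) = (\<Sum>d | d dvd n. mangoldt d * f (d * (n div d)))"
      by (simp add: mult.commute)
  qed
  also have "\<dots> = (\<Sum>d=1..N. \<Sum>m=1..N div d. mangoldt d * f (d * m))"
    by (rule sum_divisors_swap)
  finally have 1: "(\<Sum>n=1..N. f n * of_real (ln (real n))) = (\<Sum>d=1..N. \<Sum>m=1..N div d. mangoldt d * f (d * m))" .
  have "z * (\<Sum>m=1..N. f m * of_real (psi (N div m))) = (\<Sum>m=1..N. \<Sum>d=1..N div m. mangoldt d * (z * f m))"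
    by (simp add: psi_def sum_distrib_left sum_distrib_right mult_ac)
  also have "\<dots> = (\<Sum>d=1..N. \<Sum>m=1..N div d. mangoldt d * (z * f m))"
    by (rule sum_hyperbola_swap[symmetric])
  finally have 2: "z * (\<Sum>m=1..N. f m * of_real (psi (N div m))) = (\<Sum>d=1..N. \<Sum>m=1..N div d. mangoldt d * (z * f m))" .
  have "norm (\<Sum>d=1..N. \<Sum>m=1..N div d. mangoldt d * (f (d * m) - z * f m)) \<le>
          (\<Sum>d=1..N. \<Sum>m=1..N div d. 2 * (if prime d \<and> \<not> d dvd m then 0 else mangoldt d))"
  proof (intro order.trans[OF norm_sum] sum_mono)
    fix d m assume "d \<in> {1..N}" "m \<in> {1..N div d}"
    show "norm (mangoldt d * (f (d * m) - z * f m)) \<le> 2 * (if prime d \<and> \<not> d dvd m then 0 else mangoldt d)"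
    proof (cases "prime d \<and> \<not> d dvd m")
      case True
      thus ?thesis using f_prime[of d m] \<open>m \<in> _\<close> by simp
    next
      case False
      have "norm (f (d * m) - z * f m) \<le> norm (f (d * m)) + norm (z * f m)"
        by (rule norm_triangle_ineq4)
      also have "\<dots> \<le> 1 + 1"
        using norm_f norm_z by (intro add_mono) (auto simp: norm_mult)
      finally show ?thesis using False mult_left_mono[OF _ mangoldt_nonneg, of "norm (f (d * m) - z * f m)" 2 d]
        by (auto simp: norm_mult mult.commute)
    qed
  qed
  also have "\<dots> \<le> 2 * (3 * ln_sq_sum * real N)"
    unfolding sum_distrib_left[symmetric] by (intro mult_left_mono sum_mangoldt_exceptional_le) auto
  finally show ?thesis
    unfolding 1 2 by (simp add: sum_subtractf right_diff_distrib)
qed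

text \<open>The prime number theorem applies only where N div m is large. Chebyshev's bound absorbs
  the other m into 4 n0, and rounding N / m adds 1; summed over m both are O(N).\<close>

lemma psi_sum_approx:
  assumes \<epsilon>: "0 < \<epsilon>" "\<epsilon> < 1"
  obtains K where "K \<ge> 0" "\<And>N. norm ((\<Sum>m=1..N. f m * of_real (psi (N div m))) - of_nat N * L N) \<le> \<epsilon> * real N * harm N + K * real N"
proof -
  obtain n0 where n0: "\<And>n. n \<ge> n0 \<Longrightarrow> \<bar>psi_error n\<bar> \<le> \<epsilon> * real n"
    using prime_number_theorem[OF \<epsilon>] by blast
  have err: "\<bar>psi_error n\<bar> \<le> \<epsilon> * real n + 4 * real n0" for n
  proof (cases "n \<ge> n0")
    case True thus ?thesis using n0[of n] by simp
  next
    case False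
    moreover have "0 \<le> \<epsilon> * real n" using \<epsilon> by simp
    ultimately show ?thesis using psi_error_bound[of n] by linarith
  qed
  show ?thesis
  proof (rule that[of "4 * real n0 + 1"])
    fix N
    have "norm ((\<Sum>m=1..N. f m * of_real (psi (N div m))) - of_nat N * L N) =
          norm (\<Sum>m=1..N. f m * of_real (psi (N div m) - real N / real m))"
      by (simp add: L_def sum_distrib_left sum_subtractf[symmetric] algebra_simps)
    also have "\<dots> \<le> (\<Sum>m=1..N. \<epsilon> * (real N / real m) + (4 * real n0 + 1))"
    proof (intro order.trans[OF norm_sum] sum_mono)
      fix m assume m: "m \<in> {1..N}"
      have le: "real (N div m) \<le> real N / real m" by (rule real_div_bounds)
      have ge: "real N / real m - real (N div m) \<le> 1" using real_div_bounds(2)[of N m] by simp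
      have "\<epsilon> * real (N div m) \<le> \<epsilon> * (real N / real m)" using le \<epsilon> by (intro mult_left_mono) auto
      hence "\<bar>psi (N div m) - real N / real m\<bar> \<le> \<epsilon> * (real N / real m) + (4 * real n0 + 1)"
        using err[of "N div m"] le ge unfolding psi_error_def by linarith
      moreover have "norm (f m * of_real (psi (N div m) - real N / real m)) \<le> 1 * \<bar>psi (N div m) - real N / real m\<bar>"
        unfolding norm_mult norm_of_real by (intro mult_right_mono norm_f) auto
      ultimately show "norm (f m * of_real (psi (N div m) - real N / real m)) \<le> \<epsilon> * (real N / real m) + (4 * real n0 + 1)"
        by simp
    qed
    also have "\<dots> = \<epsilon> * real N * harm N + (4 * real n0 + 1) * real N"
      unfolding sum.distrib harm_def sum_distrib_left by (simp add: divide_inverse mult_ac distrib_left)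
    finally show "norm ((\<Sum>m=1..N. f m * of_real (psi (N div m))) - of_nat N * L N) \<le>
        \<epsilon> * real N * harm N + (4 * real n0 + 1) * real N" .
  qed simp
qed

text \<open>On average ln n differs from ln N by O(1), and ln N from \<open>harm N\<close> by at
  most 1. The normalisation by \<open>harm\<close> has increments exactly 1 / N, which makes the
  later recursion exact.\<close>

lemma log_sum_approx:
  "norm (S N * of_real (harm N) - (\<Sum>n=1..N. f n * of_real (ln (real n)))) \<le> 2 * real N"
proof (cases "N = 0")
  case False
  hence N: "N > 0" by simp
  have "norm (S N * of_real (harm N) - (\<Sum>n=1..N. f n * of_real (ln (real n)))) =
        norm (\<Sum>n=1..N. f n * of_real (harm N - ln (real n)))"
    unfolding S_def sum_distrib_right sum_subtractf[symmetric] by (simp add: right_diff_distrib)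
  also have "\<dots> \<le> (\<Sum>n=1..N. (ln (real N) - ln (real n)) + 1)"
  proof (intro order.trans[OF norm_sum] sum_mono)
    fix n assume n: "n \<in> {1..N}"
    have "ln (real n) \<le> ln (real N)" using n by auto
    hence "\<bar>harm N - ln (real n)\<bar> \<le> ln (real N) - ln (real n) + 1"
      using harm_ln_diff[OF N] by linarith
    moreover have "norm (f n * of_real (harm N - ln (real n))) \<le> 1 * \<bar>harm N - ln (real n)\<bar>"
      unfolding norm_mult norm_of_real by (intro mult_right_mono norm_f) auto
    ultimately show "norm (f n * of_real (harm N - ln (real n))) \<le> (ln (real N) - ln (real n)) + 1" by simp
  qed
  also have "\<dots> = (\<Sum>n=1..N. ln (real N) - ln (real n)) + real N"
    by (subst sum.distrib) simp
  finally show ?thesis using ln_minus_ln_sum_le[OF N] by simp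
qed (simp add: S_def)

text \<open>Three errors are divided by N harm N: the O(N) parts, collected in \<open>K'\<close>,
  die out, and what remains is the \<eta> of the prime number theorem, which is arbitrary.\<close>

lemma mean_log_mean:
  "(\<lambda>N. S N / of_nat N - z * L N / of_real (harm N)) \<longlonglongrightarrow> 0"
proof (rule tendstoI)
  fix \<epsilon> :: real assume \<epsilon>: "\<epsilon> > 0"
  define \<eta> where "\<eta> = min (1/2) (\<epsilon> / 2)"
  have \<eta>: "0 < \<eta>" "\<eta> < 1" "\<eta> \<le> \<epsilon> / 2" using \<epsilon> by (auto simp: \<eta>_def)
  obtain K where K: "K \<ge> 0" "\<And>N. norm ((\<Sum>m=1..N. f m * of_real (psi (N div m))) - of_nat N * L N) \<le> \<eta> * real N * harm N + K * real N"
    using psi_sum_approx[OF \<eta>(1,2)] by blast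
  define K' where "K' = K + 6 * ln_sq_sum + 2"
  have "((\<lambda>N. K' / harm N :: real) \<longlongrightarrow> 0) sequentially"
    by (intro tendsto_divide_0[OF tendsto_const] filterlim_at_top_imp_at_infinity harm_at_top)
  hence "eventually (\<lambda>N. K' / harm N < \<epsilon> / 2) sequentially"
    by (rule order_tendstoD(2)) (use \<epsilon> in simp)
  thus "eventually (\<lambda>N. dist (S N / of_nat N - z * L N / of_real (harm N)) 0 < \<epsilon>) sequentially"
    using eventually_gt_at_top[of 0]
  proof eventually_elim
    case (elim N)
    define H where "H = (harm N :: real)"
    have H: "H > 0" using elim by (simp add: H_def harm_pos)
    define A where "A = (\<Sum>n=1..N. f n * of_real (ln (real n)))"
    define B where "B = (\<Sum>m=1..N. f m * of_real (psi (N div m)))"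
    have "S N * of_real H - z * (of_nat N * L N) = (S N * of_real H - A) + (A - z * B) + z * (B - of_nat N * L N)"
      by (simp add: algebra_simps)
    also have "norm \<dots> \<le> 2 * real N + 6 * ln_sq_sum * real N + (\<eta> * real N * H + K * real N)"
      using log_sum_approx[of N] log_weighted_sum[of N] K(2)[of N] norm_z
      unfolding A_def[symmetric] B_def[symmetric] H_def[symmetric]
      by (intro norm_triangle_mono) (auto simp: norm_mult)
    also have "\<dots> = real N * H * (\<eta> + K' / H)"
      using H by (simp add: K'_def field_simps)
    finally have le: "norm (S N * of_real H - z * (of_nat N * L N)) \<le> real N * H * (\<eta> + K' / H)" .
    have "S N / of_nat N - z * L N / of_real H = (S N * of_real H - z * (of_nat N * L N)) / of_real (real N * H)"
      using elim H by (simp add: field_simps)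
    hence "norm (S N / of_nat N - z * L N / of_real H) = norm (S N * of_real H - z * (of_nat N * L N)) / (real N * H)"
      using H by (simp only: norm_divide norm_of_real) simp
    also have "\<dots> \<le> \<eta> + K' / H"
      using le H elim by (simp add: divide_le_eq mult.commute)
    also have "\<dots> < \<epsilon>" using elim(1) \<eta>(3) unfolding H_def by linarith
    finally show ?case by (simp add: dist_norm H_def)
  qed
qed

lemma norm_mean_le: "norm (S N / of_nat N) \<le> 1"
proof -
  have "norm (S N) \<le> (\<Sum>n=1..N. 1)"
    unfolding S_def by (intro order.trans[OF norm_sum] sum_mono norm_f)
  thus ?thesis by (simp add: norm_divide divide_le_eq)
qed

text \<open>In the variable \<open>u = ln (ln N)\<close> the normalised logarithmic mean \<open>V\<close> satisfies
  \<open>V' = (z - 1) V + o(1)\<close>, a contracting equation because \<open>Re z < 1\<close>.\<close>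

theorem mean_tendsto_0:
  assumes z1: "z \<noteq> 1"
  shows "(\<lambda>N. (\<Sum>n=1..N. f n) / of_nat N) \<longlonglongrightarrow> 0"
proof -
  define M where "M = (\<lambda>N. S N / of_nat N)"
  define H where "H = (\<lambda>N. harm N :: real)"
  \<comment> \<open>Subtracting \<open>M N\<close> cancels the new value f(N + 1) between L and M,
    so \<open>V (Suc N)\<close> depends on \<open>V N\<close> and \<open>M N\<close> alone. As |M N|
    <= 1, it changes L N / H N only by o(1).\<close>
  define V where "V = (\<lambda>N. (L N - M N) / of_real (H N))"
  define E where "E = (\<lambda>N. M N - z * V N)"
  define \<delta> where "\<delta> = (\<lambda>N. 1 / (real (Suc N) * H (Suc N)))"
  \<comment> \<open>The squared modulus of 1 + t (z - 1) is 1 - 2 t (1 - t) (1 - Re z); for 0 <= t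
    <= 1/2 this is at most 1 - 2 c t <= (1 - c t)^2.\<close>
  define c where "c = (1 - Re z) / 2"
  have H_pos: "H N > 0" if "N > 0" for N using that by (simp add: H_def harm_pos)
  have H_Suc: "H (Suc N) = H N + 1 / real (Suc N)" for N
    by (simp add: H_def harm_Suc inverse_eq_divide)
  have H_ge1: "H (Suc N) \<ge> 1" for N
    using harm_mono[of 1 "Suc N", where 'a = real] by (simp add: H_def harm_expand)
  have Re_z: "Re z < 1" "Re z \<ge> -1"
  proof -
    have "Re z \<noteq> 1"
    proof
      assume "Re z = 1"
      hence "Im z = 0" using norm_z by (simp add: cmod_def)
      thus False using z1 \<open>Re z = 1\<close> by (simp add: complex_eq_iff)
    qed
    thus "Re z < 1" "Re z \<ge> -1" using abs_Re_le_cmod[of z] norm_z by auto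
  qed
  have c: "c > 0" "c \<le> 1" using Re_z by (auto simp: c_def)
  have \<delta>_nonneg: "\<delta> N \<ge> 0" for N using H_pos[of "Suc N"] by (simp add: \<delta>_def)
  have \<delta>_le: "\<delta> N \<le> 1 / 2" if "N > 0" for N
  proof -
    have "2 * 1 \<le> real (Suc N) * H (Suc N)"
      using that H_ge1[of N] by (intro mult_mono) auto
    thus ?thesis by (simp add: \<delta>_def divide_simps)
  qed
  have Hinv: "(\<lambda>N. 1 / H N) \<longlonglongrightarrow> 0"
    unfolding H_def
    by (intro tendsto_divide_0[OF tendsto_const] filterlim_at_top_imp_at_infinity harm_at_top)
  have E_lim: "E \<longlonglongrightarrow> 0"
  proof -
    have "(\<lambda>N. M N / of_real (H N)) \<longlonglongrightarrow> 0"
    proof (rule Lim_null_comparison[OF _ Hinv])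
      show "eventually (\<lambda>N. norm (M N / of_real (H N)) \<le> 1 / H N) sequentially"
        using eventually_gt_at_top[of 0]
      proof eventually_elim
        case (elim N)
        have "norm (M N) \<le> 1" using norm_mean_le[of N] by (simp only: M_def)
        thus ?case using H_pos[OF elim] by (simp add: norm_divide divide_right_mono)
      qed
    qed
    hence "(\<lambda>N. (S N / of_nat N - z * L N / of_real (harm N)) + z * (M N / of_real (H N))) \<longlonglongrightarrow> 0 + z * 0"
      by (intro tendsto_intros mean_log_mean)
    thus ?thesis unfolding E_def V_def M_def H_def
      by (simp add: diff_divide_distrib algebra_simps)
  qed
  have H_ratio: "H N / H (Suc N) = 1 - \<delta> N" for N
  proof -
    have "H N = H (Suc N) - 1 / real (Suc N)" using H_Suc[of N] by simp
    hence "H N / H (Suc N) = H (Suc N) / H (Suc N) - (1 / real (Suc N)) / H (Suc N)"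
      by (simp only: diff_divide_distrib)
    thus ?thesis using H_pos[of "Suc N"] by (simp add: \<delta>_def del: of_nat_Suc)
  qed
  have V_Suc: "V (Suc N) = (1 + of_real (\<delta> N) * (z - 1)) * V N + of_real (\<delta> N) * E N" if N: "N > 0" for N
  proof -
    have S_Suc: "S (Suc N) = S N + f (Suc N)" and L_Suc: "L (Suc N) = L N + f (Suc N) / of_nat (Suc N)"
      by (simp_all add: S_def L_def)
    have "L (Suc N) - M (Suc N) = L N - S N / of_nat (Suc N)"
      unfolding S_Suc L_Suc M_def by (simp add: add_divide_distrib del: of_nat_Suc)
    also have "S N / of_nat (Suc N) = M N - M N / of_nat (Suc N)"
    proof -
      have "S N = M N * (of_nat (Suc N) - 1)" using N by (simp add: M_def)
      thus ?thesis by (simp add: diff_divide_distrib right_diff_distrib del: of_nat_Suc)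
    qed
    finally have 1: "L (Suc N) - M (Suc N) = (L N - M N) + M N / of_nat (Suc N)" by simp
    have 2: "L N - M N = V N * of_real (H N)" using H_pos[OF N] by (simp add: V_def)
    have 3: "M N = z * V N + E N" by (simp add: E_def)
    have "of_real (H N) / of_real (H (Suc N)) = complex_of_real (H N / H (Suc N))" by simp
    hence 4: "of_real (H N) / of_real (H (Suc N)) = 1 - complex_of_real (\<delta> N)"
      unfolding H_ratio by simp
    have 5: "1 / (of_nat (Suc N) * of_real (H (Suc N))) = complex_of_real (\<delta> N)"
      by (simp add: \<delta>_def del: of_nat_Suc)
    have "V (Suc N) = (L (Suc N) - M (Suc N)) / of_real (H (Suc N))" by (simp only: V_def)
    also have "\<dots> = (V N * of_real (H N) + M N / of_nat (Suc N)) / of_real (H (Suc N))"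
      by (simp only: 1 2)
    also have "\<dots> = V N * (of_real (H N) / of_real (H (Suc N))) + M N * (1 / (of_nat (Suc N) * of_real (H (Suc N))))"
      by (simp add: add_divide_distrib del: of_nat_Suc)
    also have "\<dots> = (1 + of_real (\<delta> N) * (z - 1)) * V N + of_real (\<delta> N) * E N"
    proof -
      have "v * (1 - d) + (z * v + e) * d = (1 + d * (z - 1)) * v + d * e" for v d e :: complex
        by (simp add: algebra_simps)
      thus ?thesis unfolding 4 5 by (simp only: 3)
    qed
    finally show ?thesis .
  qed
  have contr: "norm (1 + of_real t * (z - 1)) \<le> 1 - c * t" if t: "0 \<le> t" "t \<le> 1 / 2" for t
  proof (rule power2_le_imp_le)
    have z2: "(Re z)\<^sup>2 + (Im z)\<^sup>2 = 1" using cmod_power2[of z] norm_z by simp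
    have "norm (1 + of_real t * (z - 1)) ^ 2 = (1 + t * (Re z - 1))\<^sup>2 + (t * Im z)\<^sup>2"
      unfolding cmod_power2 by simp
    also have "\<dots> = 1 + 2 * t * (Re z - 1) + t\<^sup>2 * (((Re z)\<^sup>2 + (Im z)\<^sup>2) - 2 * Re z + 1)"
      by (simp add: power2_eq_square algebra_simps)
    also have "\<dots> = 1 - 2 * t * (1 - t) * (1 - Re z)"
      unfolding z2 by (simp add: power2_eq_square algebra_simps)
    also have "\<dots> \<le> 1 - 2 * c * t"
    proof -
      have "t * (1 - Re z) * 1 \<le> t * (1 - Re z) * (2 * (1 - t))"
        using t Re_z by (intro mult_left_mono) auto
      moreover have "2 * c = 1 - Re z" by (simp add: c_def)
      hence "1 - 2 * c * t = 1 - (1 - Re z) * t" by metis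
      ultimately show ?thesis by (simp add: algebra_simps)
    qed
    also have "\<dots> \<le> 1 - 2 * c * t + (c * t)\<^sup>2" by simp
    also have "\<dots> = (1 - c * t)\<^sup>2" by (simp add: power2_eq_square algebra_simps)
    finally show "norm (1 + of_real t * (z - 1)) ^ 2 \<le> (1 - c * t)\<^sup>2" .
    have "c * t \<le> 1 * 1" using c t by (intro mult_mono) auto
    thus "0 \<le> 1 - c * t" by simp
  qed
  have "(\<lambda>n. norm (V (Suc n))) \<longlonglongrightarrow> 0"
  \<comment> \<open>The shift by one drops \<delta> 0 = 1, the only step longer than 1/2.\<close>
  proof (rule recursion_tendsto_0[of c _ "\<lambda>n. \<delta> (Suc n)" "\<lambda>n. norm (E (Suc n))"])
    show "c * \<delta> (Suc n) \<le> 1" for n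
      using mult_mono[OF c(2) \<delta>_le[of "Suc n"]] \<delta>_nonneg[of "Suc n"] by simp
    show "norm (V (Suc (Suc n))) \<le> (1 - c * \<delta> (Suc n)) * norm (V (Suc n)) + \<delta> (Suc n) * norm (E (Suc n))" for n
    proof -
      have "norm (V (Suc (Suc n))) \<le> norm ((1 + of_real (\<delta> (Suc n)) * (z - 1)) * V (Suc n)) + norm (of_real (\<delta> (Suc n)) * E (Suc n))"
        unfolding V_Suc[OF zero_less_Suc] by (rule norm_triangle_ineq)
      also have "norm ((1 + of_real (\<delta> (Suc n)) * (z - 1)) * V (Suc n)) \<le> (1 - c * \<delta> (Suc n)) * norm (V (Suc n))"
        unfolding norm_mult by (intro mult_right_mono contr \<delta>_nonneg \<delta>_le) auto
      also have "norm (of_real (\<delta> (Suc n)) * E (Suc n)) = \<delta> (Suc n) * norm (E (Suc n))"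
        using \<delta>_nonneg[of "Suc n"] by (simp add: norm_mult)
      finally show ?thesis by simp
    qed
    show "(\<lambda>n. norm (E (Suc n))) \<longlonglongrightarrow> 0"
      using tendsto_norm_zero[OF LIMSEQ_Suc[OF E_lim]] .
    \<comment> \<open>The increment of ln H is -ln(1 - \<delta>) <= 2 \<delta>, so the sum of the
      steps dominates half of ln H, which is unbounded.\<close>
    have step: "(ln (H (Suc (Suc n))) - ln (H (Suc n))) / 2 \<le> \<delta> (Suc n)" for n
    proof -
      have pos: "H (Suc n) > 0" "H (Suc (Suc n)) > 0" using H_pos by auto
      have d: "\<delta> (Suc n) \<le> 1 / 2" "\<delta> (Suc n) \<ge> 0" using \<delta>_le \<delta>_nonneg by auto
      have "ln (H (Suc (Suc n))) - ln (H (Suc n)) = ln (1 / (H (Suc n) / H (Suc (Suc n))))"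
        using pos by (simp add: ln_div)
      also have "\<dots> = ln (1 / (1 - \<delta> (Suc n)))" unfolding H_ratio ..
      also have "\<dots> \<le> 1 / (1 - \<delta> (Suc n)) - 1"
        using d by (intro ln_le_minus_one) auto
      also have "\<dots> = \<delta> (Suc n) * (1 / (1 - \<delta> (Suc n)))" using d by (simp add: field_simps)
      also have "\<dots> \<le> \<delta> (Suc n) * 2"
        using d by (intro mult_left_mono) (auto simp: field_simps)
      finally show ?thesis by simp
    qed
    have sum_ge: "(ln (H (Suc n)) - ln (H 1)) / 2 \<le> (\<Sum>i<n. \<delta> (Suc i))" for n
    proof (induction n)
      case (Suc n)
      thus ?case using step[of n] unfolding sum.lessThan_Suc diff_divide_distrib by linarith
    qed simp
    have "filterlim (\<lambda>n. ln (H (Suc n))) at_top sequentially"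
      unfolding H_def
      by (intro filterlim_compose[OF ln_at_top] filterlim_compose[OF harm_at_top] filterlim_Suc)
    hence "filterlim (\<lambda>n. (1/2) * ((- ln (H 1)) + ln (H (Suc n)))) at_top sequentially"
      by (intro filterlim_tendsto_pos_mult_at_top[OF tendsto_const] filterlim_tendsto_add_at_top[OF tendsto_const]) auto
    thus "filterlim (\<lambda>n. \<Sum>i<n. \<delta> (Suc i)) at_top sequentially"
      by (rule filterlim_at_top_mono) (use sum_ge in \<open>auto simp: algebra_simps\<close>)
  qed (use c \<delta>_nonneg in auto)
  hence "(\<lambda>n. V (Suc n)) \<longlonglongrightarrow> 0" by (rule tendsto_norm_zero_cancel)
  hence "V \<longlonglongrightarrow> 0" by (rule LIMSEQ_imp_Suc)
  hence "(\<lambda>N. z * V N + E N) \<longlonglongrightarrow> z * 0 + 0"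
    by (intro tendsto_intros E_lim)
  thus ?thesis by (simp add: E_def M_def S_def)
qed

end

section \<open>Weyl's criterion\<close>

lemma card_le_diameter:
  assumes "finite A" "\<And>i j. i \<in> A \<Longrightarrow> j \<in> A \<Longrightarrow> real i - real j \<le> l" "l \<ge> 0"
  shows "real (card A) \<le> l + 1"
proof (cases "A = {}")
  case False
  have "A \<subseteq> {Min A..Max A}" using assms(1) by auto
  hence "card A \<le> card {Min A..Max A}" by (intro card_mono) auto
  moreover have "Min A \<le> Max A"
    using Max_ge[OF assms(1) Min_in[OF assms(1) False]] .
  ultimately have "card A + Min A \<le> Max A + 1" by simp
  hence "real (card A) \<le> real (Max A) - real (Min A) + 1" by linarith
  also have "\<dots> \<le> l + 1"
    using assms(2)[of "Max A" "Min A"] assms(1) False by simp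
  finally show ?thesis .
qed (use assms in auto)

text \<open>Shows cos(2 pi t) as an increasing function of the distance of frac t from 1/2.
  Intervals centred at 1/2 become half lines in cos, which polynomials in cos can detect.\<close>

lemma cos_frac: "cos (2 * pi * t) = - cos (2 * pi * \<bar>frac t - 1 / 2\<bar>)"
proof -
  have "t = frac t + of_int \<lfloor>t\<rfloor>" by (simp add: frac_def)
  hence "2 * pi * t = 2 * pi * frac t + 2 * pi * of_int \<lfloor>t\<rfloor>"
    by (metis distrib_left)
  hence "cos (2 * pi * t) = cos (2 * pi * frac t)"
    by (simp add: cos_add sin_int_2pin cos_int_2pin)
  also have "\<dots> = - cos (2 * pi * frac t - pi)" by simp
  also have "2 * pi * frac t - pi = 2 * pi * (frac t - 1 / 2)" by (simp add: algebra_simps)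
  also have "cos (2 * pi * (frac t - 1 / 2)) = cos \<bar>2 * pi * (frac t - 1 / 2)\<bar>" by simp
  also have "\<bar>2 * pi * (frac t - 1 / 2)\<bar> = 2 * pi * \<bar>frac t - 1 / 2\<bar>" by (simp add: abs_mult)
  finally show ?thesis .
qed

lemma frac_add_eq:
  assumes "0 \<le> frac u + t + of_int k" "frac u + t + of_int k < (1::real)"
  shows "frac (u + t) = frac u + t + of_int k"
proof -
  have "u + t - (frac u + t + of_int k) = of_int (\<lfloor>u\<rfloor> - k)" by (simp add: frac_def)
  thus ?thesis unfolding frac_unique_iff using assms by (metis Ints_of_int)
qed

lemma sum_roots_of_unity:
  assumes "0 < k" "k < (Q::nat)"
  shows "(\<Sum>j<Q. cis (2 * pi * real k * (real j / real Q))) = 0"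
proof -
  define w where "w = cis (2 * pi * real k / real Q)"
  have "w \<noteq> 1"
  proof
    assume "w = 1"
    hence "cos (2 * pi * (real k / real Q)) = 1"
      by (simp add: w_def complex_eq_iff)
    then obtain n :: int where "2 * pi * (real k / real Q) = of_int n * 2 * pi"
      using cos_one_2pi_int by auto
    note n = this
    have "real k / real Q = (2 * pi * (real k / real Q)) / (2 * pi)" by simp
    also have "\<dots> = of_int n" unfolding n by simp
    finally have "real k / real Q = of_int n" .
    moreover have "0 < real k / real Q" "real k / real Q < 1" using assms by simp_all
    ultimately have "0 < (of_int n :: real)" "(of_int n :: real) < 1" by simp_all
    thus False by simp
  qed
  moreover have "w ^ Q = 1"
    using assms by (simp add: w_def Complex.DeMoivre cis_multiple_2pi)
  moreover have "cis (2 * pi * real k * (real j / real Q)) = w ^ j" for j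
    by (simp add: w_def Complex.DeMoivre mult_ac)
  ultimately show ?thesis by (simp add: sum_gp_strict)
qed

locale weyl_sequence =
  fixes x :: "nat \<Rightarrow> real"
  assumes weyl: "k > 0 \<Longrightarrow> (\<lambda>N. (\<Sum>n=1..N. cis (2 * pi * real k * x n)) / of_nat N) \<longlonglongrightarrow> 0"
begin

text \<open>Comparing with averages over equally spaced points instead of integrals turns the
  final estimate into counting integers in an interval.\<close>

definition equidist :: "(real \<Rightarrow> complex) \<Rightarrow> bool" where
  "equidist F \<longleftrightarrow> (\<exists>l. (\<lambda>N. (\<Sum>n=1..N. F (x n)) / of_nat N) \<longlonglongrightarrow> l \<and>
     (\<forall>\<^sub>F Q in sequentially. (\<Sum>j<Q. F (real j / real Q)) / of_nat Q = l))"

lemma equidist_add: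
  assumes "equidist F" "equidist G"
  shows "equidist (\<lambda>t. F t + G t)"
proof -
  obtain l l' where l: "(\<lambda>N. (\<Sum>n=1..N. F (x n)) / of_nat N) \<longlonglongrightarrow> l"
      "\<forall>\<^sub>F Q in sequentially. (\<Sum>j<Q. F (real j / real Q)) / of_nat Q = l"
    and l': "(\<lambda>N. (\<Sum>n=1..N. G (x n)) / of_nat N) \<longlonglongrightarrow> l'"
      "\<forall>\<^sub>F Q in sequentially. (\<Sum>j<Q. G (real j / real Q)) / of_nat Q = l'"
    using assms unfolding equidist_def by blast
  have "(\<lambda>N. (\<Sum>n=1..N. F (x n) + G (x n)) / of_nat N) \<longlonglongrightarrow> l + l'"
    using tendsto_add[OF l(1) l'(1)] by (simp add: sum.distrib add_divide_distrib)
  moreover have "\<forall>\<^sub>F Q in sequentially. (\<Sum>j<Q. F (real j / real Q) + G (real j / real Q)) / of_nat Q = l + l'"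
    using l(2) l'(2) by eventually_elim (simp add: sum.distrib add_divide_distrib)
  ultimately show ?thesis unfolding equidist_def by blast
qed

lemma equidist_cmult:
  assumes "equidist F"
  shows "equidist (\<lambda>t. c * F t)"
proof -
  obtain l where l: "(\<lambda>N. (\<Sum>n=1..N. F (x n)) / of_nat N) \<longlonglongrightarrow> l"
      "\<forall>\<^sub>F Q in sequentially. (\<Sum>j<Q. F (real j / real Q)) / of_nat Q = l"
    using assms unfolding equidist_def by blast
  have "(\<lambda>N. (\<Sum>n=1..N. c * F (x n)) / of_nat N) \<longlonglongrightarrow> c * l"
    using tendsto_mult_left[OF l(1), of c] by (simp add: sum_distrib_left)
  moreover have "\<forall>\<^sub>F Q in sequentially. (\<Sum>j<Q. c * F (real j / real Q)) / of_nat Q = c * l"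
    using l(2) by eventually_elim (simp only: sum_distrib_left[symmetric] times_divide_eq_right[symmetric])
  ultimately show ?thesis unfolding equidist_def by blast
qed

lemma equidist_cnj:
  assumes "equidist F"
  shows "equidist (\<lambda>t. cnj (F t))"
proof -
  obtain l where l: "(\<lambda>N. (\<Sum>n=1..N. F (x n)) / of_nat N) \<longlonglongrightarrow> l"
      "\<forall>\<^sub>F Q in sequentially. (\<Sum>j<Q. F (real j / real Q)) / of_nat Q = l"
    using assms unfolding equidist_def by blast
  have "(\<lambda>N. (\<Sum>n=1..N. cnj (F (x n))) / of_nat N) \<longlonglongrightarrow> cnj l"
    using tendsto_cnj[OF l(1)] by simp
  moreover have "\<forall>\<^sub>F Q in sequentially. (\<Sum>j<Q. cnj (F (real j / real Q))) / of_nat Q = cnj l"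
    using l(2) by eventually_elim auto
  ultimately show ?thesis unfolding equidist_def by blast
qed

lemma equidist_1: "equidist (\<lambda>_. 1)"
proof -
  have "\<forall>\<^sub>F N in sequentially. (\<Sum>n=1..N. 1) / of_nat N = (1 :: complex)"
    using eventually_gt_at_top[of 0] by eventually_elim simp
  moreover have "\<forall>\<^sub>F N in sequentially. (\<Sum>j<N. 1) / of_nat N = (1 :: complex)"
    using eventually_gt_at_top[of 0] by eventually_elim simp
  ultimately show ?thesis unfolding equidist_def by (blast intro: tendsto_eventually)
qed

lemma equidist_cis_nat: "equidist (\<lambda>t. cis (2 * pi * real k * t))"
proof (cases "k = 0")
  case True
  thus ?thesis using equidist_1 by simp
next
  case False
  have "\<forall>\<^sub>F Q in sequentially. (\<Sum>j<Q. cis (2 * pi * real k * (real j / real Q))) / of_nat Q = 0"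
    using eventually_gt_at_top[of k]
  proof eventually_elim
    case (elim Q)
    show ?case using sum_roots_of_unity[of k Q] False elim by simp
  qed
  thus ?thesis using weyl[of k] False unfolding equidist_def by blast
qed

lemma equidist_cis: "equidist (\<lambda>t. cis (2 * pi * of_int k * t))"
proof (cases "k \<ge> 0")
  case True
  thus ?thesis using equidist_cis_nat[of "nat k"] by simp
next
  case False
  hence "real (nat (-k)) = - of_int k" by simp
  thus ?thesis using equidist_cnj[OF equidist_cis_nat[of "nat (-k)"]] by (simp add: cis_cnj)
qed

text \<open>The factor \<open>cis\<close> makes the induction work: cos u cis(k u) is the mean of
  cis((k + 1) u) and cis((k - 1) u).\<close>

lemma equidist_cos_power_cis: "equidist (\<lambda>t. of_real (cos (2 * pi * t)) ^ m * cis (2 * pi * of_int k * t))"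
proof (induction m arbitrary: k)
  case 0
  show ?case using equidist_cis by simp
next
  case (Suc m)
  have "of_real (cos (2 * pi * t)) ^ Suc m * cis (2 * pi * of_int k * t) =
      (1 / 2) * (of_real (cos (2 * pi * t)) ^ m * cis (2 * pi * of_int (k + 1) * t) +
       of_real (cos (2 * pi * t)) ^ m * cis (2 * pi * of_int (k - 1) * t))" for t
  proof -
    have "cis (2 * pi * of_int (k + 1) * t) = cis (2 * pi * of_int k * t) * cis (2 * pi * t)"
         "cis (2 * pi * of_int (k - 1) * t) = cis (2 * pi * of_int k * t) * cis (- (2 * pi * t))"
      unfolding cis_mult by (simp_all add: algebra_simps)
    moreover have "cis (2 * pi * t) + cis (- (2 * pi * t)) = 2 * of_real (cos (2 * pi * t))"
      by (simp add: complex_eq_iff)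
    moreover have "c ^ Suc m * e = (1 / 2) * (c ^ m * (e * u) + c ^ m * (e * v))"
      if "u + v = 2 * c" for c e u v :: complex
    proof -
      have "(1 / 2) * (c ^ m * (e * u) + c ^ m * (e * v)) = (1 / 2) * (c ^ m * e * (u + v))"
        by (simp add: algebra_simps)
      thus ?thesis unfolding that by simp
    qed
    ultimately show ?thesis by presburger
  qed
  thus ?case
    using equidist_cmult[OF equidist_add[OF Suc.IH[of "k + 1"] Suc.IH[of "k - 1"]], of "1 / 2"] by presburger
qed

lemma equidist_poly_cos:
  fixes a :: "nat \<Rightarrow> real"
  shows "equidist (\<lambda>t. of_real (\<Sum>i\<le>n. a i * cos (2 * pi * t) ^ i))"
proof (induction n)
  case 0
  show ?case using equidist_cmult[OF equidist_1, of "of_real (a 0)"] by simp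
next
  case (Suc n)
  show ?case
    using equidist_add[OF Suc.IH equidist_cmult[OF equidist_cos_power_cis[of "Suc n" 0], of "of_real (a (Suc n))"]] by simp
qed

lemma poly_cos_mean:
  fixes a :: "nat \<Rightarrow> real" and n :: nat
  defines "P \<equiv> \<lambda>y. \<Sum>i\<le>n. a i * y ^ i"
  shows "\<exists>l. (\<lambda>N. (\<Sum>n=1..N. P (cos (2 * pi * x n))) / real N) \<longlonglongrightarrow> l \<and>
    (\<forall>\<^sub>F Q in sequentially. (\<Sum>j<Q. P (cos (2 * pi * (real j / real Q)))) / real Q = l)"
proof -
  obtain l where l: "(\<lambda>N. (\<Sum>n=1..N. complex_of_real (P (cos (2 * pi * x n)))) / of_nat N) \<longlonglongrightarrow> l"
      "\<forall>\<^sub>F Q in sequentially. (\<Sum>j<Q. complex_of_real (P (cos (2 * pi * (real j / real Q))))) / of_nat Q = l"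
    using equidist_poly_cos[of a n] unfolding equidist_def P_def by blast
  have *: "Re ((\<Sum>i\<in>A. complex_of_real (g i)) / of_nat N) = (\<Sum>i\<in>A. g i) / real N" for g :: "nat \<Rightarrow> real" and A N
  proof -
    have "(\<Sum>i\<in>A. complex_of_real (g i)) / of_nat N = of_real ((\<Sum>i\<in>A. g i) / real N)" by simp
    thus ?thesis by (simp only: Re_complex_of_real)
  qed
  show ?thesis
  proof (intro exI[of _ "Re l"] conjI)
    show "(\<lambda>N. (\<Sum>n=1..N. P (cos (2 * pi * x n))) / real N) \<longlonglongrightarrow> Re l"
      using tendsto_Re[OF l(1)] unfolding * .
    show "\<forall>\<^sub>F Q in sequentially. (\<Sum>j<Q. P (cos (2 * pi * (real j / real Q)))) / real Q = Re l"
      using l(2) by eventually_elim (metis *)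
  qed
qed

text \<open>A continuous majorant of the indicator, as a function of cos, is approximated by a
  polynomial. Its mean along x equals that over Q equally spaced points, which counts the j / Q in a
  slightly longer interval. Upper bounds suffice, as the complement of an interval is an interval
  modulo 1.\<close>

lemma upper_density:
  assumes r: "0 \<le> r" "r < 1 / 2" and \<epsilon>: "\<epsilon> > 0"
  shows "\<forall>\<^sub>F N in sequentially. real (card {n\<in>{1..N}. \<bar>frac (x n) - 1 / 2\<bar> \<le> r}) \<le> (2 * r + \<epsilon>) * real N"
proof -
  \<comment> \<open>Room for the majorant to fall to 0: the first bound keeps the enlarged interval
    within [0, 1], the second limits the added length 2 \<delta> to \<epsilon> / 4.\<close>
  define \<delta> where "\<delta> = min (1 / 2 - r) (\<epsilon> / 8)"
  have "\<delta> \<le> 1 / 2 - r" unfolding \<delta>_def by (rule min.cobounded1)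
  moreover have "\<delta> \<le> \<epsilon> / 8" unfolding \<delta>_def by (rule min.cobounded2)
  moreover have "\<delta> > 0" using r \<epsilon> by (simp add: \<delta>_def)
  ultimately have \<delta>: "\<delta> > 0" "r + \<delta> \<le> 1 / 2" "\<delta> \<le> \<epsilon> / 8" by simp_all
  define c1 where "c1 = - cos (2 * pi * r)"
  define c2 where "c2 = - cos (2 * pi * (r + \<delta>))"
  have scale: "2 * pi * u \<le> pi" if "u \<le> 1 / 2" for u
    using mult_left_mono[OF that, of "2 * pi"] by simp
  have c12: "c1 < c2"
    unfolding c1_def c2_def using r \<delta> scale[of "r + \<delta>"]
    by (auto intro!: cos_monotone_0_pi)
  define g where "g = (\<lambda>y. max 0 (min 1 ((c2 - y) / (c2 - c1))))"
  have g01: "0 \<le> g y" "g y \<le> 1" for y by (auto simp: g_def)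
  have g1: "g y = 1" if "y \<le> c1" for y using that c12 by (auto simp: g_def field_simps)
  have g0: "g y = 0" if "y \<ge> c2" for y using that c12 by (auto simp: g_def field_simps)
  have "continuous_on {-1..1} g"
    unfolding g_def using c12 by (intro continuous_intros) auto
  moreover have "\<epsilon> / 8 > 0" using \<epsilon> by simp
  ultimately obtain P where P: "real_polynomial_function P" "\<And>y. y \<in> {-1..1} \<Longrightarrow> \<bar>g y - P y\<bar> < \<epsilon> / 8"
    using Stone_Weierstrass_real_polynomial_function[of "{-1..1::real}" g "\<epsilon> / 8"] by blast
  obtain a m where P_eq: "P = (\<lambda>y. \<Sum>i\<le>m. a i * y ^ i)"
    using P(1) unfolding real_polynomial_function_iff_sum by blast
  have Pg: "\<bar>g (cos t) - P (cos t)\<bar> < \<epsilon> / 8" for t by (rule P(2)) auto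
  have P_app: "P y = (\<Sum>i\<le>m. a i * y ^ i)" for y unfolding P_eq ..
  obtain l where l: "(\<lambda>N. (\<Sum>n=1..N. P (cos (2 * pi * x n))) / real N) \<longlonglongrightarrow> l"
    "\<forall>\<^sub>F Q in sequentially. (\<Sum>j<Q. P (cos (2 * pi * (real j / real Q)))) / real Q = l"
    using poly_cos_mean[of a m, folded P_app] by (elim exE conjE) (rule that)
  have "\<forall>\<^sub>F Q in sequentially. Q > nat \<lceil>8 / \<epsilon>\<rceil>" by (rule eventually_gt_at_top)
  with l(2) have "\<forall>\<^sub>F Q in sequentially. (\<Sum>j<Q. P (cos (2 * pi * (real j / real Q)))) / real Q = l \<and> Q > nat \<lceil>8 / \<epsilon>\<rceil>"
    by eventually_elim simp
  then obtain Q where Q: "(\<Sum>j<Q. P (cos (2 * pi * (real j / real Q)))) / real Q = l" "Q > nat \<lceil>8 / \<epsilon>\<rceil>"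
    using eventually_happens'[OF sequentially_bot] by blast
  have Q_pos: "real Q > 0" using Q by simp
  have "8 / \<epsilon> \<le> real Q" using Q(2) by linarith
  hence Q1: "1 \<le> \<epsilon> / 8 * real Q" using \<epsilon> by (simp add: field_simps)
  define A where "A = {j\<in>{..<Q}. \<bar>real j / real Q - 1 / 2\<bar> < r + \<delta>}"
  have "(\<Sum>j<Q. P (cos (2 * pi * (real j / real Q)))) \<le> (\<Sum>j<Q. of_bool (j \<in> A) + \<epsilon> / 8)"
  proof (rule sum_mono)
    fix j assume j: "j \<in> {..<Q}"
    define u where "u = real j / real Q"
    have u: "0 \<le> u" "u < 1" using j by (auto simp: u_def)
    hence fu: "frac u = u" by (simp add: frac_eq)
    have "g (cos (2 * pi * u)) \<le> of_bool (j \<in> A)"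
    proof (cases "j \<in> A")
      case False
      hence "r + \<delta> \<le> \<bar>u - 1 / 2\<bar>" using j by (auto simp: A_def u_def)
      moreover have "\<bar>u - 1 / 2\<bar> \<le> 1 / 2" using u by (auto simp: abs_if)
      ultimately have "cos (2 * pi * \<bar>u - 1 / 2\<bar>) \<le> cos (2 * pi * (r + \<delta>))"
        using r \<delta> scale by (intro cos_monotone_0_pi_le) auto
      hence "cos (2 * pi * u) \<ge> c2" unfolding cos_frac[of u] fu c2_def by simp
      thus ?thesis using g0 by simp
    qed (use g01 in auto)
    thus "P (cos (2 * pi * (real j / real Q))) \<le> of_bool (j \<in> A) + \<epsilon> / 8"
      using Pg[of "2 * pi * u"] unfolding u_def by linarith
  qed
  also have "\<dots> = real (card A) + real Q * (\<epsilon> / 8)"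
    by (simp add: sum.distrib A_def Int_def)
  also have "real (card A) \<le> 2 * (r + \<delta>) * real Q + 1"
  proof (rule card_le_diameter)
    fix i j assume "i \<in> A" "j \<in> A"
    hence "\<bar>real i / real Q - 1 / 2\<bar> < r + \<delta>" "\<bar>real j / real Q - 1 / 2\<bar> < r + \<delta>"
      by (simp_all add: A_def)
    hence "real i / real Q - real j / real Q < (r + \<delta>) + (r + \<delta>)"
      unfolding abs_less_iff by linarith
    hence "real i / real Q - real j / real Q \<le> 2 * (r + \<delta>)" by simp
    thus "real i - real j \<le> 2 * (r + \<delta>) * real Q"
      using Q_pos by (simp add: field_simps)
  qed (use r \<delta> in \<open>auto simp: A_def\<close>)
  \<comment> \<open>The 1 from counting integers costs \<epsilon> / 8 per point, as Q >= 8 /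
    \<epsilon>; the other \<epsilon> / 8 is the polynomial error.\<close>
  also have "2 * (r + \<delta>) * real Q + 1 + real Q * (\<epsilon> / 8) \<le> (2 * (r + \<delta>) + \<epsilon> / 4) * real Q"
    using Q1 by (simp add: algebra_simps)
  also have "\<dots> \<le> (2 * r + \<epsilon> / 2) * real Q"
    using \<delta> Q_pos by (intro mult_right_mono) auto
  finally have "(\<Sum>j<Q. P (cos (2 * pi * (real j / real Q)))) / real Q \<le> 2 * r + \<epsilon> / 2"
    by (simp only: pos_divide_le_eq[OF Q_pos])
  hence l_le: "l \<le> 2 * r + \<epsilon> / 2" unfolding Q(1) .
  hence "\<forall>\<^sub>F N in sequentially. (\<Sum>n=1..N. P (cos (2 * pi * x n))) / real N < 2 * r + 3 * \<epsilon> / 4"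
    using \<epsilon> by (intro order_tendstoD(2)[OF l(1)]) auto
  thus ?thesis using eventually_gt_at_top[of 0]
  proof eventually_elim
    case (elim N)
    have "real (card {n\<in>{1..N}. \<bar>frac (x n) - 1 / 2\<bar> \<le> r}) = (\<Sum>n=1..N. of_bool (\<bar>frac (x n) - 1 / 2\<bar> \<le> r))"
      by (simp add: Int_def)
    also have "\<dots> \<le> (\<Sum>n=1..N. P (cos (2 * pi * x n)) + \<epsilon> / 8)"
    proof (rule sum_mono)
      fix n
      have "of_bool (\<bar>frac (x n) - 1 / 2\<bar> \<le> r) \<le> g (cos (2 * pi * x n))"
      proof (cases "\<bar>frac (x n) - 1 / 2\<bar> \<le> r")
        case True
        hence "cos (2 * pi * r) \<le> cos (2 * pi * \<bar>frac (x n) - 1 / 2\<bar>)"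
          using r scale by (intro cos_monotone_0_pi_le) auto
        hence "cos (2 * pi * x n) \<le> c1" unfolding cos_frac[of "x n"] c1_def by simp
        thus ?thesis using g1 by simp
      qed (use g01 in auto)
      thus "of_bool (\<bar>frac (x n) - 1 / 2\<bar> \<le> r) \<le> P (cos (2 * pi * x n)) + \<epsilon> / 8"
        using Pg[of "2 * pi * x n"] by linarith
    qed
    also have "\<dots> = (\<Sum>n=1..N. P (cos (2 * pi * x n))) + real N * (\<epsilon> / 8)"
      by (simp add: sum.distrib)
    also have "(\<Sum>n=1..N. P (cos (2 * pi * x n))) \<le> (2 * r + 3 * \<epsilon> / 4) * real N"
      using elim by (simp add: divide_less_eq)
    also have "(2 * r + 3 * \<epsilon> / 4) * real N + real N * (\<epsilon> / 8) = (2 * r + 7 * \<epsilon> / 8) * real N"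
      by (simp add: algebra_simps)
    also have "\<dots> \<le> (2 * r + \<epsilon>) * real N"
      using \<epsilon> by (intro mult_right_mono) auto
    finally show ?case by simp
  qed
qed

lemma weyl_shift: "weyl_sequence (\<lambda>n. x n + \<theta>)"
proof
  fix k :: nat assume k: "k > 0"
  have eq: "cis (2 * pi * real k * (x n + \<theta>)) = cis (2 * pi * real k * x n) * cis (2 * pi * real k * \<theta>)" for n
    unfolding cis_mult by (simp add: algebra_simps)
  have "(\<lambda>N. (\<Sum>n=1..N. cis (2 * pi * real k * x n)) / of_nat N * cis (2 * pi * real k * \<theta>)) \<longlonglongrightarrow> 0 * cis (2 * pi * real k * \<theta>)"
    by (intro tendsto_intros weyl k)
  thus "(\<lambda>N. (\<Sum>n=1..N. cis (2 * pi * real k * (x n + \<theta>))) / of_nat N) \<longlonglongrightarrow> 0"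
    unfolding eq by (simp add: sum_distrib_right)
qed

text \<open>The shift \<theta> centres [a, b) at 1/2 without wrapping around. The full circle is
  treated separately because \<open>upper_density\<close> requires r < 1/2.\<close>

lemma upper_density_interval:
  assumes ab: "0 \<le> a" "a < b" "b \<le> 1" and \<epsilon>: "\<epsilon> > 0"
  shows "\<forall>\<^sub>F N in sequentially. real (card {n\<in>{1..N}. a \<le> frac (x n) \<and> frac (x n) < b}) \<le> (b - a + \<epsilon>) * real N"
proof (cases "b - a = 1")
  case True
  have "real (card {n\<in>{1..N}. a \<le> frac (x n) \<and> frac (x n) < b}) \<le> (b - a + \<epsilon>) * real N" for N
  proof -
    have "card {n\<in>{1..N}. a \<le> frac (x n) \<and> frac (x n) < b} \<le> card {1..N}"
      by (intro card_mono) auto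
    hence "real (card {n\<in>{1..N}. a \<le> frac (x n) \<and> frac (x n) < b}) \<le> 1 * real N" by simp
    also have "\<dots> \<le> (b - a + \<epsilon>) * real N" using True \<epsilon> by (intro mult_right_mono) auto
    finally show ?thesis .
  qed
  thus ?thesis by simp
next
  case False
  define \<theta> where "\<theta> = 1 / 2 - (a + b) / 2"
  interpret shifted: weyl_sequence "\<lambda>n. x n + \<theta>" by (rule weyl_shift)
  have "\<forall>\<^sub>F N in sequentially. real (card {n\<in>{1..N}. \<bar>frac (x n + \<theta>) - 1 / 2\<bar> \<le> (b - a) / 2}) \<le> (2 * ((b - a) / 2) + \<epsilon>) * real N"
    by (rule shifted.upper_density) (use ab False \<epsilon> in auto)
  thus ?thesis
  proof eventually_elim
    case (elim N)
    have "{n\<in>{1..N}. a \<le> frac (x n) \<and> frac (x n) < b} \<subseteq> {n\<in>{1..N}. \<bar>frac (x n + \<theta>) - 1 / 2\<bar> \<le> (b - a) / 2}"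
    proof safe
      fix n assume n: "a \<le> frac (x n)" "frac (x n) < b"
      have e: "frac (x n + \<theta>) = frac (x n) + \<theta>"
        using frac_add_eq[of "x n" \<theta> 0] n ab by (simp add: \<theta>_def field_simps)
      show "\<bar>frac (x n + \<theta>) - 1 / 2\<bar> \<le> (b - a) / 2"
        unfolding e using n by (auto simp: \<theta>_def abs_if field_simps)
    qed
    hence "card {n\<in>{1..N}. a \<le> frac (x n) \<and> frac (x n) < b} \<le> card {n\<in>{1..N}. \<bar>frac (x n + \<theta>) - 1 / 2\<bar> \<le> (b - a) / 2}"
      by (intro card_mono) auto
    hence "real (card {n\<in>{1..N}. a \<le> frac (x n) \<and> frac (x n) < b}) \<le>
           real (card {n\<in>{1..N}. \<bar>frac (x n + \<theta>) - 1 / 2\<bar> \<le> (b - a) / 2})"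
      by (rule of_nat_mono)
    also have "\<dots> \<le> (2 * ((b - a) / 2) + \<epsilon>) * real N" by (rule elim)
    also have "2 * ((b - a) / 2) = b - a" by simp
    finally show ?case .
  qed
qed

text \<open>Modulo 1 the complement is a single interval, centred opposite to (a + b) / 2, and the
  shift moves its centre to 1/2. Points with frac < a wrap around, hence the + 1 in that
  case.\<close>

lemma upper_density_complement:
  assumes ab: "0 \<le> a" "a < b" "b \<le> 1" and \<epsilon>: "\<epsilon> > 0"
  shows "\<forall>\<^sub>F N in sequentially. real (card {n\<in>{1..N}. \<not> (a \<le> frac (x n) \<and> frac (x n) < b)}) \<le> (1 - (b - a) + \<epsilon>) * real N"
proof -
  define \<theta> where "\<theta> = - (a + b) / 2"
  define r where "r = 1 / 2 - (b - a) / 2"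
  interpret shifted: weyl_sequence "\<lambda>n. x n + \<theta>" by (rule weyl_shift)
  have "\<forall>\<^sub>F N in sequentially. real (card {n\<in>{1..N}. \<bar>frac (x n + \<theta>) - 1 / 2\<bar> \<le> r}) \<le> (2 * r + \<epsilon>) * real N"
    by (rule shifted.upper_density) (use ab \<epsilon> in \<open>auto simp: r_def field_simps\<close>)
  thus ?thesis
  proof eventually_elim
    case (elim N)
    have "{n\<in>{1..N}. \<not> (a \<le> frac (x n) \<and> frac (x n) < b)} \<subseteq> {n\<in>{1..N}. \<bar>frac (x n + \<theta>) - 1 / 2\<bar> \<le> r}"
    proof
      fix n assume n: "n \<in> {n\<in>{1..N}. \<not> (a \<le> frac (x n) \<and> frac (x n) < b)}"
      have fr: "0 \<le> frac (x n)" "frac (x n) < 1" by (auto simp: frac_lt_1)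
      consider "frac (x n) < a" | "frac (x n) \<ge> b" using n by fastforce
      hence "\<bar>frac (x n + \<theta>) - 1 / 2\<bar> \<le> r"
      proof cases
        case 1
        have e: "frac (x n + \<theta>) = frac (x n) + \<theta> + 1"
          using frac_add_eq[of "x n" \<theta> 1] 1 fr ab by (simp add: \<theta>_def field_simps)
        obtain u where u: "u = frac (x n)" by blast
        show ?thesis
          using 1 fr ab unfolding e unfolding r_def abs_le_iff \<theta>_def u[symmetric]
          by (simp add: field_simps)
      next
        case 2
        have e: "frac (x n + \<theta>) = frac (x n) + \<theta>"
          using frac_add_eq[of "x n" \<theta> 0] 2 fr ab by (simp add: \<theta>_def field_simps)
        obtain u where u: "u = frac (x n)" by blast
        show ?thesis
          using 2 fr ab unfolding e unfolding r_def abs_le_iff \<theta>_def u[symmetric]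
          by (simp add: field_simps)
      qed
      thus "n \<in> {n\<in>{1..N}. \<bar>frac (x n + \<theta>) - 1 / 2\<bar> \<le> r}" using n by simp
    qed
    hence "card {n\<in>{1..N}. \<not> (a \<le> frac (x n) \<and> frac (x n) < b)} \<le> card {n\<in>{1..N}. \<bar>frac (x n + \<theta>) - 1 / 2\<bar> \<le> r}"
      by (intro card_mono) auto
    hence "real (card {n\<in>{1..N}. \<not> (a \<le> frac (x n) \<and> frac (x n) < b)}) \<le> (2 * r + \<epsilon>) * real N"
      using elim by simp
    moreover have "2 * r = 1 - (b - a)" by (simp add: r_def field_simps)
    ultimately show ?case by (simp only:)
  qed
qed

text \<open>The counts for the interval and its complement add up to N, so the two upper bounds
  force the limit.\<close>

theorem weyl_density:
  assumes ab: "0 \<le> a" "a < b" "b \<le> 1"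
  shows "(\<lambda>N. real (card {n\<in>{1..N}. a \<le> frac (x n) \<and> frac (x n) < b}) / real N) \<longlonglongrightarrow> b - a"
proof (rule tendstoI)
  fix \<epsilon> :: real assume "\<epsilon> > 0"
  hence \<epsilon>: "\<epsilon> / 2 > 0" by simp
  show "\<forall>\<^sub>F N in sequentially. dist (real (card {n\<in>{1..N}. a \<le> frac (x n) \<and> frac (x n) < b}) / real N) (b - a) < \<epsilon>"
    using upper_density_interval[OF ab \<epsilon>] upper_density_complement[OF ab \<epsilon>] eventually_gt_at_top[of 0]
  proof eventually_elim
    case (elim N)
    define A where "A = {n\<in>{1..N}. a \<le> frac (x n) \<and> frac (x n) < b}"
    define B where "B = {n\<in>{1..N}. \<not> (a \<le> frac (x n) \<and> frac (x n) < b)}"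
    have "{1..N} = A \<union> B" by (auto simp: A_def B_def)
    moreover have "card (A \<union> B) = card A + card B"
      by (rule card_Un_disjoint) (auto simp: A_def B_def)
    ultimately have "card {1..N} = card A + card B" by simp
    hence N: "real N = real (card A) + real (card B)" by simp
    have Np: "real N > 0" using elim by simp
    have "real (card A) / real N \<le> b - a + \<epsilon> / 2"
      using elim(1) Np by (simp add: A_def divide_le_eq)
    moreover have "real (card B) / real N \<le> 1 - (b - a) + \<epsilon> / 2"
      using elim(2) Np by (simp add: B_def divide_le_eq)
    moreover have "real (card A) / real N + real (card B) / real N = 1"
      using N Np by (simp add: add_divide_distrib[symmetric])
    ultimately have "\<bar>real (card A) / real N - (b - a)\<bar> < \<epsilon>"
      using \<open>\<epsilon> > 0\<close> unfolding abs_less_iff by linarith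
    thus ?case by (simp add: A_def dist_real_def)
  qed
qed

end

section \<open>Leading digits and fractional parts of logarithms\<close>

definition digit_sum :: "(nat \<Rightarrow> nat) \<Rightarrow> nat \<Rightarrow> real" where
  "digit_sum d n = (\<Sum>j<n. real (d j) / 10 ^ j)"

lemma digit_sum_Suc: "digit_sum d (Suc n) = digit_sum d n + real (d n) / 10 ^ n"
  by (simp add: digit_sum_def)

lemma powi_minus: "(10::real) powi (- int j) = 1 / 10 ^ j"
  by (simp add: power_int_minus divide_inverse)

lemma string_value_eq: "string_value S = digit_sum (\<lambda>j. S ! j) (length S)"
  by (simp add: string_value_def digit_sum_def powi_minus)

text \<open>The intervals belonging to longer prefixes are nested: a digit at most 9 plus one unit
  of its place stays within one unit of the previous place. Digits start at 10^0, so the last of n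
  places has unit 10 / 10^n.\<close>

lemma digit_sum_antimono:
  assumes "m \<le> n" "\<And>j. j < n \<Longrightarrow> d j \<le> 9"
  shows "digit_sum d n + 10 / 10 ^ n \<le> digit_sum d m + 10 / 10 ^ m"
  using assms
proof (induction n rule: dec_induct)
  case (step n)
  have "d n \<le> 9" using step.prems by simp
  hence "real (d n) \<le> 9" by (metis of_nat_le_iff of_nat_numeral)
  hence "real (d n) / 10 ^ n + 1 / 10 ^ n \<le> 10 / 10 ^ n"
    by (simp add: add_divide_distrib[symmetric] divide_right_mono)
  moreover have "10 / 10 ^ Suc n = (1::real) / 10 ^ n" by simp
  ultimately show ?case using step.IH step.prems unfolding digit_sum_Suc by fastforce
qed auto

lemma digit_sum_mono: "m \<le> n \<Longrightarrow> digit_sum d m \<le> digit_sum d n"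
  unfolding digit_sum_def by (rule sum_mono2) auto

lemma digit_series:
  assumes "\<And>j. d j \<le> 9"
  shows "summable (\<lambda>j. real (d j) / 10 ^ j)"
proof (rule summable_comparison_test')
  show "summable (\<lambda>j. 9 * (1 / 10 :: real) ^ j)"
    by (intro summable_mult summable_geometric) simp
  show "norm (real (d j) / 10 ^ j) \<le> 9 * (1 / 10) ^ j" for j
  proof -
    have "real (d j) \<le> 9" using assms[of j] by (metis of_nat_le_iff of_nat_numeral)
    thus ?thesis by (simp add: power_divide divide_right_mono)
  qed
qed

text \<open>A digit other than 9 at some position m >= n leaves a gap and makes the upper inequality
  strict.\<close>

lemma digit_series_bounds:
  assumes d: "\<And>j. d j \<le> 9" and not9: "\<not> (\<exists>J. \<forall>j\<ge>J. d j = 9)"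
  shows "digit_sum d n \<le> (\<Sum>j. real (d j) / 10 ^ j)"
    and "(\<Sum>j. real (d j) / 10 ^ j) < digit_sum d n + 10 / 10 ^ n"
proof -
  have sm: "summable (\<lambda>j. real (d j) / 10 ^ j)" using d by (rule digit_series)
  show "digit_sum d n \<le> (\<Sum>j. real (d j) / 10 ^ j)"
    unfolding digit_sum_def by (rule sum_le_suminf[OF sm]) auto
  have "\<exists>m\<ge>n. d m \<noteq> 9" using not9 by blast
  then obtain m where m: "m \<ge> n" "d m \<noteq> 9" by blast
  have "d m + 1 \<le> 9" using m d[of m] by simp
  hence dm: "real (d m) + 1 \<le> 9" by (metis of_nat_1 of_nat_add of_nat_le_iff of_nat_numeral)
  have le: "digit_sum d k \<le> digit_sum d (Suc m) + 10 / 10 ^ Suc m" for k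
  proof (cases "Suc m \<le> k")
    case True
    have "digit_sum d k \<le> digit_sum d k + 10 / 10 ^ k" by simp
    also have "\<dots> \<le> digit_sum d (Suc m) + 10 / 10 ^ Suc m"
      by (rule digit_sum_antimono) (use True d in auto)
    finally show ?thesis .
  next
    case False
    hence "digit_sum d k \<le> digit_sum d (Suc m)" by (intro digit_sum_mono) auto
    thus ?thesis by (rule order.trans) simp
  qed
  have "(\<Sum>j. real (d j) / 10 ^ j) \<le> digit_sum d (Suc m) + 10 / 10 ^ Suc m"
    by (rule suminf_le_const[OF sm]) (use le in \<open>simp add: digit_sum_def\<close>)
  also have "\<dots> = digit_sum d m + (real (d m) + 1) / 10 ^ m"
    by (simp add: digit_sum_Suc add_divide_distrib)
  also have "\<dots> < digit_sum d m + 10 / 10 ^ m"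
    using dm by (intro add_strict_left_mono divide_strict_right_mono) auto
  also have "\<dots> \<le> digit_sum d n + 10 / 10 ^ n"
    by (rule digit_sum_antimono) (use m d in auto)
  finally show "(\<Sum>j. real (d j) / 10 ^ j) < digit_sum d n + 10 / 10 ^ n" .
qed

text \<open>The digits are the last digits of floor(t 10^j). A tail of 9s would make t the right end
  point of one of the half-open intervals that contain it.\<close>

lemma exists_digits:
  assumes t: "1 \<le> t" "t < (10::real)"
  obtains d where "\<And>j. d j \<le> 9" "1 \<le> d 0" "\<not> (\<exists>J. \<forall>j\<ge>J. d j = 9)" "(\<Sum>j. real (d j) / 10 ^ j) = t"
proof -
  define F where "F = (\<lambda>j. \<lfloor>t * 10 ^ j\<rfloor>)"
  define d where "d = (\<lambda>j. nat (F j mod 10))"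
  have d_int: "int (d j) = F j mod 10" for j by (simp add: d_def)
  have d9: "d j \<le> 9" for j
    using pos_mod_bound[of 10 "F j"] d_int[of j] by linarith
  have F0: "1 \<le> F 0" "F 0 \<le> 9" using t by (auto simp: F_def le_floor_iff floor_le_iff)
  hence d0: "int (d 0) = F 0" unfolding d_int by simp
  have F_Suc: "F (Suc j) = 10 * F j + int (d (Suc j))" for j
  proof -
    have "F (Suc j) div 10 = \<lfloor>t * 10 ^ Suc j / real_of_int 10\<rfloor>"
      unfolding F_def by (rule floor_divide_real_eq_div[symmetric]) simp
    also have "\<dots> = F j" by (simp add: F_def)
    finally show ?thesis unfolding d_int using div_mult_mod_eq[of "F (Suc j)" 10] by simp
  qed
  have part: "digit_sum d (Suc j) = of_int (F j) / 10 ^ j" for j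
  proof (induction j)
    case 0
    have "real (d 0) = of_int (F 0)" using d0 by (metis of_int_of_nat_eq)
    thus ?case by (simp add: digit_sum_def)
  next
    case (Suc j)
    have "real_of_int (F (Suc j)) = 10 * of_int (F j) + real (d (Suc j))"
      unfolding F_Suc by simp
    thus ?case using Suc by (subst digit_sum_Suc) (simp add: add_divide_distrib)
  qed
  have F_bounds: "of_int (F j) / 10 ^ j \<le> t" "t < of_int (F j) / 10 ^ j + 1 / 10 ^ j" for j
  proof -
    have "of_int (F j) \<le> t * 10 ^ j" "t * 10 ^ j < of_int (F j) + 1"
      unfolding F_def by linarith+
    thus "of_int (F j) / 10 ^ j \<le> t" "t < of_int (F j) / 10 ^ j + 1 / 10 ^ j"
      by (simp_all add: field_simps)
  qed
  have sm: "summable (\<lambda>j. real (d j) / 10 ^ j)" using d9 by (rule digit_series)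
  have lim: "(\<lambda>j. digit_sum d (Suc j)) \<longlonglongrightarrow> (\<Sum>j. real (d j) / 10 ^ j)"
    unfolding digit_sum_def by (rule LIMSEQ_Suc[OF summable_LIMSEQ[OF sm]])
  have lim0: "(\<lambda>j. 1 / 10 ^ j :: real) \<longlonglongrightarrow> 0"
    using LIMSEQ_power_zero[of "1 / 10 :: real"] by (simp add: power_divide)
  have "(\<lambda>j. digit_sum d (Suc j)) \<longlonglongrightarrow> t"
  proof (rule tendsto_sandwich)
    show "(\<lambda>j. t - 1 / 10 ^ j) \<longlonglongrightarrow> t"
      using tendsto_diff[OF tendsto_const lim0, of t] by simp
    show "\<forall>\<^sub>F j in sequentially. t - 1 / 10 ^ j \<le> digit_sum d (Suc j)"
      unfolding part using F_bounds(2) by (intro always_eventually allI) (simp add: less_imp_le algebra_simps)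
    show "\<forall>\<^sub>F j in sequentially. digit_sum d (Suc j) \<le> t"
      unfolding part using F_bounds(1) by (intro always_eventually allI)
  qed auto
  hence sum: "(\<Sum>j. real (d j) / 10 ^ j) = t" using LIMSEQ_unique[OF lim] by simp
  have "\<not> (\<exists>J. \<forall>j\<ge>J. d j = 9)"
  proof
    assume "\<exists>J. \<forall>j\<ge>J. d j = 9"
    then obtain J where J: "\<And>j. j \<ge> J \<Longrightarrow> d j = 9" by blast
    \<comment> \<open>Along a tail of 9s the right end points of the prefix intervals no longer
      move.\<close>
    have const: "digit_sum d (Suc j) + 1 / 10 ^ j = digit_sum d (Suc J) + 1 / 10 ^ J" if "j \<ge> J" for j
      using that
    proof (induction j rule: dec_induct)
      case (step j)
      have "d (Suc j) = 9" using J[of "Suc j"] step by simp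
      hence "digit_sum d (Suc (Suc j)) = digit_sum d (Suc j) + 9 / 10 ^ Suc j"
        by (simp only: digit_sum_Suc[of d "Suc j"] of_nat_numeral)
      moreover have "9 / 10 ^ Suc j + 1 / 10 ^ Suc j = (1 / 10 ^ j :: real)"
        by (simp add: field_simps)
      ultimately show ?case using step.IH by linarith
    qed simp
    have lim1: "(\<lambda>j. digit_sum d (Suc j) + 1 / 10 ^ j) \<longlonglongrightarrow> t + 0"
      using lim lim0 sum by (intro tendsto_add) auto
    have lim2: "(\<lambda>j. digit_sum d (Suc j) + 1 / 10 ^ j) \<longlonglongrightarrow> digit_sum d (Suc J) + 1 / 10 ^ J"
      by (rule tendsto_eventually, rule eventually_mono[OF eventually_ge_at_top[of J]]) (rule const)
    have "t = digit_sum d (Suc J) + 1 / 10 ^ J" using LIMSEQ_unique[OF lim1 lim2] by simp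
    thus False using F_bounds(2)[of J] unfolding part by simp
  qed
  moreover have "1 \<le> d 0" using d0 F0 by linarith
  ultimately show ?thesis using that[OF d9 _ _ sum] by simp
qed

lemma digit_string_value:
  assumes "digit_string S"
  shows "1 \<le> string_value S" "string_value S + 10 / 10 ^ length S \<le> 10"
proof -
  have S: "\<And>j. j < length S \<Longrightarrow> S ! j \<le> 9" "S ! 0 \<ge> 1" "length S \<ge> 1"
    using assms by (auto simp: digit_string_def Suc_le_eq)
  have "1 \<le> real (S ! 0)" using S(2) by simp
  also have "real (S ! 0) = digit_sum (\<lambda>j. S ! j) 1" by (simp add: digit_sum_def)
  also have "\<dots> \<le> string_value S"
    unfolding string_value_eq by (rule digit_sum_mono) (use S in auto)
  finally show "1 \<le> string_value S" .
  show "string_value S + 10 / 10 ^ length S \<le> 10"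
    using digit_sum_antimono[of 0 "length S" "\<lambda>j. S ! j"] S
    by (simp add: string_value_eq digit_sum_def)
qed

lemma powr_frac_log:
  assumes "a > 0"
  shows "a = 10 powi \<lfloor>log 10 a\<rfloor> * 10 powr frac (log 10 a)"
proof -
  have "10 powi \<lfloor>log 10 a\<rfloor> = (10::real) powr of_int \<lfloor>log 10 a\<rfloor>"
    by (simp add: powr_real_of_int')
  hence "10 powi \<lfloor>log 10 a\<rfloor> * 10 powr frac (log 10 a) = 10 powr (of_int \<lfloor>log 10 a\<rfloor> + frac (log 10 a))"
    by (simp add: powr_add)
  also have "of_int \<lfloor>log 10 a\<rfloor> + frac (log 10 a) = log 10 a" by (simp add: frac_def)
  also have "10 powr log 10 a = a" using assms by simp
  finally show ?thesis by simp
qed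

text \<open>The mantissa 10 powr frac(log10 a) lies in [1, 10); having prefix S confines it to the
  half-open interval of one last-place unit starting at the value of S, and logarithms preserve
  order.\<close>

theorem has_first_digits_iff:
  assumes a: "a > 0" and S: "digit_string S"
  shows "has_first_digits a S \<longleftrightarrow>
           log 10 (string_value S) \<le> frac (log 10 a) \<and>
           frac (log 10 a) < log 10 (string_value S + 10 / 10 ^ length S)"
proof
  have r: "1 \<le> string_value S" using digit_string_value[OF S] by simp
  have S9: "\<And>j. j < length S \<Longrightarrow> S ! j \<le> 9" "length S > 0"
    using S by (auto simp: digit_string_def)
  have rp: "string_value S + 10 / 10 ^ length S > 0" using r by (intro add_pos_pos) auto
  {
    assume "has_first_digits a S"
    then obtain M d where d: "a = 10 powi M * (\<Sum>j. real (d j) / 10 ^ j)" "1 \<le> d 0" "\<And>j. d j \<le> 9"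
        "\<not> (\<exists>J. \<forall>j\<ge>J. d j = 9)" "\<And>j. j < length S \<Longrightarrow> d j = S ! j"
      unfolding has_first_digits_def decimal_expansion_def by (auto simp: powi_minus)
    define t where "t = (\<Sum>j. real (d j) / 10 ^ j)"
    have eq: "digit_sum d (length S) = string_value S"
      unfolding string_value_eq digit_sum_def using d(5) by (intro sum.cong) auto
    have t: "string_value S \<le> t" "t < string_value S + 10 / 10 ^ length S"
      using digit_series_bounds[OF d(3,4), of "length S"] by (simp_all add: t_def eq)
    have t10: "1 \<le> t" "t < 10"
      using t r digit_string_value(2)[OF S] by linarith+
    have "log 10 a = of_int M + log 10 t"
    proof -
      have "log 10 (10 powi M) = of_int M"
        using log_powr_cancel[of 10 "of_int M"] by (simp add: powr_real_of_int')
      thus ?thesis unfolding d(1) t_def[symmetric] using t10 by (subst log_mult) auto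
    qed
    moreover have "0 \<le> log 10 t" "log 10 t < 1" using t10 by (auto simp: log_less_one_cancel_iff)
    ultimately have "frac (log 10 a) = log 10 t"
      unfolding frac_unique_iff by simp
    thus "log 10 (string_value S) \<le> frac (log 10 a) \<and> frac (log 10 a) < log 10 (string_value S + 10 / 10 ^ length S)"
      using t t10 r by auto
  next
    assume *: "log 10 (string_value S) \<le> frac (log 10 a) \<and> frac (log 10 a) < log 10 (string_value S + 10 / 10 ^ length S)"
    define t where "t = 10 powr frac (log 10 a)"
    have tp: "t > 0" and logt: "log 10 t = frac (log 10 a)" by (simp_all add: t_def)
    have t: "string_value S \<le> t" "t < string_value S + 10 / 10 ^ length S"
      using * r rp tp unfolding logt[symmetric] by auto
    have t10: "1 \<le> t" "t < 10"
      using t r digit_string_value(2)[OF S] by linarith+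
    obtain d where d: "\<And>j. d j \<le> 9" "1 \<le> d 0" "\<not> (\<exists>J. \<forall>j\<ge>J. d j = 9)" "(\<Sum>j. real (d j) / 10 ^ j) = t"
      using exists_digits[OF t10] by metis
    \<comment> \<open>Once the earlier digits agree, both candidates for digit j give half-open
      intervals of length 10^(-j) on one grid; both contain t, so they coincide.\<close>
    have "d j = S ! j" if "j < length S" for j
      using that
    proof (induction j rule: less_induct)
      case (less j)
      define p where "p = digit_sum d j"
      have p: "digit_sum (\<lambda>j. S ! j) j = p"
        unfolding p_def digit_sum_def using less by (intro sum.cong) auto
      have 1: "p + real (d j) / 10 ^ j \<le> t" "t < p + real (d j) / 10 ^ j + 1 / 10 ^ j"
        using digit_series_bounds[OF d(1,3), of "Suc j"] unfolding d(4) digit_sum_Suc p_def[symmetric] by auto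
      have "digit_sum (\<lambda>j. S ! j) (Suc j) \<le> string_value S"
        unfolding string_value_eq by (rule digit_sum_mono) (use less in auto)
      moreover have "string_value S + 10 / 10 ^ length S \<le> digit_sum (\<lambda>j. S ! j) (Suc j) + 10 / 10 ^ Suc j"
        unfolding string_value_eq by (rule digit_sum_antimono) (use less S9 in auto)
      ultimately have 2: "p + real (S ! j) / 10 ^ j \<le> t" "t < p + real (S ! j) / 10 ^ j + 1 / 10 ^ j"
        using t unfolding digit_sum_Suc p by auto
      have "real (d j) / 10 ^ j < (real (S ! j) + 1) / 10 ^ j" "real (S ! j) / 10 ^ j < (real (d j) + 1) / 10 ^ j"
        using 1 2 unfolding add_divide_distrib by linarith+
      hence "real (d j) < real (S ! j) + 1" "real (S ! j) < real (d j) + 1"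
        by (simp_all add: divide_less_cancel)
      thus ?case by linarith
    qed
    moreover have "a = 10 powi \<lfloor>log 10 a\<rfloor> * (\<Sum>j. real (d j) / 10 ^ j)"
      unfolding d(4) t_def by (rule powr_frac_log[OF a])
    ultimately show "has_first_digits a S"
      unfolding has_first_digits_def decimal_expansion_def powi_minus
      using d by (intro exI[of _ "\<lfloor>log 10 a\<rfloor>"] exI[of _ d]) auto
  }
qed

section \<open>The divisor function\<close>

definition factorizations :: "nat \<Rightarrow> nat \<Rightarrow> nat list set" where
  "factorizations k n = {xs. length xs = k \<and> (\<forall>x\<in>set xs. 0 < x) \<and> prod_list xs = n}"

lemma divisor_fun_eq: "divisor_fun k n = card (factorizations k n)"
  by (simp add: divisor_fun_def factorizations_def)

lemma factorizations_0: "factorizations 0 n = (if n = 1 then {[]} else {})"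
  by (auto simp: factorizations_def)

lemma factorizations_Suc:
  assumes "n > 0"
  shows "factorizations (Suc k) n = (\<lambda>(d, xs). d # xs) ` (SIGMA d:{d. d dvd n}. factorizations k (n div d))"
proof
  show "factorizations (Suc k) n \<subseteq> (\<lambda>(d, xs). d # xs) ` (SIGMA d:{d. d dvd n}. factorizations k (n div d))"
  proof
    fix ys assume ys: "ys \<in> factorizations (Suc k) n"
    then obtain d xs where "ys = d # xs" by (auto simp: factorizations_def length_Suc_conv)
    with ys show "ys \<in> (\<lambda>(d, xs). d # xs) ` (SIGMA d:{d. d dvd n}. factorizations k (n div d))"
      by (intro image_eqI[of _ _ "(d, xs)"]) (auto simp: factorizations_def)
  qed
  show "(\<lambda>(d, xs). d # xs) ` (SIGMA d:{d. d dvd n}. factorizations k (n div d)) \<subseteq> factorizations (Suc k) n"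
    using assms by (auto simp: factorizations_def intro!: Nat.gr0I)
qed

lemma finite_factorizations: "n > 0 \<Longrightarrow> finite (factorizations k n)"
proof (induction k arbitrary: n)
  case (Suc k)
  have "finite (factorizations k (n div d))" if "d dvd n" for d
    using Suc.prems that by (intro Suc.IH) (auto simp: dvd_div_eq_0_iff intro!: Nat.gr0I)
  thus ?case unfolding factorizations_Suc[OF Suc.prems]
    using Suc.prems by (intro finite_imageI finite_SigmaI) auto
qed (simp add: factorizations_0)

lemma divisor_fun_Suc:
  assumes "n > 0"
  shows "divisor_fun (Suc k) n = (\<Sum>d | d dvd n. divisor_fun k (n div d))"
proof -
  have "finite (factorizations k (n div d))" if "d dvd n" for d
    using assms that by (intro finite_factorizations) (auto simp: dvd_div_eq_0_iff intro!: Nat.gr0I)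
  thus ?thesis
    unfolding divisor_fun_eq factorizations_Suc[OF assms] using assms
    by (subst card_image) (auto simp: inj_on_def card_SigmaI)
qed

lemma divisors_prime_mult:
  fixes p m :: nat
  assumes "prime p" "\<not> p dvd m"
  shows "{d. d dvd p * m} = {d. d dvd m} \<union> (\<lambda>d. p * d) ` {d. d dvd m}"
    and "{d. d dvd m} \<inter> (\<lambda>d. p * d) ` {d. d dvd m} = {}"
proof -
  show "{d. d dvd p * m} = {d. d dvd m} \<union> (\<lambda>d. p * d) ` {d. d dvd m}"
  proof (intro equalityI subsetI)
    fix d assume d: "d \<in> {d. d dvd p * m}"
    show "d \<in> {d. d dvd m} \<union> (\<lambda>d. p * d) ` {d. d dvd m}"
    proof (cases "p dvd d")
      case True
      then obtain e where "d = p * e" by blast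
      thus ?thesis using d assms(1) by (auto simp: prime_gt_0_nat)
    next
      case False
      hence "coprime d p" using assms(1) by (metis prime_imp_coprime coprime_commute)
      thus ?thesis using d by (simp add: coprime_dvd_mult_right_iff)
    qed
  qed auto
  show "{d. d dvd m} \<inter> (\<lambda>d. p * d) ` {d. d dvd m} = {}"
    using assms(2) by (auto dest: dvd_mult_left)
qed

text \<open>The divisors of p m are d and p d with d | m. In the step to k + 1 the first kind
  contributes k times \<open>divisor_fun (Suc k) m\<close> by induction, the second contributes it
  once.\<close>

lemma divisor_fun_prime_mult:
  assumes p: "prime p" and m: "\<not> p dvd m" "m > 0"
  shows "divisor_fun k (p * m) = k * divisor_fun k m"
  using m
proof (induction k arbitrary: m)
  case 0
  have "p * m \<noteq> 1" using p by (auto simp: prime_nat_iff)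
  thus ?case by (simp add: divisor_fun_eq factorizations_0)
next
  case (Suc k)
  have p0: "p > 0" using p by (simp add: prime_gt_0_nat)
  have fin: "finite {d. d dvd m}" using Suc.prems by simp
  have 1: "divisor_fun k (p * m div d) = k * divisor_fun k (m div d)" if d: "d dvd m" for d
  proof -
    have "p * m div d = p * (m div d)" using d by (simp add: div_mult_swap)
    moreover have "\<not> p dvd m div d" using Suc.prems d by (metis dvd_div_mult_self dvd_mult2)
    moreover have "m div d > 0" using Suc.prems d by (auto simp: dvd_div_eq_0_iff intro!: Nat.gr0I)
    ultimately show ?thesis using Suc.IH by simp
  qed
  have "divisor_fun (Suc k) (p * m) = (\<Sum>d | d dvd p * m. divisor_fun k (p * m div d))"
    by (rule divisor_fun_Suc) (use p0 Suc.prems in simp)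
  also have "\<dots> = (\<Sum>d | d dvd m. divisor_fun k (p * m div d)) +
                  (\<Sum>d\<in>(\<lambda>d. p * d) ` {d. d dvd m}. divisor_fun k (p * m div d))"
    unfolding divisors_prime_mult(1)[OF p Suc.prems(1)]
    using divisors_prime_mult(2)[OF p Suc.prems(1)] fin by (intro sum.union_disjoint) auto
  also have "(\<Sum>d\<in>(\<lambda>d. p * d) ` {d. d dvd m}. divisor_fun k (p * m div d)) = (\<Sum>d | d dvd m. divisor_fun k (m div d))"
    using p0 by (subst sum.reindex) (auto simp: inj_on_def)
  also have "(\<Sum>d | d dvd m. divisor_fun k (p * m div d)) = k * (\<Sum>d | d dvd m. divisor_fun k (m div d))"
    using 1 by (simp add: sum_distrib_left)
  also have "(\<Sum>d | d dvd m. divisor_fun k (m div d)) = divisor_fun (Suc k) m"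
    by (rule divisor_fun_Suc[symmetric]) (use Suc.prems in simp)
  finally show ?case by simp
qed

lemma divisor_fun_pos:
  assumes "k > 0" "n > 0"
  shows "divisor_fun k n > 0"
proof -
  have "n # replicate (k - 1) 1 \<in> factorizations k n"
    using assms by (auto simp: factorizations_def)
  thus ?thesis using finite_factorizations[OF assms(2)]
    unfolding divisor_fun_eq by (subst card_gt_0_iff) auto
qed

lemma prod_list_nat_eq_1: "prod_list xs = (1::nat) \<Longrightarrow> x \<in> set xs \<Longrightarrow> x = 1"
  by (induction xs) auto

text \<open>Prime factors are removed one at a time, each giving a factor k; i is the number of
  primes dividing n.\<close>

lemma divisor_fun_squarefree:
  assumes "squarefree n" "n > 0"
  shows "\<exists>i. divisor_fun k n = k ^ i"
  using assms
proof (induction n rule: less_induct)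
  case (less n)
  show ?case
  proof (cases "n = 1")
    case True
    have "factorizations k 1 = {replicate k 1}"
    proof (intro equalityI subsetI)
      fix xs assume xs: "xs \<in> factorizations k 1"
      hence "\<forall>x\<in>set xs. x = 1"
        using prod_list_nat_eq_1 unfolding factorizations_def by blast
      thus "xs \<in> {replicate k 1}"
        using xs by (auto simp: factorizations_def intro!: replicate_eqI)
    qed (auto simp: factorizations_def)
    thus ?thesis using True by (intro exI[of _ 0]) (simp add: divisor_fun_eq)
  next
    case False
    then obtain p where p: "prime p" "p dvd n" using prime_factor_nat by blast
    then obtain m where n: "n = p * m" by blast
    have m: "m > 0" using n less.prems by simp
    have "\<not> p dvd m"
    proof
      assume "p dvd m"
      hence "p ^ 2 dvd n" using n by (auto simp: power2_eq_square)
      hence "is_unit p" using less.prems(1) by (auto simp: squarefree_def)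
      thus False using p by auto
    qed
    moreover have "squarefree m" using less.prems n by (auto simp: squarefree_def)
    moreover have "m < n" using n m prime_gt_1_nat[OF p(1)] by simp
    ultimately show ?thesis
      using less.IH[of m] divisor_fun_prime_mult[OF p(1), of m k] m n by (metis power_Suc)
  qed
qed

section \<open>Lower density of the squarefree numbers\<close>

lemma sum_inverse_squares_le:
  "n \<ge> 4 \<Longrightarrow> (\<Sum>d=5..n. 1 / real d ^ 2) \<le> 1 / 4 - 1 / real n"
proof (induction n rule: dec_induct)
  case (step n)
  have "1 / real (Suc n) ^ 2 \<le> 1 / real n - 1 / real (Suc n)"
  proof -
    have "1 / real n - 1 / real (Suc n) = 1 / (real n * real (Suc n))"
      using step by (simp add: field_simps)
    also have "\<dots> \<ge> 1 / (real (Suc n) * real (Suc n))"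
      using step by (intro divide_left_mono mult_right_mono) auto
    finally show ?thesis by (simp add: power2_eq_square)
  qed
  moreover have "{5..Suc n} = insert (Suc n) {5..n}" using step by auto
  ultimately show ?case using step.IH by simp
qed simp

lemma card_square_multiples_le:
  "real (card {n\<in>{1..N}. d ^ 2 dvd n}) \<le> real N * (1 / real d ^ 2)"
proof -
  have "real (card {n\<in>{1..N}. d ^ 2 dvd n}) \<le> real (N div d ^ 2)"
    by (intro of_nat_mono card_multiples_le)
  also have "\<dots> \<le> real N / real (d ^ 2)" by (rule real_div_bounds)
  finally show ?thesis by simp
qed

text \<open>Union bound over squares: 1 - 1/4 - 1/9 - 1/4 = 7/18, the last 1/4 bounding the sum of 1
  / d^2 over d >= 5. Divisibility by 4^2 is subsumed under d = 2; leaving it out keeps the density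
  above 1/3 and so above log10 2.\<close>

lemma card_squarefree_ge:
  "real (card {n\<in>{1..N}. squarefree n}) \<ge> 7 / 18 * real N"
proof -
  define D where "D = {2, 3} \<union> {5..max 4 N}"
  have "{n\<in>{1..N}. \<not> squarefree n} \<subseteq> (\<Union>d\<in>D. {n\<in>{1..N}. d ^ 2 dvd n})"
  proof
    fix n assume n: "n \<in> {n\<in>{1..N}. \<not> squarefree n}"
    then obtain d where d: "d ^ 2 dvd n" "d \<noteq> 1" by (auto simp: squarefree_def)
    have "d \<noteq> 0"
    proof
      assume "d = 0"
      with d n show False by simp
    qed
    have "d ^ 2 \<le> n" using d n by (auto intro: dvd_imp_le)
    moreover have "d \<le> d ^ 2" by (simp add: power2_eq_square)
    ultimately have dN: "d \<le> N" using n by simp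
    show "n \<in> (\<Union>d\<in>D. {n\<in>{1..N}. d ^ 2 dvd n})"
    proof (cases "d = 4")
      case True
      have "(2::nat) ^ 2 dvd d ^ 2" unfolding True by simp
      hence "2 ^ 2 dvd n" using d(1) by (rule dvd_trans)
      thus ?thesis using n by (auto simp: D_def)
    next
      case False
      hence "d \<in> D" using d \<open>d \<noteq> 0\<close> dN by (auto simp: D_def)
      thus ?thesis using n d by auto
    qed
  qed
  hence "card {n\<in>{1..N}. \<not> squarefree n} \<le> card (\<Union>d\<in>D. {n\<in>{1..N}. d ^ 2 dvd n})"
    by (intro card_mono) (auto simp: D_def)
  also have "\<dots> \<le> (\<Sum>d\<in>D. card {n\<in>{1..N}. d ^ 2 dvd n})"
    by (rule card_UN_le) (auto simp: D_def)
  finally have "real (card {n\<in>{1..N}. \<not> squarefree n}) \<le> (\<Sum>d\<in>D. real (card {n\<in>{1..N}. d ^ 2 dvd n}))"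
    unfolding of_nat_sum[symmetric] by (rule of_nat_mono)
  also have "\<dots> \<le> (\<Sum>d\<in>D. real N * (1 / real d ^ 2))"
    by (intro sum_mono card_square_multiples_le)
  also have "\<dots> = real N * (\<Sum>d\<in>D. 1 / real d ^ 2)"
    by (rule sum_distrib_left[symmetric])
  also have "(\<Sum>d\<in>D. 1 / real d ^ 2) = 1 / 4 + 1 / 9 + (\<Sum>d=5..max 4 N. 1 / real d ^ 2)"
    unfolding D_def by (subst sum.union_disjoint) auto
  also have "real N * \<dots> \<le> real N * (11 / 18)"
  proof (intro mult_left_mono)
    have "0 \<le> 1 / real (max 4 N)" by simp
    thus "1 / 4 + 1 / 9 + (\<Sum>d=5..max 4 N. 1 / real d ^ 2) \<le> 11 / 18"
      using sum_inverse_squares_le[of "max 4 N"] by linarith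
  qed simp
  finally have *: "real (card {n\<in>{1..N}. \<not> squarefree n}) \<le> 11 / 18 * real N" by simp
  define A where "A = {n\<in>{1..N}. squarefree n}"
  define B where "B = {n\<in>{1..N}. \<not> squarefree n}"
  have "{1..N} = A \<union> B" by (auto simp: A_def B_def)
  moreover have "card (A \<union> B) = card A + card B"
    by (rule card_Un_disjoint) (auto simp: A_def B_def)
  ultimately have "card {1..N} = card A + card B" by simp
  hence "real N = real (card A) + real (card B)" by simp
  thus ?thesis using * unfolding A_def[symmetric] B_def[symmetric] by linarith
qed

text \<open>The primes 2 and 5 divide a power of k and hence k, so a factor 10 splits off and the
  induction continues with k / 10.\<close>

lemma power_eq_power_10:
  assumes "k ^ h = 10 ^ m" "h > 0" "k > (1::nat)"
  shows "\<exists>j\<ge>1. k = 10 ^ j"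
  using assms
proof (induction k arbitrary: m rule: less_induct)
  case (less k)
  have "m \<noteq> 0"
  proof
    assume "m = 0"
    hence "k ^ h = 1" using less.prems by simp
    thus False using less.prems by simp
  qed
  hence "2 dvd (10::nat) ^ m" "5 dvd (10::nat) ^ m"
    by (auto simp: prime_dvd_power_nat_iff intro!: dvd_power_iff[THEN iffD2] dvd_trans[OF _ dvd_power[of m 10]])
  hence "2 dvd k ^ h" "5 dvd k ^ h" using less.prems by simp_all
  moreover have "prime (2::nat)" "prime (5::nat)" by simp_all
  ultimately have "2 dvd k" "5 dvd k" using prime_dvd_power by blast+
  moreover have "coprime 2 (5::nat)" by simp
  ultimately have "2 * 5 dvd k" by (rule divides_mult)
  then obtain k' where k': "k = 10 * k'" by auto
  show ?case
  proof (cases "k' = 1")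
    case True
    thus ?thesis using k' by (intro exI[of _ 1]) simp
  next
    case False
    hence "k' > 1" using k' less.prems by simp
    have eq: "10 ^ h * k' ^ h = 10 ^ m" using less.prems k' by (simp add: power_mult_distrib)
    have "(10::nat) ^ h \<le> 10 ^ m" using eq \<open>k' > 1\<close> by (metis dvd_imp_le dvd_triv_left zero_less_numeral zero_less_power)
    hence "h \<le> m" by (simp add: power_increasing_iff)
    hence "(10::nat) ^ m = 10 ^ h * 10 ^ (m - h)" by (simp add: power_add[symmetric])
    hence "k' ^ h = 10 ^ (m - h)" using eq by simp
    moreover have "k' < k" using k' \<open>k' > 1\<close> by simp
    ultimately obtain j where "j \<ge> 1" "k' = 10 ^ j" using less.IH[of k' "m - h"] less.prems \<open>k' > 1\<close> by blast
    thus ?thesis using k' by (intro exI[of _ "Suc j"]) simp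
  qed
qed

section \<open>Strong Benford behaviour of the divisor functions\<close>

text \<open>An integer value n would give k^h = 10^n after exponentiating. This is the condition z
  \<noteq> 1 at frequency h.\<close>

lemma log_10_multiple_not_int:
  assumes "k > 1" and no_pow: "\<And>j::nat. 1 \<le> j \<Longrightarrow> k \<noteq> 10 ^ j" and h: "h > (0::nat)"
  shows "real h * log 10 (real k) \<noteq> of_int n"
proof
  assume eq: "real h * log 10 (real k) = of_int n"
  have k: "real k > 1" using assms(1) by simp
  have "0 \<le> real h * log 10 (real k)" using k by (intro mult_nonneg_nonneg) auto
  hence n: "n \<ge> 0" unfolding eq by simp
  have "10 powr (real h * log 10 (real k)) = (10 powr log 10 (real k)) powr real h"
    by (simp only: powr_powr mult.commute)
  also have "\<dots> = real k ^ h" using k by (simp add: powr_realpow)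
  finally have "real k ^ h = 10 powr (real h * log 10 (real k))" ..
  also have "\<dots> = 10 ^ nat n"
    unfolding eq using n powr_realpow[of 10 "nat n"] by simp
  finally have "real (k ^ h) = real (10 ^ nat n)" by simp
  hence "k ^ h = 10 ^ nat n" by (simp only: of_nat_eq_iff)
  thus False using power_eq_power_10[OF _ h assms(1)] no_pow by blast
qed

lemma divisor_fun_weyl:
  assumes k: "k > 1" and no_pow: "\<And>j::nat. 1 \<le> j \<Longrightarrow> k \<noteq> 10 ^ j"
  shows "weyl_sequence (\<lambda>n. log 10 (real (divisor_fun k n)))"
proof
  fix h :: nat assume h: "h > 0"
  define \<alpha> where "\<alpha> = log 10 (real k)"
  define f where "f = (\<lambda>n. cis (2 * pi * real h * log 10 (real (divisor_fun k n))))"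
  interpret prime_eigenfunction f "cis (2 * pi * real h * \<alpha>)"
  proof
    fix p m :: nat assume pm: "prime p" "\<not> p dvd m" "m > 0"
    have pos: "real (divisor_fun k m) > 0" using divisor_fun_pos[of k m] k pm by simp
    have "log 10 (real (divisor_fun k (p * m))) = \<alpha> + log 10 (real (divisor_fun k m))"
      unfolding divisor_fun_prime_mult[OF pm] \<alpha>_def using pos k by (simp add: log_mult)
    thus "f (p * m) = cis (2 * pi * real h * \<alpha>) * f m"
      by (simp add: f_def cis_mult distrib_left)
  qed (simp_all add: f_def)
  have "cis (2 * pi * real h * \<alpha>) \<noteq> 1"
  proof
    assume "cis (2 * pi * real h * \<alpha>) = 1"
    hence "cos (2 * pi * real h * \<alpha>) = 1" by (simp add: complex_eq_iff)
    then obtain n :: int where "2 * pi * real h * \<alpha> = of_int n * 2 * pi"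
      using cos_one_2pi_int by auto
    hence n: "2 * pi * (real h * \<alpha>) = 2 * pi * of_int n" by (simp only: mult_ac)
    have "real h * \<alpha> = (2 * pi * (real h * \<alpha>)) / (2 * pi)" by simp
    also have "\<dots> = of_int n" unfolding n by simp
    finally show False using log_10_multiple_not_int[OF k no_pow h, of n] by (simp add: \<alpha>_def)
  qed
  from mean_tendsto_0[OF this]
  show "(\<lambda>N. (\<Sum>n=1..N. cis (2 * pi * real h * log 10 (real (divisor_fun k n)))) / of_nat N) \<longlonglongrightarrow> 0"
    by (simp add: f_def)
qed

lemma powi_one_minus: "(10::real) powi (1 - int n) = 10 / 10 ^ n"
  by (simp add: power_int_diff)

lemma strong_benfordI:
  assumes pos: "\<And>n. n > 0 \<Longrightarrow> a n > 0" and weyl: "weyl_sequence (\<lambda>n. log 10 (a n))"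
  shows "strong_benford a"
  unfolding strong_benford_def
proof (intro conjI allI impI)
  fix S assume S: "digit_string S"
  define r where "r = string_value S"
  define r' where "r' = r + 10 / 10 ^ length S"
  have r: "1 \<le> r" "r < r'" "r' \<le> 10"
    using digit_string_value[OF S] by (simp_all add: r_def r'_def)
  have eq: "{m\<in>{1..N}. has_first_digits (a m) S} =
      {n\<in>{1..N}. log 10 r \<le> frac (log 10 (a n)) \<and> frac (log 10 (a n)) < log 10 r'}" for N
    using has_first_digits_iff[OF pos S] unfolding r_def r'_def by auto
  have "log 10 r' \<le> log 10 10" using r by (intro log_mono) auto
  hence ab: "0 \<le> log 10 r" "log 10 r < log 10 r'" "log 10 r' \<le> 1" using r by auto
  show "(\<lambda>N. real (card {m\<in>{1..N}. has_first_digits (a m) S}) / real N)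
      \<longlonglongrightarrow> log 10 (string_value S + 10 powi (1 - int (length S))) - log 10 (string_value S)"
    unfolding eq powi_one_minus r_def[symmetric] r'_def[symmetric]
    by (rule weyl_sequence.weyl_density[OF weyl ab])
qed (use pos in auto)

lemma divisor_fun_power_10_not_benford:
  assumes j: "j > 0"
  shows "\<not> strong_benford (\<lambda>n. real (divisor_fun (10 ^ j) n))"
proof
  assume benford: "strong_benford (\<lambda>n. real (divisor_fun (10 ^ j) n))"
  have S: "digit_string [1]" by (simp add: digit_string_def)
  have sv: "string_value [1] = 1" by (simp add: string_value_def)
  define c where "c = (\<lambda>N. real (card {m\<in>{1..N}. has_first_digits (real (divisor_fun (10 ^ j) m)) [1]}) / real N)"
  have lim: "c \<longlonglongrightarrow> log 10 2"
    using benford S unfolding strong_benford_def c_def by (auto simp: sv[unfolded One_nat_def] dest!: spec[of _ "[1]"])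
  have "7 / 18 \<le> c N" if N: "N > 0" for N
  proof -
    have "has_first_digits (real (divisor_fun (10 ^ j) n)) [1]" if n: "squarefree n" "n > 0" for n
    proof -
      obtain i where i: "divisor_fun (10 ^ j) n = (10 ^ j) ^ i"
        using divisor_fun_squarefree[OF n] by blast
      have pos: "real (divisor_fun (10 ^ j) n) > 0" unfolding i by simp
      have "log 10 (real (divisor_fun (10 ^ j) n)) = real (j * i)"
        unfolding i by (simp add: power_mult[symmetric] log_nat_power)
      hence fr: "frac (log 10 (real (divisor_fun (10 ^ j) n))) = 0" by simp
      show ?thesis unfolding has_first_digits_iff[OF pos S] fr sv by simp
    qed
    hence "{n\<in>{1..N}. squarefree n} \<subseteq> {m\<in>{1..N}. has_first_digits (real (divisor_fun (10 ^ j) m)) [1]}"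
      by auto
    hence "card {n\<in>{1..N}. squarefree n} \<le> card {m\<in>{1..N}. has_first_digits (real (divisor_fun (10 ^ j) m)) [1]}"
      by (intro card_mono) auto
    hence "7 / 18 * real N \<le> real (card {m\<in>{1..N}. has_first_digits (real (divisor_fun (10 ^ j) m)) [1]})"
      using card_squarefree_ge[of N] by linarith
    thus ?thesis using N by (simp add: c_def pos_le_divide_eq)
  qed
  hence "7 / 18 \<le> log 10 (2::real)"
    by (intro LIMSEQ_le_const[OF lim] exI[of _ 1]) auto
  \<comment> \<open>From 2^3 <= 10; the bound 1/3 is enough because 1/3 < 7/18.\<close>
  moreover have "3 * log 10 (2::real) \<le> 1"
  proof -
    have "3 * log 10 (2::real) = log 10 (2 ^ 3)" by (subst log_nat_power) auto
    also have "\<dots> \<le> log 10 10" by (intro log_mono) auto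
    finally show ?thesis by simp
  qed
  ultimately show False by linarith
qed

theorem corollary1p4:
  fixes k :: nat
  assumes "k \<ge> 2"
  shows "strong_benford (\<lambda>n. real (divisor_fun k n)) \<longleftrightarrow> (\<forall>j::nat. 1 \<le> j \<longrightarrow> k \<noteq> 10 ^ j)"
proof
  assume "strong_benford (\<lambda>n. real (divisor_fun k n))"
  thus "\<forall>j::nat. 1 \<le> j \<longrightarrow> k \<noteq> 10 ^ j"
    using divisor_fun_power_10_not_benford by (auto simp: Suc_le_eq)
next
  assume "\<forall>j::nat. 1 \<le> j \<longrightarrow> k \<noteq> 10 ^ j"
  hence "weyl_sequence (\<lambda>n. log 10 (real (divisor_fun k n)))"
    using assms by (intro divisor_fun_weyl) auto
  moreover have "real (divisor_fun k n) > 0" if "n > 0" for n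
    using divisor_fun_pos[of k n] assms that by simp
  ultimately show "strong_benford (\<lambda>n. real (divisor_fun k n))"
    by (intro strong_benfordI)
qed

end
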